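(* Let $F$ be a free group with ordered basis $\{x_1<\dots<x_m\}$, let $e_1,\dots,e_m\ge 0$ be integers with $e_m\,|\,e_{m-1}\,|\,\cdots\,|\,e_1$, let $S=\langle x_1^{e_1},\dots,x_m^{e_m},\gamma_2(F)\rangle$, and let $R$ be a normal subgroup of $F$ satisfying $R\gamma_2(F)=S$. Then: (i) $D(4,\mathfrak f\mathfrak r\mathfrak f)$ is the subgroup generated, modulo $\gamma_4(F)$, by the elements of the types - $[[x_j,x_i],x_k]^{e_i}$, $i,j,k\in\{1,\dots,m\}$, $j>i$; - $[[x_j,x_i],x_j]^{e}$, $j>i$, $e_j\,|\,e$, $e_i\,|\,2e$. (ii) $D(4,\mathfrak r\mathfrak f\mathfrak r)$ is the subgroup generated, modulo $\gamma_4(F)$, by the elements of the types - $[[x_j,x_i],x_k]^{e_ie_k}$, $i,j,k\in\{1,\dots,m\}$, $j>i$; - $[[x_j,x_i],x_i]^{e}$, $j>i$, $(e_je_i)\,|\,e$, $e_i^2\,|\,2e$. (iii) $D(4,\mathfrak r^2\mathfrak f+\mathfrak r\mathfrak f\mathfrak r+\mathfrak f\mathfrak r^2)=[[F,R],R]\,\gamma_4(F)$. (iv) $D(4,\mathfrak f^2\mathfrak r+\mathfrak r\mathfrak f^2)$ is the subgroup generated, modulo $\gamma_4(F)$, by the elements $[[x_j,x_i],x_k]^e$ where $j>i\le k$ and: $e_k\,|\,e$ if $k\ne i$; and, when $k=i$, $e_j\,|\,e$ and $e_i\,|\,2e$.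
   Context: $\mathbb Z[F]$ is the integral group ring, $\mathfrak f$ its augmentation ideal, and for a normal subgroup $R$ of $F$, $\mathfrak r$ denotes the augmentation ideal of $\mathbb Z[R]$, regarded inside $\mathbb Z[F]$; products such as $\mathfrak f\mathfrak r\mathfrak f$, $\mathfrak r^2\mathfrak f$ are the additive subgroups spanned by the corresponding products of elements (they are two-sided ideals of $\mathbb Z[F]$). For a two-sided ideal $\mathfrak a$ of $\mathbb Z[F]$, $D(n,\mathfrak a):=F\cap(1+\mathfrak a+\mathfrak f^n)$, a normal subgroup of $F$. $\gamma_n(F)$ is the $n$th term of the lower central series. "A subgroup $D$ is generated, modulo $\gamma_4(F)$, by a set $T$" means $D=\langle T\rangle\gamma_4(F)$. The exponents $e$ are integers; $0\,|\,n$ iff $n=0$. *)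

theory Defs
  imports "HOL-Algebra.Algebra"
begin

(* A letter (i, True) stands for x i, and (i, False) for the inverse of x i. *)

definition word_val :: "('a, 'b) monoid_scheme \<Rightarrow> ('i \<Rightarrow> 'a) \<Rightarrow> ('i \<times> bool) list \<Rightarrow> 'a" where
  "word_val G x w =
     foldr (\<lambda>(i, b) g. (if b then x i else inv\<^bsub>G\<^esub> (x i)) \<otimes>\<^bsub>G\<^esub> g) w \<one>\<^bsub>G\<^esub>"

definition reduced_word :: "('i \<times> bool) list \<Rightarrow> bool" where
  "reduced_word w \<longleftrightarrow> successively (\<lambda>(i, b) (j, c). \<not> (i = j \<and> b \<noteq> c)) w"

(* The family x on I is a basis: every element has a unique expression as a reduced word. Uniqueness
   for words of length one makes x injective on I. *)
definition free_group_on :: "('a, 'b) monoid_scheme \<Rightarrow> 'i set \<Rightarrow> ('i \<Rightarrow> 'a) \<Rightarrow> bool" where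
  "free_group_on G I x \<longleftrightarrow>
     group G \<and> x ` I \<subseteq> carrier G \<and>
     bij_betw (word_val G x) {w \<in> lists (I \<times> UNIV). reduced_word w} (carrier G)"

(* The convention [g, h] = g^-1 h^-1 g h, unlike the g h g^-1 h^-1 of derived_set. The choice does
   not affect threefold commutators modulo the fourth term of the lower central series. *)
definition commutator :: "('a, 'b) monoid_scheme \<Rightarrow> 'a \<Rightarrow> 'a \<Rightarrow> 'a" where
  "commutator G g h = inv\<^bsub>G\<^esub> g \<otimes>\<^bsub>G\<^esub> inv\<^bsub>G\<^esub> h \<otimes>\<^bsub>G\<^esub> g \<otimes>\<^bsub>G\<^esub> h"

definition commutator_subgroup :: "('a, 'b) monoid_scheme \<Rightarrow> 'a set \<Rightarrow> 'a set \<Rightarrow> 'a set" where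
  "commutator_subgroup G H K = generate G {commutator G h k | h k. h \<in> H \<and> k \<in> K}"

(* Indexed so that the first term is the whole group; the value at 0 is not meaningful. *)
fun lower_central :: "('a, 'b) monoid_scheme \<Rightarrow> nat \<Rightarrow> 'a set" where
  "lower_central G 0 = carrier G"
| "lower_central G (Suc 0) = carrier G"
| "lower_central G (Suc (Suc n)) =
     commutator_subgroup G (lower_central G (Suc n)) (carrier G)"

(* Elements of the integral group ring are the finitely supported functions to the integers that
   vanish outside the carrier; the product is convolution. *)
definition group_ring :: "('a, 'b) monoid_scheme \<Rightarrow> ('a \<Rightarrow> int) ring" where
  "group_ring G =
     \<lparr> carrier = {f. finite {g. f g \<noteq> 0} \<and> {g. f g \<noteq> 0} \<subseteq> carrier G},
       monoid.mult = (\<lambda>f h x. \<Sum>y | f y \<noteq> 0. \<Sum>z | h z \<noteq> 0. if y \<otimes>\<^bsub>G\<^esub> z = x then f y * h z else 0),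
       monoid.one = (\<lambda>x. if x = \<one>\<^bsub>G\<^esub> then 1 else 0),
       ring.zero = (\<lambda>x. 0),
       ring.add = (\<lambda>f h x. f x + h x) \<rparr>"

definition group_ring_of :: "'a \<Rightarrow> 'a \<Rightarrow> int" where
  "group_ring_of g = (\<lambda>x. if x = g then 1 else 0)"

(* For a subgroup H of G, the group ring of G\<lparr>carrier := H\<rparr> consists of the elements of the group
   ring of G supported on H, so its augmentation ideal is already a subset of the group ring of G. *)
definition augmentation_ideal :: "('a, 'b) monoid_scheme \<Rightarrow> ('a \<Rightarrow> int) set" where
  "augmentation_ideal G = {f \<in> carrier (group_ring G). (\<Sum>g | f g \<noteq> 0. f g) = 0}"

(* The additive subgroup spanned by the products. The library's ideal_prod is not used, since the
   factors need not be ideals. *)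
definition span_prod :: "('a, 'b) ring_scheme \<Rightarrow> 'a set \<Rightarrow> 'a set \<Rightarrow> 'a set"
    (infixl "\<bullet>\<index>" 70) where
  "span_prod A U V = generate (add_monoid A) (U <#>\<^bsub>A\<^esub> V)"

primrec span_power :: "('a, 'b) ring_scheme \<Rightarrow> 'a set \<Rightarrow> nat \<Rightarrow> 'a set" where
  "span_power A U 0 = carrier A"
| "span_power A U (Suc n) = span_prod A (span_power A U n) U"

definition ideal_dimension_subgroup ::
    "('a, 'b) monoid_scheme \<Rightarrow> nat \<Rightarrow> ('a \<Rightarrow> int) set \<Rightarrow> 'a set" where
  "ideal_dimension_subgroup G n U =
     {g \<in> carrier G.
        group_ring_of g \<in>
          {\<one>\<^bsub>group_ring G\<^esub>} <+>\<^bsub>group_ring G\<^esub>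
            (U <+>\<^bsub>group_ring G\<^esub> span_power (group_ring G) (augmentation_ideal G) n)}"

definition generated_modulo :: "('a, 'b) monoid_scheme \<Rightarrow> 'a set \<Rightarrow> 'a set \<Rightarrow> 'a set" where
  "generated_modulo G N T = generate G T <#>\<^bsub>G\<^esub> N"

end

theory Submission
  imports Defs
begin

text \<open>
  The Magnus expansion \<open>x\<^sub>i \<mapsto> 1 + X\<^sub>i\<close> extends linearly to the group ring, and an element lies in
  the \<open>n\<close>th power of the augmentation ideal iff its coefficients of degree less than \<open>n\<close> vanish.
  All four ideals lie in the cube of the augmentation ideal, and modulo its fourth power each of them
  is spanned by multiples \<open>d\<^sub>i\<^sub>j\<^sub>k X\<^sub>i X\<^sub>j X\<^sub>k\<close>, since the ideal of \<open>R\<close> has image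
  spanned by the \<open>e\<^sub>i X\<^sub>i\<close> in degree one. Hence the dimension subgroup consists of those elements
  of the third term of the lower central series whose degree three coefficients are divisible by the
  \<open>d\<^sub>i\<^sub>j\<^sub>k\<close>. On the other hand, the third lower central factor has bases of threefold commutators of
  generators whose coordinates are Magnus coefficients, so the divisibility conditions can be read
  off coordinate by coordinate. In the first case the basis with \<open>k \<le> j\<close> is used,
  since in the usual one with \<open>i \<le> k\<close> the conditions would couple two coordinates.
\<close>

section \<open>Linear extension and the group ring\<close>

text \<open>The hard direction is that vanishing coefficients force an element into a lower central
  term; this is a form of the Magnus-Witt theorem. It is obtained degree by degree, up to degree
  three: modulo the next term, every element equals a product of fixed commutators whose exponents
  are, up to sign, its own Magnus coefficients. Zero exponents then give membership in the next
  term, and exponents divisible by prescribed numbers give membership in the subgroup generated by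
  the corresponding powers. The products are formed in the center of the quotient, where order does
  not matter, and the formula is checked on generators, one argument of the commutator at a time.
  The conditions on 2e come from the Lie polynomial [[X_j, X_i], X_i], in which X_i X_j X_i has
  coefficient -2, and from its mirror image. Of R only the linear part of its expansion enters, and
  this part is fixed by the equation for S even when R does not contain the powers of the generators
  themselves.\<close>

definition linear_extension :: "('a \<Rightarrow> int) \<Rightarrow> ('a \<Rightarrow> int) \<Rightarrow> int" where
  "linear_extension \<phi> u = (\<Sum>g | u g \<noteq> 0. u g * \<phi> g)"

lemma linear_extension_superset:
  assumes "finite A" "{g. u g \<noteq> 0} \<subseteq> A"
  shows "linear_extension \<phi> u = (\<Sum>g\<in>A. u g * \<phi> g)"
  unfolding linear_extension_def by (rule sum.mono_neutral_left) (use assms in auto)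

lemma linear_extension_cong: "(\<And>g. u g \<noteq> 0 \<Longrightarrow> \<phi> g = \<psi> g) \<Longrightarrow> linear_extension \<phi> u = linear_extension \<psi> u"
  unfolding linear_extension_def by (rule sum.cong) auto

lemma linear_extension_add:
  assumes "finite {g. u g \<noteq> 0}" "finite {g. v g \<noteq> 0}"
  shows "linear_extension \<phi> (\<lambda>g. u g + v g) = linear_extension \<phi> u + linear_extension \<phi> v"
proof -
  let ?A = "{g. u g \<noteq> 0} \<union> {g. v g \<noteq> 0}"
  have "linear_extension \<phi> w = (\<Sum>g\<in>?A. w g * \<phi> g)" if "{g. w g \<noteq> 0} \<subseteq> ?A" for w
    by (rule linear_extension_superset) (use assms that in auto)
  then show ?thesis by (simp add: sum.distrib algebra_simps subset_iff)
qed

lemma linear_extension_uminus: "linear_extension \<phi> (\<lambda>g. - u g) = - linear_extension \<phi> u"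
  by (simp add: linear_extension_def sum_negf)

lemma linear_extension_fun_add: "linear_extension (\<lambda>g. \<phi> g + \<psi> g) u = linear_extension \<phi> u + linear_extension \<psi> u"
  by (simp add: linear_extension_def sum.distrib algebra_simps)

lemma linear_extension_fun_mult: "linear_extension (\<lambda>g. k * \<phi> g) u = k * linear_extension \<phi> u"
  unfolding linear_extension_def sum_distrib_left by (rule sum.cong) auto

lemma linear_extension_fun_mult_right: "linear_extension (\<lambda>g. \<phi> g * k) u = linear_extension \<phi> u * k"
  unfolding linear_extension_def sum_distrib_right by (rule sum.cong) auto

lemma linear_extension_group_ring_of [simp]: "linear_extension \<phi> (group_ring_of g) = \<phi> g"
  by (simp add: linear_extension_def group_ring_of_def)

lemma linear_extension_zero [simp]: "linear_extension \<phi> (\<lambda>g. 0) = 0"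
  by (simp add: linear_extension_def)

section \<open>Convolution and the ring structure\<close>

lemma group_ring_carrier:
  "u \<in> carrier (group_ring G) \<longleftrightarrow> finite {g. u g \<noteq> 0} \<and> {g. u g \<noteq> 0} \<subseteq> carrier G"
  by (simp add: group_ring_def)

lemma group_ring_zero: "\<zero>\<^bsub>group_ring G\<^esub> = (\<lambda>x. 0)"
  by (simp add: group_ring_def)

lemma group_ring_one: "\<one>\<^bsub>group_ring G\<^esub> = group_ring_of \<one>\<^bsub>G\<^esub>"
  by (simp add: group_ring_def group_ring_of_def)

lemma group_ring_add: "u \<oplus>\<^bsub>group_ring G\<^esub> v = (\<lambda>x. u x + v x)"
  by (simp add: group_ring_def)

text \<open>Writing convolution through extensions of indicator functions reduces the ring axioms to
  linearity of the extension and its behaviour on products.\<close>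

lemma group_ring_mult:
  "(u \<otimes>\<^bsub>group_ring G\<^esub> v) x = linear_extension (\<lambda>y. linear_extension (\<lambda>z. of_bool (y \<otimes>\<^bsub>G\<^esub> z = x)) v) u"
  by (auto simp: group_ring_def linear_extension_def sum_distrib_left intro!: sum.cong)

context group
begin

lemma group_ring_mult_supp:
  "{g. (u \<otimes>\<^bsub>group_ring G\<^esub> v) g \<noteq> 0} \<subseteq> (\<lambda>(y, z). y \<otimes> z) ` ({g. u g \<noteq> 0} \<times> {g. v g \<noteq> 0})"
proof
  fix g assume g: "g \<in> {g. (u \<otimes>\<^bsub>group_ring G\<^esub> v) g \<noteq> 0}"
  then obtain y where y: "u y \<noteq> 0" "linear_extension (\<lambda>z. of_bool (y \<otimes> z = g)) v \<noteq> 0"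
    unfolding group_ring_mult linear_extension_def[of _ u] by (auto elim!: sum.not_neutral_contains_not_neutral)
  then obtain z where "v z \<noteq> 0" "y \<otimes> z = g"
    unfolding linear_extension_def by (auto elim!: sum.not_neutral_contains_not_neutral)
  with y show "g \<in> (\<lambda>(y, z). y \<otimes> z) ` ({g. u g \<noteq> 0} \<times> {g. v g \<noteq> 0})" by force
qed

lemma group_ring_mult_closed:
  assumes "u \<in> carrier (group_ring G)" "v \<in> carrier (group_ring G)"
  shows "u \<otimes>\<^bsub>group_ring G\<^esub> v \<in> carrier (group_ring G)"
proof -
  have "finite ((\<lambda>(y, z). y \<otimes> z) ` ({g. u g \<noteq> 0} \<times> {g. v g \<noteq> 0}))"
    using assms by (simp add: group_ring_carrier)
  moreover have "(\<lambda>(y, z). y \<otimes> z) ` ({g. u g \<noteq> 0} \<times> {g. v g \<noteq> 0}) \<subseteq> carrier G"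
    using assms by (force simp: group_ring_carrier)
  ultimately show ?thesis
    using group_ring_mult_supp[of u v] unfolding group_ring_carrier
    by (meson finite_subset order_trans)
qed

text \<open>A pair of support points y, z contributes only at the single point y z, so the sum over
  the product set collapses to a double sum. This carries identities between group elements over to
  the group ring: associativity first, multiplicativity of Magnus coefficients later.\<close>

lemma linear_extension_mult:
  assumes "u \<in> carrier (group_ring G)" "v \<in> carrier (group_ring G)"
  shows "linear_extension \<phi> (u \<otimes>\<^bsub>group_ring G\<^esub> v) = linear_extension (\<lambda>y. linear_extension (\<lambda>z. \<phi> (y \<otimes> z)) v) u"
proof -
  let ?A = "{g. u g \<noteq> 0}" and ?B = "{g. v g \<noteq> 0}"
  let ?C = "(\<lambda>(y, z). y \<otimes> z) ` (?A \<times> ?B)"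
  have fin: "finite ?A" "finite ?B" using assms by (auto simp: group_ring_carrier)
  have "linear_extension \<phi> (u \<otimes>\<^bsub>group_ring G\<^esub> v) = (\<Sum>x\<in>?C. (u \<otimes>\<^bsub>group_ring G\<^esub> v) x * \<phi> x)"
    by (rule linear_extension_superset) (use fin group_ring_mult_supp[of u v] in auto)
  also have "\<dots> = (\<Sum>x\<in>?C. \<Sum>y\<in>?A. \<Sum>z\<in>?B. u y * v z * of_bool (y \<otimes> z = x) * \<phi> x)"
    by (simp add: group_ring_mult linear_extension_def sum_distrib_left sum_distrib_right ac_simps)
  also have "\<dots> = (\<Sum>y\<in>?A. \<Sum>z\<in>?B. \<Sum>x\<in>?C. u y * v z * of_bool (y \<otimes> z = x) * \<phi> x)"
    by (subst sum.swap, rule sum.cong[OF refl], subst sum.swap) (rule refl)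
  also have "\<dots> = (\<Sum>y\<in>?A. \<Sum>z\<in>?B. u y * v z * \<phi> (y \<otimes> z))"
  proof (intro sum.cong refl)
    fix y z assume "y \<in> ?A" "z \<in> ?B"
    then have "y \<otimes> z \<in> ?C" by force
    then have "(\<Sum>x\<in>?C. if y \<otimes> z = x then u y * v z * \<phi> x else 0) = u y * v z * \<phi> (y \<otimes> z)"
      using fin by (subst sum.delta') auto
    moreover have "u y * v z * of_bool (y \<otimes> z = x) * \<phi> x = (if y \<otimes> z = x then u y * v z * \<phi> x else 0)" for x
      by simp
    ultimately show "(\<Sum>x\<in>?C. u y * v z * of_bool (y \<otimes> z = x) * \<phi> x) = u y * v z * \<phi> (y \<otimes> z)"
      by simp
  qed
  also have "\<dots> = linear_extension (\<lambda>y. linear_extension (\<lambda>z. \<phi> (y \<otimes> z)) v) u"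
    by (simp add: linear_extension_def sum_distrib_left ac_simps)
  finally show ?thesis .
qed

lemma group_ring_of_closed: "g \<in> carrier G \<Longrightarrow> group_ring_of g \<in> carrier (group_ring G)"
  by (auto simp: group_ring_carrier group_ring_of_def)

lemma group_ring_is_ring: "ring (group_ring G)"
proof (rule ringI)
  have add_closed: "u \<oplus>\<^bsub>group_ring G\<^esub> v \<in> carrier (group_ring G)"
    if "u \<in> carrier (group_ring G)" "v \<in> carrier (group_ring G)" for u v
  proof -
    have "{g. u g + v g \<noteq> 0} \<subseteq> {g. u g \<noteq> 0} \<union> {g. v g \<noteq> 0}" by auto
    moreover have "finite ({g. u g \<noteq> 0} \<union> {g. v g \<noteq> 0})" "{g. u g \<noteq> 0} \<union> {g. v g \<noteq> 0} \<subseteq> carrier G"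
      using that by (auto simp: group_ring_carrier)
    ultimately show ?thesis unfolding group_ring_carrier group_ring_add by (meson finite_subset order_trans)
  qed
  show "abelian_group (group_ring G)"
  proof (rule abelian_groupI)
    fix u assume u: "u \<in> carrier (group_ring G)"
    show "\<exists>v\<in>carrier (group_ring G). v \<oplus>\<^bsub>group_ring G\<^esub> u = \<zero>\<^bsub>group_ring G\<^esub>"
      using u by (intro bexI[of _ "\<lambda>g. - u g"]) (auto simp: group_ring_carrier group_ring_add group_ring_zero)
  qed (use add_closed in \<open>auto simp: group_ring_add group_ring_zero group_ring_carrier add.assoc add.commute\<close>)
  show "Group.monoid (group_ring G)"
  proof (rule monoidI)
    fix u v w
    assume uvw: "u \<in> carrier (group_ring G)" "v \<in> carrier (group_ring G)" "w \<in> carrier (group_ring G)"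
    have supp: "u g \<noteq> 0 \<Longrightarrow> g \<in> carrier G" "v g \<noteq> 0 \<Longrightarrow> g \<in> carrier G" "w g \<noteq> 0 \<Longrightarrow> g \<in> carrier G" for g
      using uvw by (auto simp: group_ring_carrier)
    show "u \<otimes>\<^bsub>group_ring G\<^esub> v \<otimes>\<^bsub>group_ring G\<^esub> w = u \<otimes>\<^bsub>group_ring G\<^esub> (v \<otimes>\<^bsub>group_ring G\<^esub> w)"
    proof
      fix x
      show "(u \<otimes>\<^bsub>group_ring G\<^esub> v \<otimes>\<^bsub>group_ring G\<^esub> w) x = (u \<otimes>\<^bsub>group_ring G\<^esub> (v \<otimes>\<^bsub>group_ring G\<^esub> w)) x"
        \<comment> \<open>Both sides become a threefold extension of the indicator of
          \<open>x\<close>, differing only in the bracketing of a product of three group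
          elements.\<close>
        unfolding group_ring_mult[where u = "u \<otimes>\<^bsub>group_ring G\<^esub> v"]
          group_ring_mult[where v = "v \<otimes>\<^bsub>group_ring G\<^esub> w"]
          linear_extension_mult[OF uvw(1,2)] linear_extension_mult[OF uvw(2,3)]
        by (intro linear_extension_cong) (simp add: supp m_assoc)
    qed
  next
    fix u assume u: "u \<in> carrier (group_ring G)"
    then have *: "linear_extension (\<lambda>y. of_bool (y = x)) u = u x" for x
      using linear_extension_superset[of "insert x {g. u g \<noteq> 0}" u "\<lambda>y. of_bool (y = x)"]
      by (auto simp: group_ring_carrier of_bool_def if_distrib cong: if_cong)
    have supp: "u g \<noteq> 0 \<Longrightarrow> g \<in> carrier G" for g
      using u by (auto simp: group_ring_carrier)
    show "\<one>\<^bsub>group_ring G\<^esub> \<otimes>\<^bsub>group_ring G\<^esub> u = u"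
      unfolding group_ring_one
      by (rule ext) (simp add: group_ring_mult trans[OF linear_extension_cong *] supp)
    show "u \<otimes>\<^bsub>group_ring G\<^esub> \<one>\<^bsub>group_ring G\<^esub> = u"
      unfolding group_ring_one
      by (rule ext) (simp add: group_ring_mult trans[OF linear_extension_cong *] supp)
  qed (use group_ring_mult_closed group_ring_of_closed in \<open>auto simp: group_ring_one\<close>)
  fix u v w
  assume uvw: "u \<in> carrier (group_ring G)" "v \<in> carrier (group_ring G)" "w \<in> carrier (group_ring G)"
  then have fin: "finite {g. u g \<noteq> 0}" "finite {g. v g \<noteq> 0}" by (auto simp: group_ring_carrier)
  show "(u \<oplus>\<^bsub>group_ring G\<^esub> v) \<otimes>\<^bsub>group_ring G\<^esub> w =
      u \<otimes>\<^bsub>group_ring G\<^esub> w \<oplus>\<^bsub>group_ring G\<^esub> v \<otimes>\<^bsub>group_ring G\<^esub> w"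
    by (rule ext) (simp add: group_ring_mult group_ring_add linear_extension_add[OF fin])
  show "w \<otimes>\<^bsub>group_ring G\<^esub> (u \<oplus>\<^bsub>group_ring G\<^esub> v) =
      w \<otimes>\<^bsub>group_ring G\<^esub> u \<oplus>\<^bsub>group_ring G\<^esub> w \<otimes>\<^bsub>group_ring G\<^esub> v"
    by (rule ext) (simp add: group_ring_mult group_ring_add linear_extension_add[OF fin] linear_extension_fun_add)
qed

end

section \<open>Free groups and the Magnus expansion\<close>

lemma (in group) word_val_closed:
  assumes "\<And>i. i \<in> I \<Longrightarrow> y i \<in> carrier G" "w \<in> lists (I \<times> UNIV)"
  shows "word_val G y w \<in> carrier G"
  using assms(2) by (induction w) (auto simp: word_val_def assms(1))

lemma (in group) word_val_Cons:
  "word_val G y ((i, b) # w) = (if b then y i else inv (y i)) \<otimes> word_val G y w"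
  by (simp add: word_val_def)

lemma (in group) word_val_append:
  assumes "\<And>i. i \<in> I \<Longrightarrow> y i \<in> carrier G" "v \<in> lists (I \<times> UNIV)" "w \<in> lists (I \<times> UNIV)"
  shows "word_val G y (v @ w) = word_val G y v \<otimes> word_val G y w"
  using assms(2)
proof (induction v)
  case Nil
  then show ?case using word_val_closed[OF assms(1,3)] by (simp add: word_val_def)
next
  case (Cons a v)
  then show ?case
    using assms(1) word_val_closed[of I y] assms(3)
    by (cases a) (auto simp: word_val_Cons m_assoc)
qed

fun cons_reduced :: "'i \<times> bool \<Rightarrow> ('i \<times> bool) list \<Rightarrow> ('i \<times> bool) list" where
  "cons_reduced a [] = [a]"
| "cons_reduced a (b # w) = (if fst a = fst b \<and> snd a \<noteq> snd b then w else a # b # w)"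

text \<open>Folding from the right puts each letter in front of a word that is already reduced, so
  at most one cancellation occurs per letter and a single pass suffices.\<close>

definition reduction :: "('i \<times> bool) list \<Rightarrow> ('i \<times> bool) list" where
  "reduction w = foldr cons_reduced w []"

lemma reduced_word_Cons_tl: "reduced_word (b # w) \<Longrightarrow> reduced_word w"
  by (cases w) (auto simp: reduced_word_def)

lemma reduced_reduction:
  assumes "w \<in> lists (I \<times> UNIV)"
  shows "reduction w \<in> lists (I \<times> UNIV) \<and> reduced_word (reduction w)"
  using assms
proof (induction w)
  case Nil
  then show ?case by (simp add: reduction_def reduced_word_def)
next
  case (Cons a w)
  have *: "reduction (a # w) = cons_reduced a (reduction w)" by (simp add: reduction_def)
  show ?case
  proof (cases "reduction w")
    case Nil
    then show ?thesis using Cons.hyps * by (auto simp: reduced_word_def)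
  next
    case (Cons b v)
    have "reduced_word (b # v)" "b # v \<in> lists (I \<times> UNIV)" using Cons.IH Cons by auto
    moreover from this have "reduced_word v" by (blast intro: reduced_word_Cons_tl)
    ultimately show ?thesis using Cons.hyps
      unfolding * Cons by (auto simp: reduced_word_def split: prod.splits)
  qed
qed

lemma (in group) word_val_reduction:
  assumes "\<And>i. i \<in> I \<Longrightarrow> y i \<in> carrier G" "w \<in> lists (I \<times> UNIV)"
  shows "word_val G y (reduction w) = word_val G y w"
  using assms(2)
proof (induction w)
  case Nil
  then show ?case by (simp add: reduction_def)
next
  case (Cons a w)
  obtain i c where a: "a = (i, c)" by (cases a)
  with Cons have i: "y i \<in> carrier G" using assms(1) by auto
  have *: "reduction (a # w) = cons_reduced a (reduction w)" by (simp add: reduction_def)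
  have red: "reduction w \<in> lists (I \<times> UNIV)" using reduced_reduction Cons by blast
  show ?case
  proof (cases "reduction w")
    case Nil
    then show ?thesis using Cons.IH * by (simp add: a word_val_Cons)
  next
    case (Cons b v)
    obtain j d where b: "b = (j, d)" by (cases b)
    have "word_val G y v \<in> carrier G"
      using red Cons by (intro word_val_closed[of I]) (auto intro: assms(1))
    with Cons Cons.IH[symmetric] i * show ?thesis
      by (auto simp: a b word_val_Cons m_assoc[symmetric])
  qed
qed

text \<open>The image of an element is read off from its reduced word. This respects products
  because words with the same value in \<open>F\<close> have the same value in \<open>K\<close>: by
  uniqueness of normal forms their reductions coincide, and reduction preserves values in both
  groups.\<close>

lemma free_group_universal:
  assumes free: "free_group_on F I x" and "group K" and y: "\<And>i. i \<in> I \<Longrightarrow> y i \<in> carrier K"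
  obtains h where "h \<in> hom F K" "\<And>i. i \<in> I \<Longrightarrow> h (x i) = y i"
proof -
  interpret F: group F using free by (simp add: free_group_on_def)
  interpret K: group K by fact
  let ?W = "lists (I \<times> (UNIV :: bool set))"
  have x: "x i \<in> carrier F" if "i \<in> I" for i
    using free that by (auto simp: free_group_on_def)
  have bij: "bij_betw (word_val F x) {w \<in> ?W. reduced_word w} (carrier F)"
    using free by (simp add: free_group_on_def)
  define nf where "nf = inv_into {w \<in> ?W. reduced_word w} (word_val F x)"
  have nf: "nf g \<in> ?W" "word_val F x (nf g) = g" if "g \<in> carrier F" for g
    using bij that inv_into_into[of g "word_val F x" "{w \<in> ?W. reduced_word w}"]
    by (auto simp: nf_def bij_betw_def f_inv_into_f)
  have indep: "word_val K y v = word_val K y w"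
    if "v \<in> ?W" "w \<in> ?W" "word_val F x v = word_val F x w" for v w
  proof -
    have "word_val F x (reduction v) = word_val F x (reduction w)"
      using that F.word_val_reduction[of I x] x by simp
    then have "reduction v = reduction w"
      using bij that reduced_reduction[of v I] reduced_reduction[of w I]
      by (auto simp: bij_betw_def inj_on_def)
    then show ?thesis using K.word_val_reduction[of I y] y that by metis
  qed
  define h where "h g = word_val K y (nf g)" for g
  show thesis
  proof
    show "h \<in> hom F K"
    proof (rule homI)
      fix g g' assume gg: "g \<in> carrier F" "g' \<in> carrier F"
      show "h g \<in> carrier K" unfolding h_def by (rule K.word_val_closed[of I]) (use y nf gg in auto)
      have "word_val F x (nf g @ nf g') = g \<otimes>\<^bsub>F\<^esub> g'"
        using gg nf x by (simp add: F.word_val_append[of I])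
      then have eq: "word_val F x (nf (g \<otimes>\<^bsub>F\<^esub> g')) = word_val F x (nf g @ nf g')"
        using gg nf by simp
      have "nf g @ nf g' \<in> ?W" using nf(1)[OF gg(1)] nf(1)[OF gg(2)] by auto
      then have "h (g \<otimes>\<^bsub>F\<^esub> g') = word_val K y (nf g @ nf g')"
        unfolding h_def using gg by (intro indep eq nf(1)) auto
      then show "h (g \<otimes>\<^bsub>F\<^esub> g') = h g \<otimes>\<^bsub>K\<^esub> h g'"
        unfolding h_def using gg nf y by (simp add: K.word_val_append[of I])
    qed
    fix i assume i: "i \<in> I"
    have "word_val K y (nf (x i)) = word_val K y [(i, True)]"
      using i x nf by (intro indep) (auto simp: word_val_def)
    then show "h (x i) = y i" using i y by (simp add: h_def word_val_def)
  qed
qed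

lemma free_group_generate:
  assumes "free_group_on F I x"
  shows "generate F (x ` I) = carrier F"
proof -
  interpret F: group F using assms by (simp add: free_group_on_def)
  have x: "x ` I \<subseteq> carrier F" using assms by (simp add: free_group_on_def)
  have gen: "word_val F x w \<in> generate F (x ` I)" if "w \<in> lists (I \<times> UNIV)" for w
    using that
  proof (induction w)
    case (Cons a w)
    then obtain i b where a: "a = (i, b)" "i \<in> I" by (cases a) auto
    then have "(if b then x i else inv\<^bsub>F\<^esub> x i) \<in> generate F (x ` I)"
      by (simp add: generate.incl generate.inv)
    with Cons.IH show ?case by (simp add: a F.word_val_Cons generate.eng)
  qed (simp add: word_val_def generate.one)
  have "carrier F = word_val F x ` {w \<in> lists (I \<times> UNIV). reduced_word w}"
    using assms by (simp add: free_group_on_def bij_betw_def)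
  with gen have "carrier F \<subseteq> generate F (x ` I)" by auto
  with F.generate_incl[OF x] show ?thesis by blast
qed

section \<open>Noncommutative power series and the Magnus expansion\<close>

text \<open>The product of power series: the sum of \<open>p u * q v\<close> over all splittings of
  the word into \<open>u @ v\<close>, by recursion on the letters that go into the left
  part.\<close>

fun conv :: "(nat list \<Rightarrow> int) \<Rightarrow> (nat list \<Rightarrow> int) \<Rightarrow> nat list \<Rightarrow> int" where
  "conv p q [] = p [] * q []"
| "conv p q (a # w) = p [] * q (a # w) + conv (\<lambda>v. p (a # v)) q w"

text \<open>A multiple plus a remainder is the shape of \<open>conv p q (a # v)\<close> as a
  function of \<open>v\<close>, the factor being the constant term of \<open>p\<close>. The
  induction for associativity needs exactly this.\<close>

lemma conv_lincomb_left:
  "conv (\<lambda>v. k * p v + p' v) q w = k * conv p q w + conv p' q w"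
  by (induction w arbitrary: p p') (auto simp: algebra_simps)

lemma conv_assoc: "conv (conv p q) r w = conv p (conv q r) w"
  by (induction w arbitrary: p) (auto simp: algebra_simps conv_lincomb_left)

lemma conv_zero_left [simp]: "conv (\<lambda>v. 0) q w = 0"
  by (induction w) auto

lemma conv_one_left [simp]: "conv (\<lambda>v. of_bool (v = [])) q w = q w"
  by (cases w) auto

lemma conv_one_right [simp]: "conv p (\<lambda>v. of_bool (v = [])) w = p w"
  by (induction w arbitrary: p) auto

text \<open>Noncommutative formal power series with constant term 1, indexed by their monomials.\<close>

definition magnus_monoid :: "(nat list \<Rightarrow> int) monoid" where
  "magnus_monoid = \<lparr>carrier = {p. p [] = 1}, monoid.mult = conv, one = (\<lambda>v. of_bool (v = []))\<rparr>"

lemma magnus_monoid: "Group.monoid magnus_monoid"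
  by (rule monoidI) (auto simp: magnus_monoid_def conv_assoc)

definition magnus_gen :: "nat \<Rightarrow> nat list \<Rightarrow> int" where
  "magnus_gen a w = of_bool (w = [] \<or> w = [a])"

text \<open>The geometric series 1 - X + X^2 - ... in the variable X_a, inverse to 1 + X_a.\<close>

primrec magnus_gen_inv :: "nat \<Rightarrow> nat list \<Rightarrow> int" where
  "magnus_gen_inv a [] = 1"
| "magnus_gen_inv a (b # w) = - of_bool (b = a) * magnus_gen_inv a w"

lemma magnus_gen_inv_right: "conv (magnus_gen a) (magnus_gen_inv a) w = of_bool (w = [])"
proof (cases w)
  case (Cons b v)
  have "(\<lambda>v. magnus_gen a (b # v)) = (if b = a then (\<lambda>v. of_bool (v = [])) else (\<lambda>v. 0))"
    by (auto simp: magnus_gen_def)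
  with Cons show ?thesis by (simp add: magnus_gen_def)
qed (simp add: magnus_gen_def)

lemma magnus_gen_inv_left: "conv (magnus_gen_inv a) (magnus_gen a) w = of_bool (w = [])"
proof (induction w)
  case (Cons b w)
  have "magnus_gen a [] = 1" "magnus_gen a (b # w) = of_bool (b = a \<and> w = [])" by (auto simp: magnus_gen_def)
  moreover have "conv (\<lambda>v. magnus_gen_inv a (b # v)) (magnus_gen a) w
      = - of_bool (b = a) * conv (magnus_gen_inv a) (magnus_gen a) w"
    using conv_lincomb_left[of "- of_bool (b = a)" "magnus_gen_inv a" "\<lambda>v. 0" "magnus_gen a" w] by simp
  ultimately show ?case using Cons
    unfolding conv.simps by (auto simp del: magnus_gen_inv.simps(2))
qed (simp add: magnus_gen_def)

lemma magnus_gen_Units: "magnus_gen a \<in> Units magnus_monoid"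
  unfolding Units_def
proof (intro CollectI conjI bexI)
  show "magnus_gen_inv a \<otimes>\<^bsub>magnus_monoid\<^esub> magnus_gen a = \<one>\<^bsub>magnus_monoid\<^esub>"
    by (auto simp: magnus_monoid_def magnus_gen_inv_left)
  show "magnus_gen a \<otimes>\<^bsub>magnus_monoid\<^esub> magnus_gen_inv a = \<one>\<^bsub>magnus_monoid\<^esub>"
    by (auto simp: magnus_monoid_def magnus_gen_inv_right)
qed (auto simp: magnus_monoid_def magnus_gen_def)

text \<open>The series 1 + X_i are invertible, so the universal property applies with the group of
  units of \<open>magnus_monoid\<close> as target.\<close>

lemma magnus_expansion:
  assumes "free_group_on F I x"
  obtains \<mu> :: "'a \<Rightarrow> nat list \<Rightarrow> int" where
    "\<And>g. g \<in> carrier F \<Longrightarrow> \<mu> g [] = 1"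
    "\<And>g h. g \<in> carrier F \<Longrightarrow> h \<in> carrier F \<Longrightarrow> \<mu> (g \<otimes>\<^bsub>F\<^esub> h) = conv (\<mu> g) (\<mu> h)"
    "\<And>i. i \<in> I \<Longrightarrow> \<mu> (x i) = magnus_gen i"
proof -
  interpret M: Group.monoid magnus_monoid by (rule magnus_monoid)
  have gen: "magnus_gen i \<in> carrier (units_of magnus_monoid)" for i
    by (simp add: units_of_carrier magnus_gen_Units)
  obtain \<mu> where \<mu>: "\<mu> \<in> hom F (units_of magnus_monoid)" "\<And>i. i \<in> I \<Longrightarrow> \<mu> (x i) = magnus_gen i"
    by (rule free_group_universal[OF assms M.units_group, of magnus_gen]) (auto intro: gen)
  show thesis
  proof
    fix g h assume "g \<in> carrier F" "h \<in> carrier F"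
    with \<mu>(1) show "\<mu> (g \<otimes>\<^bsub>F\<^esub> h) = conv (\<mu> g) (\<mu> h)"
      by (simp add: hom_mult units_of_mult) (simp add: magnus_monoid_def)
  next
    fix g assume "g \<in> carrier F"
    with \<mu>(1) have "\<mu> g \<in> Units magnus_monoid"
      using hom_in_carrier[of \<mu> F "units_of magnus_monoid" g] by (simp add: units_of_carrier)
    then have "\<mu> g \<in> carrier magnus_monoid" by (rule M.Units_closed)
    then show "\<mu> g [] = 1" by (simp add: magnus_monoid_def)
  qed (fact \<mu>(2))
qed

section \<open>Commutator calculus\<close>

text \<open>The divisor 0 turns divisibility into vanishing, so kernels of coefficients and
  subgroups cut out by exponents come from the same statement. Additivity is asked on
  \<open>H\<close> alone because coefficients of degree two and three become additive once those of
  lower degree vanish.\<close>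

lemma (in group) subgroup_dvd_additive:
  fixes f :: "'t \<Rightarrow> 'a \<Rightarrow> int"
  assumes H: "subgroup H G"
    and add: "\<And>t u v. t \<in> T \<Longrightarrow> u \<in> H \<Longrightarrow> v \<in> H \<Longrightarrow> f t (u \<otimes> v) = f t u + f t v"
  shows "subgroup {u \<in> H. \<forall>t\<in>T. d t dvd f t u} G"
proof -
  interpret H: subgroup H G by fact
  have one: "f t \<one> = 0" if "t \<in> T" for t
    using add[OF that H.one_closed H.one_closed] by simp
  have inv: "f t (inv u) = - f t u" if "t \<in> T" "u \<in> H" for t u
    using add[OF that H.m_inv_closed[OF that(2)]] one[OF that(1)] that by simp
  show ?thesis
  proof (rule subgroupI)
    have "\<one> \<in> {u \<in> H. \<forall>t\<in>T. d t dvd f t u}" using one by simp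
    then show "{u \<in> H. \<forall>t\<in>T. d t dvd f t u} \<noteq> {}" by blast
  qed (use inv add in \<open>auto simp: H.mem_carrier\<close>)
qed

lemma (in group) int_pow_additive:
  fixes f :: "'a \<Rightarrow> int"
  assumes H: "subgroup H G" and g: "g \<in> H"
    and add: "\<And>u v. u \<in> H \<Longrightarrow> v \<in> H \<Longrightarrow> f (u \<otimes> v) = f u + f v"
  shows "f (g [^] (n::int)) = n * f g"
proof -
  interpret H: subgroup H G by fact
  have one: "f \<one> = 0"
    using add[OF H.one_closed H.one_closed] by simp
  have nat: "f (g [^] (k::nat)) = int k * f g \<and> g [^] k \<in> H" for k
    by (induction k) (use one g add in \<open>auto simp: algebra_simps\<close>)
  have inv: "f (inv u) = - f u" if "u \<in> H" for u
    using add[OF that H.m_inv_closed[OF that]] one that by simp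
  show ?thesis
  proof (cases n rule: int_cases2)
    case (nonneg k)
    with nat show ?thesis by (simp add: int_pow_int)
  next
    case (nonpos k)
    with nat[of k] inv g show ?thesis by (simp add: int_pow_neg_int H.mem_carrier)
  qed
qed

section \<open>Commutator identities and the lower central series\<close>

lemma (in group) commutator_closed [simp, intro]:
  "g \<in> carrier G \<Longrightarrow> h \<in> carrier G \<Longrightarrow> commutator G g h \<in> carrier G"
  by (simp add: commutator_def)

lemma (in group) inv_mult_cancel [simp]:
  assumes "g \<in> carrier G" "h \<in> carrier G"
  shows "inv g \<otimes> (g \<otimes> h) = h" "g \<otimes> (inv g \<otimes> h) = h"
  using assms by (simp_all flip: m_assoc)

text \<open>In this form the coefficients of a commutator follow by comparing two products, without
  expanding an inverse.\<close>

lemma (in group) commutator_eq: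
  "g \<in> carrier G \<Longrightarrow> h \<in> carrier G \<Longrightarrow> g \<otimes> h = h \<otimes> g \<otimes> commutator G g h"
  by (simp add: commutator_def m_assoc)

lemma (in group) inv_commutator:
  "g \<in> carrier G \<Longrightarrow> h \<in> carrier G \<Longrightarrow> inv (commutator G g h) = commutator G h g"
  by (simp add: commutator_def inv_mult_group m_assoc)

lemma (in group) commutator_self: "g \<in> carrier G \<Longrightarrow> commutator G g g = \<one>"
  by (simp add: commutator_def m_assoc)

lemma (in group) conj_commutator:
  assumes "g \<in> carrier G" "h \<in> carrier G" "k \<in> carrier G"
  shows "k \<otimes> commutator G g h \<otimes> inv k = commutator G (k \<otimes> g \<otimes> inv k) (k \<otimes> h \<otimes> inv k)"
  using assms by (simp add: commutator_def inv_mult_group m_assoc)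

text \<open>The correction is written as a further commutator and not as a conjugate, so that it
  disappears as soon as \<open>commutator G g h\<close> is central.\<close>

lemma (in group) commutator_mult_left:
  assumes "g \<in> carrier G" "g' \<in> carrier G" "h \<in> carrier G"
  shows "commutator G (g \<otimes> g') h
    = commutator G g h \<otimes> commutator G (commutator G g h) g' \<otimes> commutator G g' h"
  using assms by (simp add: commutator_def inv_mult_group m_assoc)

lemma (in group) commutator_mult_right:
  assumes "g \<in> carrier G" "h \<in> carrier G" "h' \<in> carrier G"
  shows "commutator G g (h \<otimes> h')
    = commutator G g h' \<otimes> commutator G g h \<otimes> commutator G (commutator G g h) h'"
  using assms by (simp add: commutator_def inv_mult_group m_assoc)

lemma (in group) Hall_Witt:
  assumes "a \<in> carrier G" "b \<in> carrier G" "c \<in> carrier G"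
  shows "inv b \<otimes> commutator G (commutator G a (inv b)) c \<otimes> b \<otimes>
    (inv c \<otimes> commutator G (commutator G b (inv c)) a \<otimes> c) \<otimes>
    (inv a \<otimes> commutator G (commutator G c (inv a)) b \<otimes> a) = \<one>"
  using assms by (simp add: commutator_def inv_mult_group m_assoc)

lemma (in group_hom) hom_commutator:
  "g \<in> carrier G \<Longrightarrow> k \<in> carrier G \<Longrightarrow> h (commutator G g k) = commutator H (h g) (h k)"
  by (simp add: commutator_def)

lemma (in group) commutator_subgroup_normal:
  assumes "H \<lhd> G" "K \<lhd> G"
  shows "commutator_subgroup G H K \<lhd> G"
proof -
  interpret H: normal H G by fact
  interpret K: normal K G by fact
  show ?thesis unfolding commutator_subgroup_def
  proof (rule normal_generateI)
    show "{commutator G h k |h k. h \<in> H \<and> k \<in> K} \<subseteq> carrier G" by auto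
  next
    fix u g assume "u \<in> {commutator G h k |h k. h \<in> H \<and> k \<in> K}" and g: "g \<in> carrier G"
    then obtain h k where "u = commutator G h k" "h \<in> H" "k \<in> K" by auto
    moreover from this g have "g \<otimes> h \<otimes> inv g \<in> H" "g \<otimes> k \<otimes> inv g \<in> K"
      by (simp_all add: H.inv_op_closed2 K.inv_op_closed2)
    ultimately show "g \<otimes> u \<otimes> inv g \<in> {commutator G h k |h k. h \<in> H \<and> k \<in> K}"
      using conj_commutator[of h k g] g H.mem_carrier K.mem_carrier by blast
  qed
qed

lemma (in group) lower_central_normal: "lower_central G n \<lhd> G"
proof -
  have G: "carrier G \<lhd> G" by (rule normal_invI) (auto simp: subgroup_self)
  show ?thesis
  proof (induction n)
    case (Suc n)
    then show ?case by (cases n) (auto simp: G commutator_subgroup_normal)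
  qed (simp add: G)
qed

lemma (in group) commutator_lower_central:
  assumes "u \<in> lower_central G n" "n > 0" "k \<in> carrier G"
  shows "commutator G u k \<in> lower_central G (Suc n)"
  using assms by (cases n) (auto simp: commutator_subgroup_def intro: generate.incl)

lemma (in group) lower_central_Suc_subset: "lower_central G (Suc n) \<subseteq> lower_central G n"
proof (cases n)
  case (Suc m)
  interpret N: normal "lower_central G n" G by (rule lower_central_normal)
  have "commutator G u k \<in> lower_central G n" if "u \<in> lower_central G n" "k \<in> carrier G" for u k
    using that N.m_closed[OF N.m_inv_closed[OF that(1)] N.inv_op_closed1[OF that(2,1)]]
    by (simp add: commutator_def m_assoc)
  then show ?thesis
    unfolding Suc lower_central.simps commutator_subgroup_def
    by (intro generate_subgroup_incl) (auto simp: Suc intro: N.subgroup_axioms[unfolded Suc])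
qed simp

text \<open>The maps are homomorphisms on the generated subgroup alone because the product formulas
  compared later are additive only on a term of the lower central series.\<close>

lemma (in group) hom_eq_generate:
  assumes T: "T \<subseteq> carrier G" and "group K"
    and "\<phi> \<in> hom (G\<lparr>carrier := generate G T\<rparr>) K" "\<psi> \<in> hom (G\<lparr>carrier := generate G T\<rparr>) K"
    and eq: "\<And>t. t \<in> T \<Longrightarrow> \<phi> t = \<psi> t" and u: "u \<in> generate G T"
  shows "\<phi> u = \<psi> u"
proof -
  let ?H = "G\<lparr>carrier := generate G T\<rparr>"
  have sub: "subgroup (generate G T) G" by (rule generate_is_subgroup[OF T])
  interpret H: group ?H by (rule subgroup.subgroup_is_group[OF sub is_group])
  interpret \<phi>: group_hom ?H K \<phi> by (simp add: assms group_hom_def group_hom_axioms_def H.is_group)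
  interpret \<psi>: group_hom ?H K \<psi> by (simp add: assms group_hom_def group_hom_axioms_def H.is_group)
  from u show ?thesis
  proof induction
    case one
    then show ?case using \<phi>.hom_one \<psi>.hom_one by simp
  next
    case (inv h)
    then have "h \<in> generate G T" by (rule generate.incl)
    then show ?case
      using \<phi>.hom_inv[of h] \<psi>.hom_inv[of h] eq inv m_inv_consistent[OF sub] by simp
  next
    case (eng u v)
    then show ?case using \<phi>.hom_mult[of u v] \<psi>.hom_mult[of u v] by simp
  qed (rule eq)
qed

section \<open>Central elements and commutators with central values\<close>

definition center :: "('a, 'b) monoid_scheme \<Rightarrow> 'a set" where
  "center G = {z \<in> carrier G. \<forall>g\<in>carrier G. z \<otimes>\<^bsub>G\<^esub> g = g \<otimes>\<^bsub>G\<^esub> z}"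

lemma center_closed: "z \<in> center G \<Longrightarrow> z \<in> carrier G"
  by (simp add: center_def)

lemma center_commute: "z \<in> center G \<Longrightarrow> g \<in> carrier G \<Longrightarrow> z \<otimes>\<^bsub>G\<^esub> g = g \<otimes>\<^bsub>G\<^esub> z"
  by (simp add: center_def)

lemma centerI:
  "z \<in> carrier G \<Longrightarrow> (\<And>g. g \<in> carrier G \<Longrightarrow> z \<otimes>\<^bsub>G\<^esub> g = g \<otimes>\<^bsub>G\<^esub> z) \<Longrightarrow> z \<in> center G"
  by (simp add: center_def)

lemma (in group) center_subgroup: "subgroup (center G) G"
proof (rule subgroupI)
  have "\<one> \<in> center G" by (simp add: center_def)
  then show "center G \<noteq> {}" by blast
next
  fix z assume z: "z \<in> center G"
  show "inv z \<in> center G"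
  proof (rule centerI)
    fix g assume g: "g \<in> carrier G"
    have "inv z \<otimes> g = inv z \<otimes> (g \<otimes> z) \<otimes> inv z" using center_closed[OF z] g by (simp add: m_assoc)
    also have "\<dots> = inv z \<otimes> (z \<otimes> g) \<otimes> inv z" by (simp only: center_commute[OF z g])
    also have "\<dots> = g \<otimes> inv z" using center_closed[OF z] g by simp
    finally show "inv z \<otimes> g = g \<otimes> inv z" .
  qed (simp add: center_closed[OF z])
next
  fix z z' assume z: "z \<in> center G" and z': "z' \<in> center G"
  note c = center_closed[OF z] center_closed[OF z']
  show "z \<otimes> z' \<in> center G"
  proof (rule centerI)
    fix g assume g: "g \<in> carrier G"
    have "z \<otimes> z' \<otimes> g = z \<otimes> g \<otimes> z'" using c g by (simp add: m_assoc center_commute[OF z' g])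
    also have "z \<otimes> g = g \<otimes> z" by (rule center_commute[OF z g])
    finally show "z \<otimes> z' \<otimes> g = g \<otimes> (z \<otimes> z')" using c g by (simp add: m_assoc)
  qed (simp add: c)
qed (rule subsetI, rule center_closed)

abbreviation (input) center_group :: "('a, 'b) monoid_scheme \<Rightarrow> ('a, 'b) monoid_scheme" where
  "center_group G \<equiv> G\<lparr>carrier := center G\<rparr>"

text \<open>This is the commutative group in which products over finite index sets can be formed
  inside a noncommutative quotient.\<close>

lemma (in group) center_comm_group: "comm_group (G\<lparr>carrier := center G\<rparr>)"
proof (rule group.group_comm_groupI[OF subgroup.subgroup_is_group[OF center_subgroup is_group]])
  fix y z assume "y \<in> carrier (G\<lparr>carrier := center G\<rparr>)" "z \<in> carrier (G\<lparr>carrier := center G\<rparr>)"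
  then show "y \<otimes>\<^bsub>G\<lparr>carrier := center G\<rparr>\<^esub> z = z \<otimes>\<^bsub>G\<lparr>carrier := center G\<rparr>\<^esub> y"
    using center_commute[of y G z] center_closed[of z G] by simp
qed

lemma (in group) commutator_center_left:
  assumes z: "z \<in> center G" and g: "g \<in> carrier G"
  shows "commutator G z g = \<one>"
proof -
  have "z \<otimes> g = g \<otimes> z \<otimes> commutator G z g" using commutator_eq center_closed[OF z] g by blast
  then have "g \<otimes> z \<otimes> commutator G z g = g \<otimes> z" using center_commute[OF z g] by simp
  with center_closed[OF z] g show ?thesis by simp
qed

lemma (in group) commutator_central_mult_left:
  assumes "g \<in> carrier G" "g' \<in> carrier G" "h \<in> carrier G" "commutator G g h \<in> center G"
  shows "commutator G (g \<otimes> g') h = commutator G g h \<otimes> commutator G g' h"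
  using assms by (simp add: commutator_mult_left commutator_center_left)

lemma (in group) commutator_central_mult_right:
  assumes "g \<in> carrier G" "h \<in> carrier G" "h' \<in> carrier G" "commutator G g h \<in> center G"
  shows "commutator G g (h \<otimes> h') = commutator G g h \<otimes> commutator G g h'"
  using assms center_commute[OF assms(4), of "commutator G g h'"]
  by (simp add: commutator_mult_right commutator_center_left)

section \<open>Groups in which threefold commutators are central\<close>

context group
begin

context
  assumes class3: "\<And>a b c. a \<in> carrier G \<Longrightarrow> b \<in> carrier G \<Longrightarrow> c \<in> carrier G \<Longrightarrow>
    commutator G (commutator G a b) c \<in> center G"
begin

text \<open>The commutator of a product differs from the product of the commutators by a threefold
  commutator, which is central and so has no effect on the outer commutator.\<close>

lemma commutator3_mult1:
  assumes "a \<in> carrier G" "a' \<in> carrier G" "b \<in> carrier G" "c \<in> carrier G"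
  shows "commutator G (commutator G (a \<otimes> a') b) c
    = commutator G (commutator G a b) c \<otimes> commutator G (commutator G a' b) c"
proof -
  let ?z = "commutator G (commutator G a b) a'"
  have z: "?z \<in> center G" "?z \<in> carrier G" using assms class3 by auto
  let ?w = "commutator G a b \<otimes> commutator G a' b"
  have eq: "commutator G (a \<otimes> a') b = ?z \<otimes> ?w"
    using assms z(2) center_commute[OF z(1), of "commutator G a b"]
    by (simp add: commutator_mult_left flip: m_assoc)
  have "commutator G ?z c = \<one>" using assms z by (simp add: commutator_center_left)
  then have "commutator G (?z \<otimes> ?w) c = commutator G ?w c"
    using assms z subgroup.one_closed[OF center_subgroup] commutator_central_mult_left[of ?z ?w c]
    by simp
  also have "\<dots> = commutator G (commutator G a b) c \<otimes> commutator G (commutator G a' b) c"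
    using assms class3 by (intro commutator_central_mult_left) auto
  finally show ?thesis unfolding eq .
qed

lemma commutator3_swap:
  assumes "a \<in> carrier G" "b \<in> carrier G" "c \<in> carrier G"
  shows "commutator G (commutator G b a) c = inv (commutator G (commutator G a b) c)"
proof -
  have "commutator G (commutator G a b) c \<otimes> commutator G (commutator G b a) c
      = commutator G (commutator G a b \<otimes> commutator G b a) c"
    using assms class3 by (simp add: commutator_central_mult_left)
  also have "\<dots> = \<one>"
    using assms by (simp add: commutator_center_left subgroup.one_closed[OF center_subgroup]
        flip: inv_commutator[of a b])
  finally show ?thesis using assms by (metis commutator_closed inv_equality r_inv inv_comm)
qed

lemma commutator3_mult2:
  assumes "a \<in> carrier G" "b \<in> carrier G" "b' \<in> carrier G" "c \<in> carrier G"
  shows "commutator G (commutator G a (b \<otimes> b')) c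
    = commutator G (commutator G a b) c \<otimes> commutator G (commutator G a b') c"
proof -
  have "commutator G (commutator G a (b \<otimes> b')) c
      = inv (commutator G (commutator G b a) c \<otimes> commutator G (commutator G b' a) c)"
    using assms by (simp add: commutator3_swap[of "b \<otimes> b'"] commutator3_mult1)
  also have "\<dots> = commutator G (commutator G a b') c \<otimes> commutator G (commutator G a b) c"
    using assms by (simp add: inv_mult_group commutator3_swap[of a b] commutator3_swap[of a b'])
  also have "\<dots> = commutator G (commutator G a b) c \<otimes> commutator G (commutator G a b') c"
    using assms by (intro center_commute class3) auto
  finally show ?thesis .
qed

lemma commutator3_mult3:
  assumes "a \<in> carrier G" "b \<in> carrier G" "c \<in> carrier G" "c' \<in> carrier G"
  shows "commutator G (commutator G a b) (c \<otimes> c')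
    = commutator G (commutator G a b) c \<otimes> commutator G (commutator G a b) c'"
  using assms class3 by (simp add: commutator_central_mult_right)

lemma commutator3_inv2:
  assumes "a \<in> carrier G" "b \<in> carrier G" "c \<in> carrier G"
  shows "commutator G (commutator G a (inv b)) c = inv (commutator G (commutator G a b) c)"
proof -
  have "commutator G a \<one> = \<one>" using assms by (simp add: commutator_def)
  then have "commutator G (commutator G a b) c \<otimes> commutator G (commutator G a (inv b)) c = \<one>"
    using assms subgroup.one_closed[OF center_subgroup]
    by (simp add: commutator_center_left flip: commutator3_mult2)
  then show ?thesis using assms by (metis commutator_closed inv_closed inv_equality inv_comm)
qed

text \<open>In \<open>Hall_Witt\<close> the conjugations act trivially on central values, and an
  inverse in the second slot comes out as an inverse of the whole commutator. What is left is the
  Jacobi identity in multiplicative form.\<close>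

lemma commutator3_Jacobi:
  assumes "a \<in> carrier G" "b \<in> carrier G" "c \<in> carrier G"
  shows "commutator G (commutator G a b) c
    = commutator G (commutator G a c) b \<otimes> inv (commutator G (commutator G b c) a)"
proof -
  let ?t = "\<lambda>a b c. commutator G (commutator G a b) c"
  have conj: "inv g \<otimes> inv z \<otimes> g = inv z" if "z \<in> center G" "g \<in> carrier G" for z g
  proof -
    have "inv z \<in> center G" using that subgroup.m_inv_closed[OF center_subgroup] by blast
    then have "inv z \<otimes> g = g \<otimes> inv z" by (rule center_commute[OF _ that(2)])
    with center_closed[OF that(1)] that(2) show ?thesis by (simp add: m_assoc)
  qed
  have "inv (?t a b c) \<otimes> inv (?t b c a) \<otimes> inv (?t c a b) = \<one>"
    using Hall_Witt[OF assms] assms by (simp add: commutator3_inv2 conj class3)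
  then have "inv (?t a b c) \<otimes> (inv (?t b c a) \<otimes> ?t a c b) = \<one>"
    using assms by (simp add: commutator3_swap[of a c] m_assoc)
  then have "?t a b c = inv (?t b c a) \<otimes> ?t a c b"
    using assms by (metis commutator_closed inv_closed inv_inv inv_equality inv_comm m_closed)
  also have "\<dots> = ?t a c b \<otimes> inv (?t b c a)"
    using assms by (intro center_commute[symmetric] class3) auto
  finally show ?thesis .
qed

end
end

lemma (in comm_group) finprod_int_pow_add:
  assumes "v \<in> B \<rightarrow> carrier G" "\<And>b. b \<in> B \<Longrightarrow> n b = (k b + l b :: int)"
  shows "(\<Otimes>b\<in>B. v b [^] n b) = (\<Otimes>b\<in>B. v b [^] k b) \<otimes> (\<Otimes>b\<in>B. v b [^] l b)"
proof -
  have "(\<Otimes>b\<in>B. v b [^] n b) = (\<Otimes>b\<in>B. v b [^] k b \<otimes> v b [^] l b)"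
    using assms by (intro finprod_cong') (auto simp: int_pow_mult Pi_iff)
  also have "\<dots> = (\<Otimes>b\<in>B. v b [^] k b) \<otimes> (\<Otimes>b\<in>B. v b [^] l b)"
    using assms by (intro finprod_multf) auto
  finally show ?thesis .
qed

lemma (in comm_group) finprod_int_pow_support:
  assumes "v \<in> B \<rightarrow> carrier G" "finite B" "S \<subseteq> B" "\<And>b. b \<in> B \<Longrightarrow> n b = (if b \<in> S then k b else 0 :: int)"
  shows "(\<Otimes>b\<in>B. v b [^] n b) = (\<Otimes>b\<in>S. v b [^] k b)"
  using assms by (intro finprod_mono_neutral_cong_right) auto

section \<open>Magnus coefficients on the lower central series\<close>

lemma lower_central_2:
  "lower_central G 2 = generate G {commutator G g h | g h. g \<in> carrier G \<and> h \<in> carrier G}"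
  by (simp add: numeral_2_eq_2 commutator_subgroup_def)

lemma lower_central_3:
  "lower_central G 3 = generate G {commutator G u k | u k. u \<in> lower_central G 2 \<and> k \<in> carrier G}"
  by (simp add: numeral_3_eq_3 numeral_2_eq_2 commutator_subgroup_def[of _ "commutator_subgroup _ _ _"])

lemma lower_central_4:
  "lower_central G 4 = generate G {commutator G u k | u k. u \<in> lower_central G 3 \<and> k \<in> carrier G}"
  by (simp add: numeral_eq_Suc commutator_subgroup_def[of _ "commutator_subgroup _ (commutator_subgroup _ _ _) _"])

text \<open>Freeness enters the rest of the argument through two facts: the \<open>x i\<close>
  generate, and there is a multiplicative expansion with \<open>x i\<close> going to 1 +
  X_i.\<close>

locale magnus = group F for F (structure) +
  fixes I :: "nat set" and x :: "nat \<Rightarrow> 'a" and \<mu> :: "'a \<Rightarrow> nat list \<Rightarrow> int"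
  assumes finite_I: "finite I"
    and x_closed [simp]: "\<And>i. i \<in> I \<Longrightarrow> x i \<in> carrier F"
    and generate_x: "generate F (x ` I) = carrier F"
    and mu_Nil [simp]: "\<And>g. g \<in> carrier F \<Longrightarrow> \<mu> g [] = 1"
    and mu_mult: "\<And>g h. g \<in> carrier F \<Longrightarrow> h \<in> carrier F \<Longrightarrow> \<mu> (g \<otimes> h) = conv (\<mu> g) (\<mu> h)"
    and mu_x: "\<And>i. i \<in> I \<Longrightarrow> \<mu> (x i) = magnus_gen i"
begin

lemma mu_mult1: "g \<in> carrier F \<Longrightarrow> h \<in> carrier F \<Longrightarrow> \<mu> (g \<otimes> h) [i] = \<mu> g [i] + \<mu> h [i]"
  by (simp add: mu_mult)

lemma mu_mult2: "g \<in> carrier F \<Longrightarrow> h \<in> carrier F \<Longrightarrow>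
    \<mu> (g \<otimes> h) [i, j] = \<mu> g [i, j] + \<mu> g [i] * \<mu> h [j] + \<mu> h [i, j]"
  by (simp add: mu_mult)

lemma mu_mult3: "g \<in> carrier F \<Longrightarrow> h \<in> carrier F \<Longrightarrow>
    \<mu> (g \<otimes> h) [i, j, k] = \<mu> g [i, j, k] + \<mu> g [i, j] * \<mu> h [k] + \<mu> g [i] * \<mu> h [j, k] + \<mu> h [i, j, k]"
  by (simp add: mu_mult)

lemma mu_x1: "a \<in> I \<Longrightarrow> \<mu> (x a) [i] = of_bool (i = a)"
  by (simp add: mu_x magnus_gen_def)

lemma mu_commutator1:
  assumes "g \<in> carrier F" "h \<in> carrier F"
  shows "\<mu> (commutator F g h) [i] = 0"
  using arg_cong[OF commutator_eq[OF assms], of "\<lambda>u. \<mu> u [i]"] assms by (simp add: mu_mult1)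

lemma mu_commutator2:
  assumes "g \<in> carrier F" "h \<in> carrier F"
  shows "\<mu> (commutator F g h) [i, j] = \<mu> g [i] * \<mu> h [j] - \<mu> h [i] * \<mu> g [j]"
  using arg_cong[OF commutator_eq[OF assms], of "\<lambda>u. \<mu> u [i, j]"] assms
  by (simp add: mu_mult2 mu_mult1 mu_commutator1)

text \<open>Without a linear part in \<open>g\<close>, the commutator has no terms in degrees one
  and two, and its cubic part is the Lie bracket of the quadratic part of \<open>g\<close> with the
  linear part of \<open>h\<close>.\<close>

lemma mu_commutator3:
  assumes "g \<in> carrier F" "h \<in> carrier F" and [simp]: "\<And>i. \<mu> g [i] = 0"
  shows "\<mu> (commutator F g h) [i, j, k] = \<mu> g [i, j] * \<mu> h [k] - \<mu> h [i] * \<mu> g [j, k]"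
  using arg_cong[OF commutator_eq[OF assms(1,2)], of "\<lambda>u. \<mu> u [i, j, k]"] assms(1,2)
  by (simp add: mu_mult3 mu_mult2 mu_mult1 mu_commutator1 mu_commutator2)

definition magnus_kernel_2 :: "'a set" where
  "magnus_kernel_2 = {u \<in> carrier F. \<forall>i. \<mu> u [i] = 0}"

definition magnus_kernel_3 :: "'a set" where
  "magnus_kernel_3 = {u \<in> magnus_kernel_2. \<forall>i j. \<mu> u [i, j] = 0}"

lemma magnus_kernel_2_subgroup: "subgroup magnus_kernel_2 F"
  using subgroup_dvd_additive[OF subgroup_self, of UNIV "\<lambda>i u. \<mu> u [i]" "\<lambda>_. 0"]
  by (simp add: mu_mult1 magnus_kernel_2_def)

lemma magnus_kernel_3_subgroup: "subgroup magnus_kernel_3 F"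
  using subgroup_dvd_additive[OF magnus_kernel_2_subgroup, of UNIV "\<lambda>(i, j) u. \<mu> u [i, j]" "\<lambda>_. 0"]
  by (auto simp: mu_mult2 magnus_kernel_2_def magnus_kernel_3_def)

lemma lower_central_2_magnus_kernel_2: "lower_central F 2 \<subseteq> magnus_kernel_2"
  unfolding lower_central_2
  by (rule generate_subgroup_incl[OF _ magnus_kernel_2_subgroup]) (auto simp: magnus_kernel_2_def mu_commutator1)

lemma lower_central_2_carrier: "u \<in> lower_central F 2 \<Longrightarrow> u \<in> carrier F"
  using lower_central_2_magnus_kernel_2 by (auto simp: magnus_kernel_2_def)

lemma lower_central_2_mu1: "u \<in> lower_central F 2 \<Longrightarrow> \<mu> u [i] = 0"
  using lower_central_2_magnus_kernel_2 by (auto simp: magnus_kernel_2_def)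

text \<open>The quadratic part is a combination of brackets of the variables. Antisymmetry is
  phrased as divisibility by 0, hence defines a subgroup, and it is clear on commutators.\<close>

lemma lower_central_2_antisym:
  assumes "u \<in> lower_central F 2"
  shows "\<mu> u [i, j] = - \<mu> u [j, i]"
proof -
  let ?H = "{u \<in> magnus_kernel_2. \<forall>t\<in>UNIV. 0 dvd (\<lambda>(i, j). \<mu> u [i, j] + \<mu> u [j, i]) t}"
  have "subgroup ?H F"
    using subgroup_dvd_additive[OF magnus_kernel_2_subgroup, of UNIV "\<lambda>(i, j) u. \<mu> u [i, j] + \<mu> u [j, i]" "\<lambda>_. 0"]
    by (auto simp: mu_mult2 magnus_kernel_2_def)
  then have "lower_central F 2 \<subseteq> ?H"
    unfolding lower_central_2
    by (rule generate_subgroup_incl[rotated]) (auto simp: magnus_kernel_2_def mu_commutator1 mu_commutator2)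
  with assms have "\<mu> u [i, j] + \<mu> u [j, i] = 0" by auto
  then show ?thesis by simp
qed

lemma lower_central_3_magnus_kernel_3: "lower_central F 3 \<subseteq> magnus_kernel_3"
  unfolding lower_central_3
  by (rule generate_subgroup_incl[OF _ magnus_kernel_3_subgroup])
    (auto simp: magnus_kernel_2_def magnus_kernel_3_def mu_commutator1 mu_commutator2 lower_central_2_mu1 lower_central_2_carrier)

lemma lower_central_3_subset_2: "lower_central F 3 \<subseteq> lower_central F 2"
  using lower_central_Suc_subset[of 2] by (simp add: eval_nat_numeral)

lemma lower_central_4_subset_3: "lower_central F 4 \<subseteq> lower_central F 3"
  using lower_central_Suc_subset[of 3] by (simp add: eval_nat_numeral)

text \<open>On a commutator of \<open>u\<close> and \<open>k\<close>, with u_ij and k_i denoting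
  coefficients, X_i X_j X_i has coefficient 2 u_ij k_i and X_j X_i X_i has -u_ij k_i, because the
  quadratic part of \<open>u\<close> is antisymmetric. This is the source of the factor 2 in the
  divisibility conditions.\<close>

lemma lower_central_3_relation:
  assumes "u \<in> lower_central F 3"
  shows "\<mu> u [i, j, i] = - 2 * \<mu> u [j, i, i]"
proof -
  let ?f = "\<lambda>(i, j) u. \<mu> u [i, j, i] + 2 * \<mu> u [j, i, i]"
  let ?H = "{u \<in> magnus_kernel_3. \<forall>t\<in>UNIV. 0 dvd ?f t u}"
  have "subgroup ?H F"
    by (rule subgroup_dvd_additive[OF magnus_kernel_3_subgroup]) (auto simp: mu_mult3 magnus_kernel_2_def magnus_kernel_3_def)
  then have "lower_central F 3 \<subseteq> ?H"
    unfolding lower_central_3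
  proof (rule generate_subgroup_incl[rotated], clarify)
    fix u k assume u: "u \<in> lower_central F 2" and k: "k \<in> carrier F"
    have "commutator F u k \<in> lower_central F 3"
      unfolding lower_central_3 using u k by (auto intro: generate.incl)
    then have "commutator F u k \<in> magnus_kernel_3" using lower_central_3_magnus_kernel_3 by blast
    moreover have "?f (i, j) (commutator F u k) = 0" for i j
      \<comment> \<open>Antisymmetry at the pair \<open>i\<close>, \<open>i\<close> makes the
        diagonal coefficient vanish.\<close>
      using lower_central_2_antisym[OF u, of i j] lower_central_2_antisym[OF u, of i i]
        lower_central_2_carrier[OF u] lower_central_2_mu1[OF u] k
      by (simp add: mu_commutator3)
    ultimately show "commutator F u k \<in> magnus_kernel_3 \<and> (\<forall>t\<in>UNIV. 0 dvd ?f t (commutator F u k))" by auto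
  qed
  with assms have "?f (i, j) u = 0" by auto
  then show ?thesis by simp
qed

lemma lower_central_4_mu3:
  assumes "u \<in> lower_central F 4"
  shows "\<mu> u [i, j, k] = 0"
proof -
  let ?f = "\<lambda>(i, j, k) u. \<mu> u [i, j, k]"
  let ?H = "{u \<in> magnus_kernel_3. \<forall>t\<in>UNIV. 0 dvd ?f t u}"
  have "subgroup ?H F"
    by (rule subgroup_dvd_additive[OF magnus_kernel_3_subgroup]) (auto simp: mu_mult3 magnus_kernel_2_def magnus_kernel_3_def)
  then have "lower_central F 4 \<subseteq> ?H"
    unfolding lower_central_4
  proof (rule generate_subgroup_incl[rotated], clarify)
    fix u k assume u: "u \<in> lower_central F 3" and k: "k \<in> carrier F"
    have "commutator F u k \<in> lower_central F 4"
      unfolding lower_central_4 using u k by (auto intro: generate.incl)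
    then have "commutator F u k \<in> magnus_kernel_3" using lower_central_3_magnus_kernel_3 lower_central_4_subset_3 by blast
    moreover have "u \<in> magnus_kernel_3" using u lower_central_3_magnus_kernel_3 by blast
    then have "?f t (commutator F u k) = 0" for t
      using k by (cases t) (auto simp: mu_commutator3 magnus_kernel_2_def magnus_kernel_3_def)
    ultimately show "commutator F u k \<in> magnus_kernel_3 \<and> (\<forall>t\<in>UNIV. 0 dvd ?f t (commutator F u k))" by auto
  qed
  with assms have "?f (i, j, k) u = 0" by auto
  then show ?thesis by simp
qed

lemma mu_triple_commutator:
  assumes "g \<in> carrier F" "h \<in> carrier F" "k \<in> carrier F"
  shows "\<mu> (commutator F (commutator F g h) k) [p, q, r] =
    (\<mu> g [p] * \<mu> h [q] - \<mu> h [p] * \<mu> g [q]) * \<mu> k [r]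
    - \<mu> k [p] * (\<mu> g [q] * \<mu> h [r] - \<mu> h [q] * \<mu> g [r])"
  using assms by (simp add: mu_commutator3 mu_commutator1 mu_commutator2)

end

section \<open>Central images expressed by linear and quadratic coefficients\<close>

lemma finprod_pow_hom:
  fixes n :: "'c \<Rightarrow> 'b \<Rightarrow> int"
  assumes "comm_group C" "v \<in> B \<rightarrow> carrier C"
    and "\<And>u u' b. u \<in> H \<Longrightarrow> u' \<in> H \<Longrightarrow> b \<in> B \<Longrightarrow> n (u \<otimes>\<^bsub>G\<^esub> u') b = n u b + n u' b"
  shows "(\<lambda>u. finprod C (\<lambda>b. v b [^]\<^bsub>C\<^esub> n u b) B) \<in> hom (G\<lparr>carrier := H\<rparr>) C"
proof -
  interpret C: comm_group C by fact
  show ?thesis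
    using assms(2,3) by (intro homI) (auto intro!: C.finprod_closed C.finprod_int_pow_add)
qed

lemma (in group_hom) hom_into_center:
  assumes "H' \<subseteq> carrier G" "\<And>u. u \<in> H' \<Longrightarrow> h u \<in> center H"
  shows "h \<in> hom (G\<lparr>carrier := H'\<rparr>) (H\<lparr>carrier := center H\<rparr>)"
  using assms by (intro homI) (auto simp: subset_iff)

context magnus
begin

context
  fixes Q :: "('q, 'r) monoid_scheme" and \<pi> :: "'a \<Rightarrow> 'q"
  assumes hom: "group_hom F Q \<pi>"
begin

interpretation \<pi>: group_hom F Q \<pi> by (rule hom)

interpretation C: comm_group "center_group Q" by (rule \<pi>.H.center_comm_group)

lemma pi_commutator_hom_left:
  assumes H: "H \<subseteq> carrier F" and k: "k \<in> carrier F"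
    and c: "\<And>u. u \<in> H \<Longrightarrow> \<pi> (commutator F u k) \<in> center Q"
  shows "(\<lambda>u. \<pi> (commutator F u k)) \<in> hom (F\<lparr>carrier := H\<rparr>) (center_group Q)"
proof (rule homI)
  fix u v assume "u \<in> carrier (F\<lparr>carrier := H\<rparr>)" "v \<in> carrier (F\<lparr>carrier := H\<rparr>)"
  then have uv: "u \<in> carrier F" "v \<in> carrier F" "u \<in> H" using H by auto
  with c[of u] k have "commutator Q (\<pi> u) (\<pi> k) \<in> center Q" by (simp add: \<pi>.hom_commutator)
  then show "\<pi> (commutator F (u \<otimes>\<^bsub>F\<lparr>carrier := H\<rparr>\<^esub> v) k)
      = \<pi> (commutator F u k) \<otimes>\<^bsub>center_group Q\<^esub> \<pi> (commutator F v k)"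
    using uv k by (simp add: \<pi>.hom_commutator \<pi>.H.commutator_central_mult_left)
qed (use c in auto)

lemma pi_commutator_hom_right:
  assumes u: "u \<in> carrier F"
    and c: "\<And>k. k \<in> carrier F \<Longrightarrow> \<pi> (commutator F u k) \<in> center Q"
  shows "(\<lambda>k. \<pi> (commutator F u k)) \<in> hom (F\<lparr>carrier := carrier F\<rparr>) (center_group Q)"
proof (rule homI)
  fix k l assume "k \<in> carrier (F\<lparr>carrier := carrier F\<rparr>)" "l \<in> carrier (F\<lparr>carrier := carrier F\<rparr>)"
  then have kl: "k \<in> carrier F" "l \<in> carrier F" by auto
  with c[of k] u have "commutator Q (\<pi> u) (\<pi> k) \<in> center Q" by (simp add: \<pi>.hom_commutator)
  then show "\<pi> (commutator F u (k \<otimes>\<^bsub>F\<lparr>carrier := carrier F\<rparr>\<^esub> l))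
      = \<pi> (commutator F u k) \<otimes>\<^bsub>center_group Q\<^esub> \<pi> (commutator F u l)"
    using kl u by (simp add: \<pi>.hom_commutator \<pi>.H.commutator_central_mult_right)
qed (use c in auto)

lemma finprod_delta:
  assumes "v \<in> B \<rightarrow> center Q" "finite B" "a \<in> B" "\<And>b. b \<in> B \<Longrightarrow> n b = (if b = a then k else 0 :: int)"
  shows "finprod (center_group Q) (\<lambda>b. v b [^]\<^bsub>center_group Q\<^esub> n b) B = v a [^]\<^bsub>center_group Q\<^esub> k"
proof -
  have "v a [^]\<^bsub>center_group Q\<^esub> k \<in> carrier (center_group Q)" by (rule C.int_pow_closed) (use assms in auto)
  then have "finprod (center_group Q) (\<lambda>b. v b [^]\<^bsub>center_group Q\<^esub> k) {a} = v a [^]\<^bsub>center_group Q\<^esub> k"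
    using C.finprod_insert[of "{}" a "\<lambda>b. v b [^]\<^bsub>center_group Q\<^esub> k"] C.r_one by simp
  moreover have "finprod (center_group Q) (\<lambda>b. v b [^]\<^bsub>center_group Q\<^esub> n b) B = finprod (center_group Q) (\<lambda>b. v b [^]\<^bsub>center_group Q\<^esub> k) {a}"
    by (rule C.finprod_int_pow_support) (use assms in auto)
  ultimately show ?thesis by simp
qed

text \<open>Both sides are homomorphisms into the center and agree on each \<open>x a\<close>, whose
  only nonzero linear coefficient is 1 at \<open>a\<close>. In the application \<open>Q\<close> is
  the quotient by the second lower central term.\<close>

lemma decomposition1:
  assumes c: "\<And>u. u \<in> carrier F \<Longrightarrow> \<pi> u \<in> center Q" and u: "u \<in> carrier F"
  shows "\<pi> u = finprod (center_group Q) (\<lambda>i. \<pi> (x i) [^]\<^bsub>center_group Q\<^esub> \<mu> u [i]) I"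
proof (rule hom_eq_generate[where T = "x ` I" and K = "center_group Q"])
  show "\<pi> \<in> hom (F\<lparr>carrier := generate F (x ` I)\<rparr>) (center_group Q)"
    unfolding generate_x by (rule \<pi>.hom_into_center[OF subset_refl c])
  show "(\<lambda>u. finprod (center_group Q) (\<lambda>i. \<pi> (x i) [^]\<^bsub>center_group Q\<^esub> \<mu> u [i]) I) \<in> hom (F\<lparr>carrier := generate F (x ` I)\<rparr>) (center_group Q)"
    unfolding generate_x using c
    by (intro finprod_pow_hom[OF C.comm_group_axioms]) (auto simp: mu_mult1)
  fix t assume "t \<in> x ` I"
  then obtain a where a: "t = x a" "a \<in> I" by auto
  show "\<pi> t = finprod (center_group Q) (\<lambda>i. \<pi> (x i) [^]\<^bsub>center_group Q\<^esub> \<mu> t [i]) I"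
    using a c finprod_delta[of "\<lambda>i. \<pi> (x i)" I a "\<lambda>i. \<mu> t [i]" 1] finite_I
    by (auto simp: mu_x1 C.int_pow_1)
qed (simp_all add: image_subset_iff generate_x u C.is_group)

text \<open>Since commutators have central image, both sides are homomorphisms in each argument of a
  commutator. Agreement on pairs of generators spreads to the second argument, then to the first,
  then to the generated subgroup. Pairs with i < j suffice because a swapped commutator is the
  inverse.\<close>

lemma decomposition2:
  assumes c: "\<And>u. u \<in> lower_central F 2 \<Longrightarrow> \<pi> u \<in> center Q" and u: "u \<in> lower_central F 2"
  shows "\<pi> u = finprod (center_group Q) (\<lambda>(j, i). \<pi> (commutator F (x j) (x i)) [^]\<^bsub>center_group Q\<^esub> \<mu> u [j, i]) {(j, i). j \<in> I \<and> i \<in> I \<and> i < j}"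
proof -
  let ?B = "{(j, i). j \<in> I \<and> i \<in> I \<and> i < j}"
  let ?v = "\<lambda>(j, i). \<pi> (commutator F (x j) (x i))"
  define n where "n u = (\<lambda>(j, i). \<mu> u [j, i])" for u
  define \<psi> where "\<psi> u = finprod (center_group Q) (\<lambda>b. ?v b [^]\<^bsub>center_group Q\<^esub> n u b) ?B" for u
  have fin: "finite ?B" by (rule finite_subset[of _ "I \<times> I"]) (auto simp: finite_I)
  have cc: "commutator F g h \<in> lower_central F 2" if "g \<in> carrier F" "h \<in> carrier F" for g h
    unfolding lower_central_2 using that by (auto intro: generate.incl)
  have pc: "\<pi> (commutator F g h) \<in> center Q" if "g \<in> carrier F" "h \<in> carrier F" for g h
    using that by (intro c cc)
  have v: "?v \<in> ?B \<rightarrow> carrier (center_group Q)" using pc by auto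
  have gen: "\<pi> (commutator F (x a) (x b)) = \<psi> (commutator F (x a) (x b))" if ab: "a \<in> I" "b \<in> I" for a b
  proof -
    have n: "n (commutator F (x a) (x b)) (j, i) = of_bool (j = a \<and> i = b) - of_bool (j = b \<and> i = a)" for i j
      using ab by (simp add: n_def mu_commutator2 mu_x1 of_bool_conj)
    consider "a = b" | "b < a" | "a < b" by linarith
    then show ?thesis
    proof cases
      case 1
      have "\<psi> (commutator F (x b) (x b)) = \<one>\<^bsub>center_group Q\<^esub>"
        unfolding \<psi>_def by (intro C.finprod_one_eqI) (auto simp: n[unfolded 1])
      with 1 ab show ?thesis by (simp add: commutator_self)
    next
      case 2
      then have "\<psi> (commutator F (x a) (x b)) = ?v (a, b) [^]\<^bsub>center_group Q\<^esub> (1::int)"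
        unfolding \<psi>_def using ab v fin by (intro finprod_delta) (auto simp: n)
      with pc ab show ?thesis by (simp add: C.int_pow_1)
    next
      case 3
      then have "\<psi> (commutator F (x a) (x b)) = ?v (b, a) [^]\<^bsub>center_group Q\<^esub> (-1::int)"
        unfolding \<psi>_def using ab v fin by (intro finprod_delta) (auto simp: n)
      also have "\<dots> = inv\<^bsub>center_group Q\<^esub> (?v (b, a))"
        using pc ab by (simp add: C.int_pow_neg C.int_pow_1)
      also have "\<dots> = inv\<^bsub>Q\<^esub> (?v (b, a))"
        using pc ab by (simp add: \<pi>.H.m_inv_consistent[OF \<pi>.H.center_subgroup])
      also have "\<dots> = \<pi> (commutator F (x a) (x b))"
        using ab by (simp add: inv_commutator flip: \<pi>.hom_inv)
      finally show ?thesis by simp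
    qed
  qed
  have n_add: "n (commutator F (g \<otimes> g') h) b = n (commutator F g h) b + n (commutator F g' h) b"
      "n (commutator F h (g \<otimes> g')) b = n (commutator F h g) b + n (commutator F h g') b"
    if "g \<in> carrier F" "g' \<in> carrier F" "h \<in> carrier F" for g g' h b
    using that by (cases b; simp add: n_def mu_commutator2 mu_mult1 algebra_simps)+
  have gen1: "\<pi> (commutator F (x a) h) = \<psi> (commutator F (x a) h)" if a: "a \<in> I" and h: "h \<in> carrier F" for a h
  proof (rule hom_eq_generate[where T = "x ` I" and K = "center_group Q" and u = h])
    show "(\<lambda>h. \<pi> (commutator F (x a) h)) \<in> hom (F\<lparr>carrier := generate F (x ` I)\<rparr>) (center_group Q)"
      unfolding generate_x using a pc by (intro pi_commutator_hom_right) auto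
    show "(\<lambda>h. \<psi> (commutator F (x a) h)) \<in> hom (F\<lparr>carrier := generate F (x ` I)\<rparr>) (center_group Q)"
      unfolding generate_x \<psi>_def
      by (rule finprod_pow_hom[OF C.comm_group_axioms v]) (use a n_add in auto)
  qed (use h a gen in \<open>auto simp: image_subset_iff generate_x C.is_group\<close>)
  have gen2: "\<pi> (commutator F g h) = \<psi> (commutator F g h)" if g: "g \<in> carrier F" and h: "h \<in> carrier F" for g h
  proof (rule hom_eq_generate[where T = "x ` I" and K = "center_group Q" and u = g])
    show "(\<lambda>g. \<pi> (commutator F g h)) \<in> hom (F\<lparr>carrier := generate F (x ` I)\<rparr>) (center_group Q)"
      unfolding generate_x using h pc by (intro pi_commutator_hom_left) auto
    show "(\<lambda>g. \<psi> (commutator F g h)) \<in> hom (F\<lparr>carrier := generate F (x ` I)\<rparr>) (center_group Q)"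
      unfolding generate_x \<psi>_def
      by (rule finprod_pow_hom[OF C.comm_group_axioms v]) (use h n_add in auto)
  qed (use g h gen1 in \<open>auto simp: image_subset_iff generate_x C.is_group\<close>)
  have "\<pi> u = \<psi> u"
  proof (rule hom_eq_generate[where T = "{commutator F g h |g h. g \<in> carrier F \<and> h \<in> carrier F}" and K = "center_group Q" and u = u])
    show "\<pi> \<in> hom (F\<lparr>carrier := generate F {commutator F g h |g h. g \<in> carrier F \<and> h \<in> carrier F}\<rparr>) (center_group Q)"
      unfolding lower_central_2[symmetric] using c lower_central_2_carrier
      by (intro \<pi>.hom_into_center) auto
    show "\<psi> \<in> hom (F\<lparr>carrier := generate F {commutator F g h |g h. g \<in> carrier F \<and> h \<in> carrier F}\<rparr>) (center_group Q)"
      unfolding lower_central_2[symmetric] \<psi>_def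
      by (rule finprod_pow_hom[OF C.comm_group_axioms v])
        (auto simp: n_def mu_mult2 lower_central_2_carrier lower_central_2_mu1)
  qed (use gen2 u lower_central_2[of F] in \<open>auto simp: C.is_group\<close>)
  also have "\<psi> u = finprod (center_group Q) (\<lambda>(j, i). \<pi> (commutator F (x j) (x i)) [^]\<^bsub>center_group Q\<^esub> \<mu> u [j, i]) ?B"
    unfolding \<psi>_def n_def by (simp add: case_prod_beta')
  finally show ?thesis .
qed

end
end

section \<open>Cubic coordinates and multilinearity of threefold commutators\<close>

context magnus
begin

text \<open>In either basis, the coordinate is the coefficient of a monomial that occurs in no other basis
  element.\<close>

definition hall_triples :: "(nat \<times> nat \<times> nat) set" where
  "hall_triples = {(j, i, k). j \<in> I \<and> i \<in> I \<and> k \<in> I \<and> i < j \<and> i \<le> k}"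

text \<open>In general X_i X_j X_k occurs in [[X_j, X_i], X_k] with coefficient -1, whence the sign.
  For \<open>k = i\<close> that monomial has coefficient -2, so X_j X_i X_i, with coefficient 1,
  takes its place.\<close>

definition hall_coeff :: "'a \<Rightarrow> nat \<times> nat \<times> nat \<Rightarrow> int" where
  "hall_coeff u = (\<lambda>(j, i, k). if k = i then \<mu> u [j, i, i] else - \<mu> u [i, j, k])"

definition hall_triples' :: "(nat \<times> nat \<times> nat) set" where
  "hall_triples' = {(j, i, k). j \<in> I \<and> i \<in> I \<and> k \<in> I \<and> i < j \<and> k \<le> j}"

text \<open>In general X_k X_i X_j occurs with coefficient 1, and its middle letter is the one whose
  exponent appears in the first case of the theorem. For \<open>k = j\<close> it has coefficient 2,
  so X_i X_j X_j, with coefficient -1, takes its place.\<close>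

definition hall_coeff' :: "'a \<Rightarrow> nat \<times> nat \<times> nat \<Rightarrow> int" where
  "hall_coeff' u = (\<lambda>(j, i, k). if k = j then - \<mu> u [i, j, j] else \<mu> u [k, i, j])"

abbreviation basic_commutator :: "nat \<times> nat \<times> nat \<Rightarrow> 'a" where
  "basic_commutator \<equiv> \<lambda>(j, i, k). commutator F (commutator F (x j) (x i)) (x k)"

lemma triple_commutator_lower_central_3:
  "g \<in> carrier F \<Longrightarrow> h \<in> carrier F \<Longrightarrow> k \<in> carrier F \<Longrightarrow>
    commutator F (commutator F g h) k \<in> lower_central F 3"
  unfolding lower_central_3 lower_central_2 by (blast intro: generate.incl)

lemma lower_central_3_carrier: "u \<in> lower_central F 3 \<Longrightarrow> u \<in> carrier F"
  using lower_central_3_subset_2 lower_central_2_carrier by blast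

context
  fixes Q :: "('q, 'r) monoid_scheme" and \<pi> :: "'a \<Rightarrow> 'q"
  assumes hom: "group_hom F Q \<pi>" and surj: "\<pi> ` carrier F = carrier Q"
    and central: "\<And>u. u \<in> lower_central F 3 \<Longrightarrow> \<pi> u \<in> center Q"
begin

interpretation \<pi>: group_hom F Q \<pi> by (rule hom)

interpretation C: comm_group "center_group Q" by (rule \<pi>.H.center_comm_group)

lemma class3:
  assumes "a \<in> carrier Q" "b \<in> carrier Q" "c \<in> carrier Q"
  shows "commutator Q (commutator Q a b) c \<in> center Q"
proof -
  obtain a' b' c' where "a = \<pi> a'" "b = \<pi> b'" "c = \<pi> c'" "a' \<in> carrier F" "b' \<in> carrier F" "c' \<in> carrier F"
    using assms unfolding surj[symmetric] by blast
  then show ?thesis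
    using central[OF triple_commutator_lower_central_3[of a' b' c']] by (simp add: \<pi>.hom_commutator)
qed

lemma pi_triple_closed:
  "g \<in> carrier F \<Longrightarrow> h \<in> carrier F \<Longrightarrow> k \<in> carrier F \<Longrightarrow>
    \<pi> (commutator F (commutator F g h) k) \<in> center Q"
  by (intro central triple_commutator_lower_central_3)

lemma pi_triple_hom1:
  assumes "h \<in> carrier F" "k \<in> carrier F"
  shows "(\<lambda>g. \<pi> (commutator F (commutator F g h) k)) \<in> hom (F\<lparr>carrier := carrier F\<rparr>) (center_group Q)"
  using assms pi_triple_closed \<pi>.H.commutator3_mult1[OF class3]
  by (intro homI) (auto simp: \<pi>.hom_commutator)

lemma pi_triple_hom2:
  assumes "h \<in> carrier F" "k \<in> carrier F"
  shows "(\<lambda>g. \<pi> (commutator F (commutator F h g) k)) \<in> hom (F\<lparr>carrier := carrier F\<rparr>) (center_group Q)"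
  using assms pi_triple_closed \<pi>.H.commutator3_mult2[OF class3]
  by (intro homI) (auto simp: \<pi>.hom_commutator)

lemma pi_triple_hom3:
  assumes "h \<in> carrier F" "k \<in> carrier F"
  shows "(\<lambda>g. \<pi> (commutator F (commutator F h k) g)) \<in> hom (F\<lparr>carrier := carrier F\<rparr>) (center_group Q)"
  using assms pi_triple_closed \<pi>.H.commutator3_mult3[OF class3]
  by (intro homI) (auto simp: \<pi>.hom_commutator)

lemma pi_triple_swap:
  assumes "g \<in> carrier F" "h \<in> carrier F" "k \<in> carrier F"
  shows "\<pi> (commutator F (commutator F h g) k) = inv\<^bsub>center_group Q\<^esub> \<pi> (commutator F (commutator F g h) k)"
  using assms pi_triple_closed \<pi>.H.commutator3_swap[OF class3, of "\<pi> g" "\<pi> h" "\<pi> k"]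
  by (simp add: \<pi>.H.m_inv_consistent[OF \<pi>.H.center_subgroup] \<pi>.hom_commutator)

lemma pi_triple_Jacobi:
  assumes "a \<in> carrier F" "b \<in> carrier F" "c \<in> carrier F"
  shows "\<pi> (commutator F (commutator F a b) c) =
    \<pi> (commutator F (commutator F a c) b) \<otimes>\<^bsub>center_group Q\<^esub> inv\<^bsub>center_group Q\<^esub> \<pi> (commutator F (commutator F b c) a)"
  using assms pi_triple_closed \<pi>.H.commutator3_Jacobi[OF class3, of "\<pi> a" "\<pi> b" "\<pi> c"]
  by (simp add: \<pi>.H.m_inv_consistent[OF \<pi>.H.center_subgroup] \<pi>.hom_commutator)

text \<open>Stated for any family \<open>y\<close> whose exponents are signed cubic coefficients, so
  that both bases are instances. Such exponents are additive in each argument of a threefold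
  commutator, so the formula need only be checked on three generators with \<open>b < a\<close>;
  swapping, multilinearity and passage to generated subgroups do the rest.\<close>

lemma decomposition3:
  fixes y :: "'t \<Rightarrow> 'a" and n :: "'a \<Rightarrow> 't \<Rightarrow> int" and s :: "'t \<Rightarrow> int" and p q r :: "'t \<Rightarrow> nat"
  assumes y: "\<And>t. t \<in> B \<Longrightarrow> y t \<in> lower_central F 3"
    and n: "\<And>u t. t \<in> B \<Longrightarrow> n u t = s t * \<mu> u [p t, q t, r t]"
    and gen: "\<And>a b c. a \<in> I \<Longrightarrow> b \<in> I \<Longrightarrow> c \<in> I \<Longrightarrow> b < a \<Longrightarrow>
      \<pi> (basic_commutator (a, b, c)) = finprod (center_group Q) (\<lambda>t. \<pi> (y t) [^]\<^bsub>center_group Q\<^esub> n (basic_commutator (a, b, c)) t) B"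
    and u: "u \<in> lower_central F 3"
  shows "\<pi> u = finprod (center_group Q) (\<lambda>t. \<pi> (y t) [^]\<^bsub>center_group Q\<^esub> n u t) B"
proof -
  let ?\<psi> = "\<lambda>u. finprod (center_group Q) (\<lambda>t. \<pi> (y t) [^]\<^bsub>center_group Q\<^esub> n u t) B"
  let ?c = "\<lambda>g h k. commutator F (commutator F g h) k"
  have v: "(\<lambda>t. \<pi> (y t)) \<in> B \<rightarrow> carrier (center_group Q)" using y central by auto
  have cl: "?\<psi> u \<in> carrier (center_group Q)" for u
    by (rule C.finprod_closed, rule Pi_I, rule C.int_pow_closed) (use v in auto)
  have nadd: "n (?c (g \<otimes> g') h k) t = n (?c g h k) t + n (?c g' h k) t"
      "n (?c h (g \<otimes> g') k) t = n (?c h g k) t + n (?c h g' k) t"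
      "n (?c h k (g \<otimes> g')) t = n (?c h k g) t + n (?c h k g') t"
    if "t \<in> B" "g \<in> carrier F" "g' \<in> carrier F" "h \<in> carrier F" "k \<in> carrier F" for g g' h k t
    using that by (simp_all add: n mu_triple_commutator mu_mult1 algebra_simps)
  have gen_swap: "\<pi> (basic_commutator (a, b, c)) = ?\<psi> (basic_commutator (a, b, c))" if abc: "a \<in> I" "b \<in> I" "c \<in> I" for a b c
  proof -
    consider "a = b" | "b < a" | "a < b" by linarith
    then show ?thesis
    proof cases
      case 1
      have "n (basic_commutator (b, b, c)) t = 0" if "t \<in> B" for t
        using that abc by (simp add: n mu_triple_commutator)
      then have "?\<psi> (basic_commutator (b, b, c)) = \<one>\<^bsub>center_group Q\<^esub>" by (intro C.finprod_one_eqI) simp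
      moreover have "\<pi> (basic_commutator (b, b, c)) = \<one>\<^bsub>center_group Q\<^esub>"
        using abc by (simp add: commutator_self commutator_center_left subgroup.one_closed[OF center_subgroup])
      ultimately show ?thesis using 1 by simp
    next
      case 2
      then show ?thesis using gen abc by blast
    next
      case 3
      \<comment> \<open>Swapping the two inner generators negates all exponents, so the two products
        are inverse to each other, just as the two commutators are.\<close>
      have "n (basic_commutator (b, a, c)) t + n (basic_commutator (a, b, c)) t = 0" if "t \<in> B" for t
        using that abc by (simp add: n mu_triple_commutator algebra_simps)
      then have "?\<psi> (basic_commutator (a, b, c)) \<otimes>\<^bsub>center_group Q\<^esub> ?\<psi> (basic_commutator (b, a, c)) = finprod (center_group Q) (\<lambda>t. \<pi> (y t) [^]\<^bsub>center_group Q\<^esub> (0 :: int)) B"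
        using v by (intro C.finprod_int_pow_add[symmetric]) (auto simp: add.commute)
      then have "?\<psi> (basic_commutator (a, b, c)) \<otimes>\<^bsub>center_group Q\<^esub> ?\<psi> (basic_commutator (b, a, c)) = \<one>\<^bsub>center_group Q\<^esub>"
        using C.finprod_one[of B] by simp
      then have "inv\<^bsub>center_group Q\<^esub> (?\<psi> (basic_commutator (b, a, c))) = ?\<psi> (basic_commutator (a, b, c))"
        using cl by (intro C.inv_equality)
      moreover have "\<pi> (basic_commutator (b, a, c)) = ?\<psi> (basic_commutator (b, a, c))"
        using gen[of b a c] 3 abc by blast
      ultimately show ?thesis using pi_triple_swap[of "x b" "x a" "x c"] abc by simp
    qed
  qed
  have gen3: "\<pi> (?c (x a) (x b) k) = ?\<psi> (?c (x a) (x b) k)" if "a \<in> I" "b \<in> I" "k \<in> carrier F" for a b k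
  proof (rule hom_eq_generate[where T = "x ` I" and K = "center_group Q" and u = k])
    show "(\<lambda>k. \<pi> (?c (x a) (x b) k)) \<in> hom (F\<lparr>carrier := generate F (x ` I)\<rparr>) (center_group Q)"
      unfolding generate_x using that by (intro pi_triple_hom3) auto
    show "(\<lambda>k. ?\<psi> (?c (x a) (x b) k)) \<in> hom (F\<lparr>carrier := generate F (x ` I)\<rparr>) (center_group Q)"
      unfolding generate_x
      by (rule finprod_pow_hom[OF C.comm_group_axioms v]) (use that nadd in auto)
  qed (use that gen_swap in \<open>auto simp: image_subset_iff generate_x C.is_group\<close>)
  have gen2: "\<pi> (?c (x a) h k) = ?\<psi> (?c (x a) h k)" if "a \<in> I" "h \<in> carrier F" "k \<in> carrier F" for a h k
  proof (rule hom_eq_generate[where T = "x ` I" and K = "center_group Q" and u = h])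
    show "(\<lambda>h. \<pi> (?c (x a) h k)) \<in> hom (F\<lparr>carrier := generate F (x ` I)\<rparr>) (center_group Q)"
      unfolding generate_x using that by (intro pi_triple_hom2) auto
    show "(\<lambda>h. ?\<psi> (?c (x a) h k)) \<in> hom (F\<lparr>carrier := generate F (x ` I)\<rparr>) (center_group Q)"
      unfolding generate_x
      by (rule finprod_pow_hom[OF C.comm_group_axioms v]) (use that nadd in auto)
  qed (use that gen3 in \<open>auto simp: image_subset_iff generate_x C.is_group\<close>)
  have gen1: "\<pi> (?c g h k) = ?\<psi> (?c g h k)" if "g \<in> carrier F" "h \<in> carrier F" "k \<in> carrier F" for g h k
  proof (rule hom_eq_generate[where T = "x ` I" and K = "center_group Q" and u = g])
    show "(\<lambda>g. \<pi> (?c g h k)) \<in> hom (F\<lparr>carrier := generate F (x ` I)\<rparr>) (center_group Q)"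
      unfolding generate_x using that by (intro pi_triple_hom1) auto
    show "(\<lambda>g. ?\<psi> (?c g h k)) \<in> hom (F\<lparr>carrier := generate F (x ` I)\<rparr>) (center_group Q)"
      unfolding generate_x
      by (rule finprod_pow_hom[OF C.comm_group_axioms v]) (use that nadd in auto)
  qed (use that gen2 in \<open>auto simp: image_subset_iff generate_x C.is_group\<close>)
  have closed: "commutator F w k \<in> lower_central F 3" if "w \<in> lower_central F 2" "k \<in> carrier F" for w k
    using that unfolding lower_central_3 by (auto intro: generate.incl)
  let ?T = "{commutator F g h |g h. g \<in> carrier F \<and> h \<in> carrier F}"
  have gen0: "\<pi> (commutator F w k) = ?\<psi> (commutator F w k)" if w: "w \<in> lower_central F 2" and k: "k \<in> carrier F" for w k
  proof (rule hom_eq_generate[where T = ?T and K = "center_group Q" and u = w])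
    show "(\<lambda>w. \<pi> (commutator F w k)) \<in> hom (F\<lparr>carrier := generate F ?T\<rparr>) (center_group Q)"
      unfolding lower_central_2[symmetric] using k lower_central_2_carrier closed central
      by (intro pi_commutator_hom_left[OF hom]) auto
    show "(\<lambda>w. ?\<psi> (commutator F w k)) \<in> hom (F\<lparr>carrier := generate F ?T\<rparr>) (center_group Q)"
      unfolding lower_central_2[symmetric]
    proof (rule finprod_pow_hom[OF C.comm_group_axioms v])
      fix w w' t assume "w \<in> lower_central F 2" "w' \<in> lower_central F 2" "t \<in> B"
      with k show "n (commutator F (w \<otimes> w') k) t = n (commutator F w k) t + n (commutator F w' k) t"
        by (simp add: n mu_commutator3 mu_mult1 mu_mult2 lower_central_2_carrier lower_central_2_mu1 algebra_simps)
    qed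
  qed (use k gen1 w lower_central_2[of F] in \<open>auto simp: C.is_group\<close>)
  let ?T = "{commutator F u k |u k. u \<in> lower_central F 2 \<and> k \<in> carrier F}"
  show ?thesis
  proof (rule hom_eq_generate[where T = ?T and K = "center_group Q" and u = u])
    show "\<pi> \<in> hom (F\<lparr>carrier := generate F ?T\<rparr>) (center_group Q)"
      unfolding lower_central_3[symmetric] using central lower_central_3_carrier
      by (intro \<pi>.hom_into_center) auto
    show "?\<psi> \<in> hom (F\<lparr>carrier := generate F ?T\<rparr>) (center_group Q)"
      unfolding lower_central_3[symmetric]
    proof (rule finprod_pow_hom[OF C.comm_group_axioms v])
      fix w w' t assume w: "w \<in> lower_central F 3" "w' \<in> lower_central F 3" "t \<in> B"
      then have "w \<in> magnus_kernel_3" "w' \<in> magnus_kernel_3" using lower_central_3_magnus_kernel_3 by auto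
      with w show "n (w \<otimes> w') t = n w t + n w' t"
        by (simp add: n magnus_kernel_3_def magnus_kernel_2_def mu_mult3 algebra_simps)
    qed
    show "?T \<subseteq> carrier F" using lower_central_2_carrier by auto
  qed (use gen0 u lower_central_3[of F] in \<open>auto simp: C.is_group\<close>)
qed

end
end

section \<open>Two bases of the third lower central factor\<close>

text \<open>This is the exponent pattern left by one application of the Jacobi identity.\<close>

lemma (in comm_group) finprod_delta2:
  assumes "v \<in> B \<rightarrow> carrier G" "finite B" "a \<in> B" "a' \<in> B" "a \<noteq> a'"
    and "\<And>b. b \<in> B \<Longrightarrow> n b = (if b = a then 1 else if b = a' then -1 else 0 :: int)"
  shows "(\<Otimes>b\<in>B. v b [^] n b) = v a \<otimes> inv (v a')"
proof -
  have "(\<Otimes>b\<in>B. v b [^] n b) = (\<Otimes>b\<in>{a, a'}. v b [^] (if b = a then 1 else -1 :: int))"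
    using assms by (intro finprod_int_pow_support) auto
  also have "\<dots> = v a \<otimes> inv (v a')"
    using assms(1,3,4,5) by (subst finprod_insert) (auto simp: Pi_iff int_pow_neg)
  finally show ?thesis .
qed

context magnus
begin

lemma finite_hall_triples: "finite hall_triples" "finite hall_triples'"
  by (rule finite_subset[of _ "I \<times> I \<times> I"], auto simp: hall_triples_def hall_triples'_def finite_I)+

lemma mu_basic_commutator:
  assumes "a \<in> I" "b \<in> I" "c \<in> I"
  shows "\<mu> (commutator F (commutator F (x a) (x b)) (x c)) [p, q, r] =
    (of_bool (p = a \<and> q = b) - of_bool (p = b \<and> q = a)) * of_bool (r = c)
    - of_bool (p = c) * (of_bool (q = a \<and> r = b) - of_bool (q = b \<and> r = a))"
  using assms by (simp add: mu_triple_commutator mu_x1 of_bool_conj)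

lemma basic_commutator_lower_central_3:
  "t \<in> hall_triples \<or> t \<in> hall_triples' \<Longrightarrow> basic_commutator t \<in> lower_central F 3"
  by (auto simp: hall_triples_def hall_triples'_def intro!: triple_commutator_lower_central_3)

context
  fixes Q :: "('q, 'r) monoid_scheme" and \<pi> :: "'a \<Rightarrow> 'q"
  assumes hom: "group_hom F Q \<pi>" and surj: "\<pi> ` carrier F = carrier Q"
    and central: "\<And>u. u \<in> lower_central F 3 \<Longrightarrow> \<pi> u \<in> center Q"
begin

interpretation \<pi>: group_hom F Q \<pi> by (rule hom)

interpretation C: comm_group "center_group Q" by (rule \<pi>.H.center_comm_group)

lemma pi_basic_commutator_closed:
  "(\<lambda>t. \<pi> (basic_commutator t)) \<in> hall_triples \<rightarrow> center Q" "(\<lambda>t. \<pi> (basic_commutator t)) \<in> hall_triples' \<rightarrow> center Q"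
  using basic_commutator_lower_central_3 central by blast+

lemma pi_basic_commutator_Jacobi:
  assumes "a \<in> I" "b \<in> I" "c \<in> I"
  shows "\<pi> (basic_commutator (a, b, c)) =
    \<pi> (basic_commutator (a, c, b)) \<otimes>\<^bsub>center_group Q\<^esub> inv\<^bsub>center_group Q\<^esub> \<pi> (basic_commutator (b, c, a))"
  using pi_triple_Jacobi[OF hom surj central, of "x a" "x b" "x c"] assms by simp

text \<open>Swapping both inner commutators on the right of the Jacobi identity brings
  \<open>c\<close> to the front, which is where the second basis wants it when \<open>c\<close> is
  the largest index.\<close>

lemma pi_basic_commutator_Jacobi':
  assumes "a \<in> I" "b \<in> I" "c \<in> I"
  shows "\<pi> (basic_commutator (a, b, c)) =
    \<pi> (basic_commutator (c, b, a)) \<otimes>\<^bsub>center_group Q\<^esub> inv\<^bsub>center_group Q\<^esub> \<pi> (basic_commutator (c, a, b))"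
proof -
  have cl: "\<pi> (basic_commutator t) \<in> carrier (center_group Q)" if "t \<in> {(c, b, a), (c, a, b)}" for t
    using that assms pi_triple_closed[OF hom surj central] by auto
  have "\<pi> (basic_commutator (a, b, c)) = inv\<^bsub>center_group Q\<^esub> \<pi> (basic_commutator (c, a, b)) \<otimes>\<^bsub>center_group Q\<^esub>
      inv\<^bsub>center_group Q\<^esub> (inv\<^bsub>center_group Q\<^esub> \<pi> (basic_commutator (c, b, a)))"
    using pi_basic_commutator_Jacobi[OF assms] assms
      pi_triple_swap[OF hom surj central, of "x c" "x a" "x b"]
      pi_triple_swap[OF hom surj central, of "x c" "x b" "x a"] by simp
  then show ?thesis
    using C.inv_inv[OF cl[of "(c, b, a)"]] C.m_comm[OF C.inv_closed[OF cl[of "(c, a, b)"]] cl[of "(c, b, a)"]]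
    by simp
qed

text \<open>A commutator with \<open>b \<le> c\<close> belongs to the family. Otherwise
  \<open>c\<close> is the smallest index, and the Jacobi identity rewrites it by two commutators
  with \<open>c\<close> in second place.\<close>

lemma hall_decomposition:
  assumes u: "u \<in> lower_central F 3"
  shows "\<pi> u = finprod (center_group Q) (\<lambda>t. \<pi> (basic_commutator t) [^]\<^bsub>center_group Q\<^esub> hall_coeff u t) hall_triples"
proof (rule decomposition3[OF hom surj central, where
      s = "\<lambda>(j, i, k). if k = i then 1 else -1" and
      p = "\<lambda>(j, i, k). if k = i then j else i" and
      q = "\<lambda>(j, i, k). if k = i then i else j" and
      r = "\<lambda>(j, i, k). if k = i then i else k", OF _ _ _ _ u])
  fix a b c assume abc: "a \<in> I" "b \<in> I" "c \<in> I" "b < a"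
  show "\<pi> (basic_commutator (a, b, c)) = finprod (center_group Q)
      (\<lambda>t. \<pi> (basic_commutator t) [^]\<^bsub>center_group Q\<^esub> hall_coeff (basic_commutator (a, b, c)) t) hall_triples"
  proof (cases "b \<le> c")
    case True
    have mem: "(a, b, c) \<in> hall_triples" using abc True by (simp add: hall_triples_def)
    have n: "hall_coeff (basic_commutator (a, b, c)) t = (if t = (a, b, c) then 1 else 0)" if "t \<in> hall_triples" for t
    proof -
      obtain j i k where t: "t = (j, i, k)" by (cases t)
      show ?thesis
        using that abc True unfolding t hall_coeff_def
        by (simp only: mu_basic_commutator prod.case split: if_split) (auto simp: hall_triples_def)
    qed
    have "\<pi> (basic_commutator (a, b, c)) \<in> carrier (center_group Q)"
      using funcset_mem[OF pi_basic_commutator_closed(1) mem] by simp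
    from C.int_pow_1[OF this] show ?thesis
      using finprod_delta[OF hom pi_basic_commutator_closed(1) finite_hall_triples(1) mem n] by simp
  next
    case False
    have mem: "(a, c, b) \<in> hall_triples" "(b, c, a) \<in> hall_triples" using abc False by (auto simp: hall_triples_def)
    have n: "hall_coeff (basic_commutator (a, b, c)) t = (if t = (a, c, b) then 1 else if t = (b, c, a) then -1 else 0)"
      if "t \<in> hall_triples" for t
    proof -
      obtain j i k where t: "t = (j, i, k)" by (cases t)
      show ?thesis
        using that abc False unfolding t hall_coeff_def
        by (simp only: mu_basic_commutator prod.case split: if_split) (auto simp: hall_triples_def)
    qed
    have "finprod (center_group Q)
      (\<lambda>t. \<pi> (basic_commutator t) [^]\<^bsub>center_group Q\<^esub> hall_coeff (basic_commutator (a, b, c)) t) hall_triples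
      = \<pi> (basic_commutator (a, c, b)) \<otimes>\<^bsub>center_group Q\<^esub> inv\<^bsub>center_group Q\<^esub> \<pi> (basic_commutator (b, c, a))"
      by (rule C.finprod_delta2) (use pi_basic_commutator_closed mem n finite_hall_triples abc in auto)
    with pi_basic_commutator_Jacobi[OF abc(1,2,3)] show ?thesis by simp
  qed
qed (auto simp: hall_coeff_def basic_commutator_lower_central_3)

lemma hall_decomposition':
  assumes u: "u \<in> lower_central F 3"
  shows "\<pi> u = finprod (center_group Q) (\<lambda>t. \<pi> (basic_commutator t) [^]\<^bsub>center_group Q\<^esub> hall_coeff' u t) hall_triples'"
proof (rule decomposition3[OF hom surj central, where
      s = "\<lambda>(j, i, k). if k = j then -1 else 1" and
      p = "\<lambda>(j, i, k). if k = j then i else k" and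
      q = "\<lambda>(j, i, k). if k = j then j else i" and
      r = "\<lambda>(j, i, k). j", OF _ _ _ _ u])
  fix a b c assume abc: "a \<in> I" "b \<in> I" "c \<in> I" "b < a"
  show "\<pi> (basic_commutator (a, b, c)) = finprod (center_group Q)
      (\<lambda>t. \<pi> (basic_commutator t) [^]\<^bsub>center_group Q\<^esub> hall_coeff' (basic_commutator (a, b, c)) t) hall_triples'"
  proof (cases "c \<le> a")
    case True
    have mem: "(a, b, c) \<in> hall_triples'" using abc True by (simp add: hall_triples'_def)
    have n: "hall_coeff' (basic_commutator (a, b, c)) t = (if t = (a, b, c) then 1 else 0)" if "t \<in> hall_triples'" for t
    proof -
      obtain j i k where t: "t = (j, i, k)" by (cases t)
      show ?thesis
        using that abc True unfolding t hall_coeff'_def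
        by (simp only: mu_basic_commutator prod.case split: if_split) (auto simp: hall_triples'_def)
    qed
    have "\<pi> (basic_commutator (a, b, c)) \<in> carrier (center_group Q)"
      using funcset_mem[OF pi_basic_commutator_closed(2) mem] by simp
    from C.int_pow_1[OF this] show ?thesis
      using finprod_delta[OF hom pi_basic_commutator_closed(2) finite_hall_triples(2) mem n] by simp
  next
    case False
    have mem: "(c, b, a) \<in> hall_triples'" "(c, a, b) \<in> hall_triples'" using abc False by (auto simp: hall_triples'_def)
    have n: "hall_coeff' (basic_commutator (a, b, c)) t = (if t = (c, b, a) then 1 else if t = (c, a, b) then -1 else 0)"
      if "t \<in> hall_triples'" for t
    proof -
      obtain j i k where t: "t = (j, i, k)" by (cases t)
      show ?thesis
        using that abc False unfolding t hall_coeff'_def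
        by (simp only: mu_basic_commutator prod.case split: if_split) (auto simp: hall_triples'_def)
    qed
    have "finprod (center_group Q)
      (\<lambda>t. \<pi> (basic_commutator t) [^]\<^bsub>center_group Q\<^esub> hall_coeff' (basic_commutator (a, b, c)) t) hall_triples'
      = \<pi> (basic_commutator (c, b, a)) \<otimes>\<^bsub>center_group Q\<^esub> inv\<^bsub>center_group Q\<^esub> \<pi> (basic_commutator (c, a, b))"
      by (rule C.finprod_delta2) (use pi_basic_commutator_closed mem n finite_hall_triples abc in auto)
    with pi_basic_commutator_Jacobi'[OF abc(1,2,3)] show ?thesis by simp
  qed
qed (auto simp: hall_coeff'_def basic_commutator_lower_central_3)

end
end

section \<open>From vanishing coefficients to membership\<close>

text \<open>The product in the center of the quotient is the coset of a product of elements of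
  \<open>H\<close>, and \<open>H\<close> contains the whole coset because it contains
  \<open>N\<close>. With \<open>H = N\<close> and zero exponents this is a vanishing criterion; a
  larger \<open>H\<close> gives membership in a subgroup generated by powers.\<close>

lemma (in group) mem_of_finprod_cosets:
  fixes n :: "'t \<Rightarrow> int"
  assumes N: "N \<lhd> G" and H: "subgroup H G" "N \<subseteq> H" and B: "finite B"
    and y: "\<And>b. b \<in> B \<Longrightarrow> y b \<in> carrier G" "\<And>b. b \<in> B \<Longrightarrow> N #> y b \<in> center (G Mod N)"
      "\<And>b. b \<in> B \<Longrightarrow> y b [^] n b \<in> H"
    and u: "u \<in> carrier G"
      "N #> u = finprod (center_group (G Mod N)) (\<lambda>b. (N #> y b) [^]\<^bsub>center_group (G Mod N)\<^esub> n b) B"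
  shows "u \<in> H"
proof -
  interpret N: normal N G by fact
  interpret H: subgroup H G by fact
  interpret Q: group "G Mod N" by (rule N.factorgroup_is_group)
  interpret C: comm_group "center_group (G Mod N)" by (rule Q.center_comm_group)
  have pow: "(N #> y b) [^]\<^bsub>center_group (G Mod N)\<^esub> n b = N #> (y b [^] n b)" if "b \<in> B" for b
    using Q.int_pow_consistent[OF Q.center_subgroup y(2)[OF that], of "n b"]
      N.FactGroup_int_pow[OF y(1)[OF that], of "n b"] by simp
  have cl: "(N #> y b) [^]\<^bsub>center_group (G Mod N)\<^esub> n b \<in> carrier (center_group (G Mod N))" if "b \<in> B" for b
    by (rule C.int_pow_closed) (use y that in auto)
  have "\<exists>h\<in>H. finprod (center_group (G Mod N)) (\<lambda>b. (N #> y b) [^]\<^bsub>center_group (G Mod N)\<^esub> n b) B = N #> h"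
    using B pow cl y(3)
  proof (induction B)
    case empty
    then show ?case using H.one_closed by (intro bexI[of _ \<one>]) (simp_all add: N.subset)
  next
    case (insert b B)
    then obtain h where h: "h \<in> H"
      "finprod (center_group (G Mod N)) (\<lambda>b. (N #> y b) [^]\<^bsub>center_group (G Mod N)\<^esub> n b) B = N #> h"
      by auto
    have b: "y b [^] n b \<in> H" using insert.prems by simp
    have "finprod (center_group (G Mod N)) (\<lambda>b. (N #> y b) [^]\<^bsub>center_group (G Mod N)\<^esub> n b) (insert b B)
        = ((N #> y b) [^]\<^bsub>center_group (G Mod N)\<^esub> n b) \<otimes>\<^bsub>center_group (G Mod N)\<^esub>
          finprod (center_group (G Mod N)) (\<lambda>b. (N #> y b) [^]\<^bsub>center_group (G Mod N)\<^esub> n b) B"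
      by (rule C.finprod_insert) (use insert.hyps insert.prems(2) in auto)
    also have "\<dots> = (N #> (y b [^] n b)) \<otimes>\<^bsub>center_group (G Mod N)\<^esub> (N #> h)"
      using insert.prems(1)[of b] by (simp add: h(2))
    also have "\<dots> = N #> (y b [^] n b \<otimes> h)"
      using b h(1) H.mem_carrier by (simp add: N.rcos_sum)
    finally show ?case using b h(1) H.m_closed by blast
  qed
  then obtain h where h: "h \<in> H" "N #> u = N #> h" using u by auto
  have "u \<in> N #> u" using rcos_self[OF u(1) N.subgroup_axioms] .
  then have "u \<in> N #> h" by (simp only: h(2))
  then obtain z where "z \<in> N" "u = z \<otimes> h" unfolding r_coset_def by auto
  with h(1) H(2) H.m_closed show ?thesis by auto
qed

lemma (in group) rcoset_in_center:
  assumes N: "N \<lhd> G" and u: "u \<in> carrier G" and c: "\<And>g. g \<in> carrier G \<Longrightarrow> commutator G u g \<in> N"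
  shows "N #> u \<in> center (G Mod N)"
proof (rule centerI)
  interpret N: normal N G by fact
  show "N #> u \<in> carrier (G Mod N)" using u by (simp add: carrier_FactGroup)
  fix A assume "A \<in> carrier (G Mod N)"
  then obtain g where g: "A = N #> g" "g \<in> carrier G" by (auto simp: carrier_FactGroup)
  have "N #> (u \<otimes> g) = (N #> (g \<otimes> u)) \<otimes>\<^bsub>G Mod N\<^esub> (N #> commutator G u g)"
    using u g by (subst commutator_eq) (simp_all add: N.rcos_sum)
  also have "N #> commutator G u g = N"
    using c[OF g(2)] N.rcos_const by simp
  also have "(N #> (g \<otimes> u)) \<otimes>\<^bsub>G Mod N\<^esub> N = N #> (g \<otimes> u)"
    using group.is_monoid[OF N.factorgroup_is_group, THEN monoid.r_one, of "N #> (g \<otimes> u)"] u g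
    by (auto simp: carrier_FactGroup)
  finally show "(N #> u) \<otimes>\<^bsub>G Mod N\<^esub> A = A \<otimes>\<^bsub>G Mod N\<^esub> (N #> u)"
    using u g by (simp add: N.rcos_sum)
qed

context magnus
begin

lemma quotient_facts:
  assumes N: "N \<lhd> F"
  shows "group_hom F (F Mod N) (\<lambda>u. N #> u)" "(\<lambda>u. N #> u) ` carrier F = carrier (F Mod N)"
proof -
  interpret N: normal N F by fact
  show "group_hom F (F Mod N) (\<lambda>u. N #> u)"
    by (simp add: group_hom_def group_hom_axioms_def is_group N.factorgroup_is_group N.r_coset_hom_Mod)
  show "(\<lambda>u. N #> u) ` carrier F = carrier (F Mod N)" by (simp add: carrier_FactGroup)
qed

lemma lower_central_2I:
  assumes u: "u \<in> carrier F" "\<And>i. i \<in> I \<Longrightarrow> \<mu> u [i] = 0"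
  shows "u \<in> lower_central F 2"
proof (rule mem_of_finprod_cosets[where N = "lower_central F 2" and B = I and y = x and n = "\<lambda>i. \<mu> u [i]"])
  note N = lower_central_normal[of 2]
  have c: "lower_central F 2 #> g \<in> center (F Mod lower_central F 2)" if "g \<in> carrier F" for g
    using N that by (rule rcoset_in_center) (use that in \<open>auto simp: lower_central_2 intro: generate.incl\<close>)
  show "lower_central F 2 #> u = finprod (center_group (F Mod lower_central F 2))
      (\<lambda>b. (lower_central F 2 #> x b) [^]\<^bsub>center_group (F Mod lower_central F 2)\<^esub> \<mu> u [b]) I"
    by (rule decomposition1[OF quotient_facts(1)[OF N] c u(1)])
  show "subgroup (lower_central F 2) F" using N by (rule normal_imp_subgroup)
  show "lower_central F 2 #> x b \<in> center (F Mod lower_central F 2)" if "b \<in> I" for b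
    using c that by simp
  show "x b [^] \<mu> u [b] \<in> lower_central F 2" if "b \<in> I" for b
    using that u(2) subgroup.one_closed[OF normal_imp_subgroup[OF N]] by simp
qed (use u finite_I lower_central_normal in auto)

text \<open>Vanishing linear coefficients put \<open>u\<close> into the second term. Modulo the
  third term it is then a product of commutators of generators with its quadratic coefficients as
  exponents, all zero.\<close>

lemma lower_central_3I:
  assumes u: "u \<in> carrier F" "\<And>i. i \<in> I \<Longrightarrow> \<mu> u [i] = 0" "\<And>i j. i \<in> I \<Longrightarrow> j \<in> I \<Longrightarrow> \<mu> u [i, j] = 0"
  shows "u \<in> lower_central F 3"
proof (rule mem_of_finprod_cosets[where N = "lower_central F 3" and B = "{(j, i). j \<in> I \<and> i \<in> I \<and> i < j}"
      and y = "\<lambda>(j, i). commutator F (x j) (x i)" and n = "\<lambda>(j, i). \<mu> u [j, i]"])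
  note N = lower_central_normal[of 3]
  have c: "lower_central F 3 #> g \<in> center (F Mod lower_central F 3)" if "g \<in> lower_central F 2" for g
    by (rule rcoset_in_center[OF N lower_central_2_carrier[OF that]])
      (use that in \<open>auto simp: lower_central_3 intro: generate.incl\<close>)
  show "lower_central F 3 #> u = finprod (center_group (F Mod lower_central F 3))
      (\<lambda>b. (lower_central F 3 #> (case b of (j, i) \<Rightarrow> commutator F (x j) (x i)))
        [^]\<^bsub>center_group (F Mod lower_central F 3)\<^esub> (case b of (j, i) \<Rightarrow> \<mu> u [j, i]))
      {(j, i). j \<in> I \<and> i \<in> I \<and> i < j}"
    using decomposition2[OF quotient_facts(1)[OF N] c lower_central_2I[OF u(1,2)]]
    by (simp add: case_prod_beta')
  show "subgroup (lower_central F 3) F" using N by (rule normal_imp_subgroup)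
  show "finite {(j, i). j \<in> I \<and> i \<in> I \<and> i < j}"
    by (rule finite_subset[of _ "I \<times> I"]) (auto simp: finite_I)
  show "lower_central F 3 #> (case b of (j, i) \<Rightarrow> commutator F (x j) (x i)) \<in> center (F Mod lower_central F 3)"
    if "b \<in> {(j, i). j \<in> I \<and> i \<in> I \<and> i < j}" for b
    using that commutator_lower_central[of _ 1] by (auto intro!: c simp: numeral_2_eq_2)
  show "(case b of (j, i) \<Rightarrow> commutator F (x j) (x i)) [^] (case b of (j, i) \<Rightarrow> \<mu> u [j, i]) \<in> lower_central F 3"
    if "b \<in> {(j, i). j \<in> I \<and> i \<in> I \<and> i < j}" for b
    using that u(3) subgroup.one_closed[OF normal_imp_subgroup[OF N]] by auto
qed (use u lower_central_normal in auto)

lemma lower_central_3_central: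
  "u \<in> lower_central F 3 \<Longrightarrow> lower_central F 4 #> u \<in> center (F Mod lower_central F 4)"
  by (rule rcoset_in_center[OF lower_central_normal lower_central_3_carrier])
    (auto simp: lower_central_4 intro: generate.incl)

lemma mem_of_hall_decomposition:
  assumes H: "subgroup H F" "lower_central F 4 \<subseteq> H" and u: "u \<in> lower_central F 3"
    and t: "\<And>t. t \<in> hall_triples \<Longrightarrow> basic_commutator t [^] hall_coeff u t \<in> H"
  shows "u \<in> H"
proof (rule mem_of_finprod_cosets[OF lower_central_normal H finite_hall_triples(1) _ _ t
      lower_central_3_carrier[OF u] hall_decomposition])
  show "basic_commutator b \<in> carrier F" "lower_central F 4 #> basic_commutator b \<in> center (F Mod lower_central F 4)"
    if "b \<in> hall_triples" for b
    using basic_commutator_lower_central_3[OF disjI1[OF that]] lower_central_3_central lower_central_3_carrier by auto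
qed (use u quotient_facts[OF lower_central_normal] lower_central_3_central in auto)

lemma mem_of_hall_decomposition':
  assumes H: "subgroup H F" "lower_central F 4 \<subseteq> H" and u: "u \<in> lower_central F 3"
    and t: "\<And>t. t \<in> hall_triples' \<Longrightarrow> basic_commutator t [^] hall_coeff' u t \<in> H"
  shows "u \<in> H"
proof (rule mem_of_finprod_cosets[OF lower_central_normal H finite_hall_triples(2) _ _ t
      lower_central_3_carrier[OF u] hall_decomposition'])
  show "basic_commutator b \<in> carrier F" "lower_central F 4 #> basic_commutator b \<in> center (F Mod lower_central F 4)"
    if "b \<in> hall_triples'" for b
    using basic_commutator_lower_central_3[OF disjI2[OF that]] lower_central_3_central lower_central_3_carrier by auto
qed (use u quotient_facts[OF lower_central_normal] lower_central_3_central in auto)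

lemma lower_central_4I:
  assumes u: "u \<in> lower_central F 3" and "\<And>i j k. i \<in> I \<Longrightarrow> j \<in> I \<Longrightarrow> k \<in> I \<Longrightarrow> \<mu> u [i, j, k] = 0"
  shows "u \<in> lower_central F 4"
proof (rule mem_of_hall_decomposition[OF normal_imp_subgroup[OF lower_central_normal] subset_refl u])
  fix t assume "t \<in> hall_triples"
  then have "hall_coeff u t = 0" using assms(2) by (auto simp: hall_triples_def hall_coeff_def)
  then show "basic_commutator t [^] hall_coeff u t \<in> lower_central F 4"
    using subgroup.one_closed[OF normal_imp_subgroup[OF lower_central_normal]] by simp
qed

end

section \<open>Ideals of the group ring\<close>

lemma augmentation_ideal_iff:
  "u \<in> augmentation_ideal G \<longleftrightarrow> u \<in> carrier (group_ring G) \<and> linear_extension (\<lambda>_. 1) u = 0"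
  by (simp add: augmentation_ideal_def linear_extension_def)

lemma (in ring) span_prod_subgroup:
  assumes "U \<subseteq> carrier R" "V \<subseteq> carrier R"
  shows "additive_subgroup (span_prod R U V) R"
  unfolding span_prod_def
  by (intro additive_subgroupI add.generate_is_subgroup[simplified])
    (use assms in \<open>auto simp: set_mult_def\<close>)

lemma (in ring) span_prod_incl:
  "u \<in> U \<Longrightarrow> v \<in> V \<Longrightarrow> u \<otimes> v \<in> span_prod R U V"
  unfolding span_prod_def by (rule generate.incl) (auto simp: set_mult_def)

lemma (in ring) span_prod_least:
  assumes J: "additive_subgroup J R" and "\<And>u v. u \<in> U \<Longrightarrow> v \<in> V \<Longrightarrow> u \<otimes> v \<in> J"
  shows "span_prod R U V \<subseteq> J"
  unfolding span_prod_def
  by (rule add.generate_subgroup_incl[OF _ additive_subgroup.a_subgroup[OF J]])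
    (use assms(2) in \<open>auto simp: set_mult_def\<close>)

lemma (in ring) additive_subgroup_finsum:
  assumes J: "additive_subgroup J R" and "finite A" "\<And>a. a \<in> A \<Longrightarrow> f a \<in> J"
  shows "finsum R f A \<in> J"
proof -
  interpret J: additive_subgroup J R by fact
  show ?thesis
    using assms(2,3) by (induction A) (auto simp: finsum_insert Pi_iff J.a_Hcarr)
qed

lemma (in ring) additive_subgroup_add_pow:
  assumes J: "additive_subgroup J R" and u: "u \<in> J"
  shows "add_pow R (n :: int) u \<in> J"
  using add.subgroup_int_pow_closed[OF additive_subgroup.a_subgroup[OF J] u] by simp

lemma (in ring) span_power_subset: "U \<subseteq> carrier R \<Longrightarrow> span_power R U n \<subseteq> carrier R"
proof (induction n)
  case (Suc n)
  then show ?case using additive_subgroup.a_subset[OF span_prod_subgroup] by simp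
qed simp

lemma (in ring) span_power_subgroup: "U \<subseteq> carrier R \<Longrightarrow> additive_subgroup (span_power R U n) R"
  by (cases n) (simp_all add: span_prod_subgroup span_power_subset additive_subgroup.intro add.subgroup_self)

lemma (in group) group_ring_a_inv:
  "v \<in> carrier (group_ring G) \<Longrightarrow> \<ominus>\<^bsub>group_ring G\<^esub> v = (\<lambda>g. - v g)"
  by (rule abelian_group.minus_equality[OF ring.is_abelian_group[OF group_ring_is_ring]])
    (auto simp: group_ring_carrier group_ring_add group_ring_zero)

lemma (in group) group_ring_add_pow:
  assumes u: "u \<in> carrier (group_ring G)"
  shows "add_pow (group_ring G) (n :: int) u = (\<lambda>g. n * u g)"
proof -
  interpret Z: ring "group_ring G" by (rule group_ring_is_ring)
  have nat: "add_pow (group_ring G) (k :: nat) u = (\<lambda>g. int k * u g)" for k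
  proof (induction k)
    case 0
    then show ?case by (simp add: group_ring_zero)
  next
    case (Suc k)
    then show ?case using u by (simp add: group_ring_add algebra_simps)
  qed
  have cl: "(\<lambda>g. int k * u g) \<in> carrier (group_ring G)" for k
    unfolding nat[symmetric] using u by simp
  show ?thesis
    using group_ring_a_inv[OF cl[of "nat (- n)"]]
    by (cases "0 \<le> n") (simp_all add: add_pow_int_ge add_pow_int_lt nat)
qed

text \<open>An element minus its augmentation times 1 is the sum of u_h (h - 1) over its support.
  The induction over the support works with this difference because deleting a point from
  \<open>u\<close> changes the augmentation.\<close>

lemma (in group) augmentation_ideal_least:
  assumes H: "H \<subseteq> carrier G" and J: "additive_subgroup J (group_ring G)"
    and gen: "\<And>h. h \<in> H \<Longrightarrow> group_ring_of h \<ominus>\<^bsub>group_ring G\<^esub> \<one>\<^bsub>group_ring G\<^esub> \<in> J"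
  shows "augmentation_ideal (G\<lparr>carrier := H\<rparr>) \<subseteq> J"
proof -
  interpret Z: ring "group_ring G" by (rule group_ring_is_ring)
  interpret J: additive_subgroup J "group_ring G" by fact
  have one: "group_ring_of \<one> \<in> carrier (group_ring G)" by (simp add: group_ring_of_closed)
  have "(\<lambda>g. u g - linear_extension (\<lambda>_. 1) u * group_ring_of \<one> g) \<in> J"
    if "finite A" "{g. u g \<noteq> 0} \<subseteq> A" "A \<subseteq> H" for u A
    using that
  proof (induction A arbitrary: u)
    case empty
    then have "u = (\<lambda>_. 0)" by auto
    with J.zero_closed show ?case by (simp add: group_ring_zero)
  next
    case (insert h A)
    let ?u = "u(h := 0)"
    have fin: "finite {g. ?u g \<noteq> 0}" "finite {g. u h * group_ring_of h g \<noteq> 0}"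
      using insert by (auto intro!: finite_subset[of _ "insert h A"] simp: group_ring_of_def)
    have u: "u = (\<lambda>g. ?u g + u h * group_ring_of h g)" by (auto simp: group_ring_of_def)
    have "linear_extension (\<lambda>_. 1) (\<lambda>g. u h * group_ring_of h g) = (\<Sum>g\<in>{h}. u h * group_ring_of h g * 1)"
      by (rule linear_extension_superset) (auto simp: group_ring_of_def)
    moreover have "linear_extension (\<lambda>_. 1) u = linear_extension (\<lambda>_. 1) (\<lambda>g. ?u g + u h * group_ring_of h g)"
      by (rule arg_cong[OF u])
    ultimately have linear_extension: "linear_extension (\<lambda>_. 1) u = linear_extension (\<lambda>_. 1) ?u + u h"
      unfolding linear_extension_add[OF fin] by (simp add: group_ring_of_def)
    have hG: "group_ring_of h \<in> carrier (group_ring G)" using insert.prems H by (intro group_ring_of_closed) auto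
    have "(\<lambda>g. ?u g - linear_extension (\<lambda>_. 1) ?u * group_ring_of \<one> g) \<in> J"
      by (rule insert.IH) (use insert in auto)
    moreover have eq: "group_ring_of h \<ominus>\<^bsub>group_ring G\<^esub> \<one>\<^bsub>group_ring G\<^esub>
        = (\<lambda>g. group_ring_of h g - group_ring_of \<one> g)"
      using one by (simp add: a_minus_def group_ring_one group_ring_add group_ring_a_inv)
    have w: "(\<lambda>g. group_ring_of h g - group_ring_of \<one> g) \<in> carrier (group_ring G)"
      using hG unfolding eq[symmetric] by simp
    have "add_pow (group_ring G) (u h) (\<lambda>g. group_ring_of h g - group_ring_of \<one> g) \<in> J"
      unfolding eq[symmetric] using insert.prems by (intro Z.additive_subgroup_add_pow[OF J] gen) auto
    then have "(\<lambda>g. u h * (group_ring_of h g - group_ring_of \<one> g)) \<in> J"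
      by (simp add: group_ring_add_pow[OF w])
    ultimately have "(\<lambda>g. ?u g - linear_extension (\<lambda>_. 1) ?u * group_ring_of \<one> g) \<oplus>\<^bsub>group_ring G\<^esub>
        (\<lambda>g. u h * (group_ring_of h g - group_ring_of \<one> g)) \<in> J"
      by (intro J.a_closed)
    also have "(\<lambda>g. ?u g - linear_extension (\<lambda>_. 1) ?u * group_ring_of \<one> g) \<oplus>\<^bsub>group_ring G\<^esub>
        (\<lambda>g. u h * (group_ring_of h g - group_ring_of \<one> g)) = (\<lambda>g. u g - linear_extension (\<lambda>_. 1) u * group_ring_of \<one> g)"
      by (subst (3) u) (auto simp: group_ring_add linear_extension algebra_simps)
    finally show ?case .
  qed
  then have *: "(\<lambda>g. u g - linear_extension (\<lambda>_. 1) u * group_ring_of \<one> g) \<in> J"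
    if "finite {g. u g \<noteq> 0}" "{g. u g \<noteq> 0} \<subseteq> H" for u using that by blast
  show ?thesis
  proof
    fix u assume "u \<in> augmentation_ideal (G\<lparr>carrier := H\<rparr>)"
    then show "u \<in> J" using *[of u] by (simp add: augmentation_ideal_iff group_ring_carrier)
  qed
qed

section \<open>Magnus coefficients on the group ring\<close>

lemma linear_extension_conv_right: "linear_extension (\<lambda>z. conv p (\<mu> z) w) v = conv p (\<lambda>w. linear_extension (\<lambda>z. \<mu> z w) v) w"
  by (induction w arbitrary: p) (simp_all add: linear_extension_fun_add linear_extension_fun_mult)

lemma linear_extension_conv_left: "linear_extension (\<lambda>y. conv (\<mu> y) q w) u = conv (\<lambda>w. linear_extension (\<lambda>y. \<mu> y w) u) q w"
  by (induction w arbitrary: \<mu>) (simp_all add: linear_extension_fun_add linear_extension_fun_mult_right)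

text \<open>In a splitting of a word of length at most \<open>n\<close>, either the left part is
  shorter than \<open>n\<close>, or it is the whole word and the right part is empty. So a factor of
  order \<open>n\<close> times one without constant term has order above \<open>n\<close>.\<close>

lemma conv_eq_zero:
  assumes "\<And>v. length v < n \<Longrightarrow> set v \<subseteq> A \<Longrightarrow> p v = 0" "q [] = 0" "length w \<le> n" "set w \<subseteq> A"
  shows "conv p q w = 0"
  using assms
proof (induction w arbitrary: p n)
  case (Cons a w)
  then obtain m where m: "n = Suc m" by (cases n) auto
  have "conv (\<lambda>v. p (a # v)) q w = 0"
    by (rule Cons.IH[of m]) (use Cons.prems m in auto)
  moreover have "p [] = 0" using Cons.prems(1)[of "[]"] m by simp
  ultimately show ?case by simp
qed simp

context magnus
begin

abbreviation "Z \<equiv> group_ring F"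

interpretation Z: ring Z by (rule group_ring_is_ring)

definition coef :: "nat list \<Rightarrow> ('a \<Rightarrow> int) \<Rightarrow> int" where
  "coef w u = linear_extension (\<lambda>g. \<mu> g w) u"

lemma group_ring_supp: "u \<in> carrier Z \<Longrightarrow> u g \<noteq> 0 \<Longrightarrow> g \<in> carrier F"
  by (auto simp: group_ring_carrier)

text \<open>The linear extension of the expansion is a ring homomorphism into power series.\<close>

lemma coef_mult:
  assumes "u \<in> carrier Z" "v \<in> carrier Z"
  shows "coef w (u \<otimes>\<^bsub>Z\<^esub> v) = conv (\<lambda>w. coef w u) (\<lambda>w. coef w v) w"
proof -
  have "coef w (u \<otimes>\<^bsub>Z\<^esub> v) = linear_extension (\<lambda>y. linear_extension (\<lambda>z. \<mu> (y \<otimes> z) w) v) u"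
    unfolding coef_def by (rule linear_extension_mult[OF assms])
  also have "\<dots> = linear_extension (\<lambda>y. linear_extension (\<lambda>z. conv (\<mu> y) (\<mu> z) w) v) u"
    using assms by (intro linear_extension_cong) (simp add: mu_mult group_ring_supp)
  finally show ?thesis by (simp add: coef_def linear_extension_conv_left linear_extension_conv_right)
qed

lemma coef_add:
  "u \<in> carrier Z \<Longrightarrow> v \<in> carrier Z \<Longrightarrow> coef w (u \<oplus>\<^bsub>Z\<^esub> v) = coef w u + coef w v"
  by (simp add: coef_def group_ring_add linear_extension_add group_ring_carrier)

lemma coef_a_inv: "u \<in> carrier Z \<Longrightarrow> coef w (\<ominus>\<^bsub>Z\<^esub> u) = - coef w u"
  by (simp add: coef_def group_ring_a_inv linear_extension_uminus)

lemma coef_minus: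
  "u \<in> carrier Z \<Longrightarrow> v \<in> carrier Z \<Longrightarrow> coef w (u \<ominus>\<^bsub>Z\<^esub> v) = coef w u - coef w v"
  by (simp add: a_minus_def coef_add coef_a_inv)

lemma coef_zero [simp]: "coef w \<zero>\<^bsub>Z\<^esub> = 0"
  by (simp add: coef_def group_ring_zero)

lemma coef_add_pow:
  assumes "u \<in> carrier Z"
  shows "coef w (add_pow Z (n :: int) u) = n * coef w u"
  by (cases "n = 0") (simp_all add: coef_def linear_extension_def group_ring_add_pow[OF assms] sum_distrib_left mult.assoc)

lemma coef_finsum:
  "finite A \<Longrightarrow> (\<And>a. a \<in> A \<Longrightarrow> v a \<in> carrier Z) \<Longrightarrow>
    coef w (finsum Z v A) = (\<Sum>a\<in>A. coef w (v a))"
  by (induction A rule: finite_induct) (auto simp: Z.finsum_insert coef_add Pi_iff)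

text \<open>The expansion of the identity is idempotent with constant term 1. In its square, once
  all shorter nonempty words are known to have coefficient 0, the coefficient of a nonempty word is
  twice itself, hence 0.\<close>

lemma mu_one: "\<mu> \<one> w = of_bool (w = [])"
proof -
  have *: "conv (\<mu> \<one>) (\<mu> \<one>) = \<mu> \<one>" using mu_mult[of \<one> \<one>] by simp
  show ?thesis
  proof (induction "length w" arbitrary: w rule: less_induct)
    case less
    have split: "conv p q w = p w * q [] + conv (\<lambda>v. if length v < length w then p v else 0) q w"
      for p q :: "nat list \<Rightarrow> int" and w
    proof (induction w arbitrary: p)
      case (Cons a w)
      show ?case using Cons[of "\<lambda>v. p (a # v)"] by simp
    qed simp
    show ?case
    proof (cases w)
      case (Cons a v)
      have "conv (\<lambda>v. if length v < length w then \<mu> \<one> v else 0) (\<mu> \<one>) w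
          = conv (\<lambda>v. of_bool (v = [])) (\<mu> \<one>) w"
        using less Cons by (intro arg_cong[of _ _ "\<lambda>p. conv p (\<mu> \<one>) w"] ext) auto
      with split[of "\<mu> \<one>" "\<mu> \<one>" w] Cons show ?thesis by (simp add: *)
    qed simp
  qed
qed

definition delta :: "'a \<Rightarrow> 'a \<Rightarrow> int" where
  "delta g = group_ring_of g \<ominus>\<^bsub>Z\<^esub> \<one>\<^bsub>Z\<^esub>"

lemma delta_closed [simp]: "g \<in> carrier F \<Longrightarrow> delta g \<in> carrier Z"
  by (simp add: delta_def group_ring_of_closed)

lemma coef_one: "coef w \<one>\<^bsub>Z\<^esub> = of_bool (w = [])"
  by (simp add: group_ring_one coef_def mu_one)

lemma coef_delta: "g \<in> carrier F \<Longrightarrow> coef w (delta g) = \<mu> g w - of_bool (w = [])"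
  by (simp add: delta_def coef_minus group_ring_of_closed coef_one) (simp add: coef_def)

lemma group_ring_of_mult:
  "g \<in> carrier F \<Longrightarrow> h \<in> carrier F \<Longrightarrow> group_ring_of (g \<otimes> h) = group_ring_of g \<otimes>\<^bsub>Z\<^esub> group_ring_of h"
  by (rule ext) (simp add: group_ring_mult, simp add: group_ring_of_def)

lemma delta_mult:
  assumes "g \<in> carrier F" "h \<in> carrier F"
  shows "delta (g \<otimes> h) = delta g \<otimes>\<^bsub>Z\<^esub> group_ring_of h \<oplus>\<^bsub>Z\<^esub> delta h"
  using group_ring_of_closed[OF assms(1)] group_ring_of_closed[OF assms(2)] assms
  unfolding delta_def group_ring_of_mult[OF assms]
  by (simp add: Z.l_distr Z.l_minus a_minus_def Z.a_assoc Z.r_neg1)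

lemma coef_Nil: "u \<in> carrier Z \<Longrightarrow> coef [] u = linear_extension (\<lambda>_. 1) u"
  unfolding coef_def by (rule linear_extension_cong) (simp add: group_ring_supp)

lemma augmentation_ideal_coef: "u \<in> augmentation_ideal F \<longleftrightarrow> u \<in> carrier Z \<and> coef [] u = 0"
  by (auto simp: augmentation_ideal_iff coef_Nil)

lemma augmentation_ideal_subset: "augmentation_ideal F \<subseteq> carrier Z"
  by (auto simp: augmentation_ideal_coef)

lemma augmentation_ideal_mult:
  assumes "u \<in> carrier Z" "v \<in> augmentation_ideal F"
  shows "u \<otimes>\<^bsub>Z\<^esub> v \<in> augmentation_ideal F" "v \<otimes>\<^bsub>Z\<^esub> u \<in> augmentation_ideal F"
  using assms by (auto simp: augmentation_ideal_coef coef_mult)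

text \<open>The \<open>v i\<close> are the Fox derivatives of \<open>u\<close>.\<close>

lemma augmentation_ideal_Fox:
  assumes "u \<in> augmentation_ideal F"
  obtains v where "\<And>i. i \<in> I \<Longrightarrow> v i \<in> carrier Z" "u = finsum Z (\<lambda>i. delta (x i) \<otimes>\<^bsub>Z\<^esub> v i) I"
proof -
  \<comment> \<open>\<open>J\<close> is the right ideal generated by the \<open>delta (x i)\<close>.
    By \<open>delta_mult\<close> the group elements whose \<open>delta\<close> lies in a right ideal
    form a subgroup, and this one contains the generators.\<close>
  define J where "J = {finsum Z (\<lambda>i. delta (x i) \<otimes>\<^bsub>Z\<^esub> v i) I | v. v \<in> I \<rightarrow> carrier Z}"
  have JI: "finsum Z (\<lambda>i. delta (x i) \<otimes>\<^bsub>Z\<^esub> v i) I \<in> J" if "\<And>i. i \<in> I \<Longrightarrow> v i \<in> carrier Z" for v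
    unfolding J_def using that by blast
  have J_sub: "J \<subseteq> carrier Z" unfolding J_def by (auto intro!: Z.finsum_closed)
  have J_add: "a \<oplus>\<^bsub>Z\<^esub> b \<in> J" if ab: "a \<in> J" "b \<in> J" for a b
  proof -
    from ab obtain v v' where v: "a = finsum Z (\<lambda>i. delta (x i) \<otimes>\<^bsub>Z\<^esub> v i) I" "v \<in> I \<rightarrow> carrier Z"
        "b = finsum Z (\<lambda>i. delta (x i) \<otimes>\<^bsub>Z\<^esub> v' i) I" "v' \<in> I \<rightarrow> carrier Z"
      unfolding J_def by blast
    have "a \<oplus>\<^bsub>Z\<^esub> b = finsum Z (\<lambda>i. delta (x i) \<otimes>\<^bsub>Z\<^esub> v i \<oplus>\<^bsub>Z\<^esub> delta (x i) \<otimes>\<^bsub>Z\<^esub> v' i) I"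
      unfolding v by (rule Z.finsum_addf[symmetric]) (use v in \<open>auto simp: Pi_iff\<close>)
    also have "\<dots> = finsum Z (\<lambda>i. delta (x i) \<otimes>\<^bsub>Z\<^esub> (v i \<oplus>\<^bsub>Z\<^esub> v' i)) I"
      by (rule Z.finsum_cong') (use v in \<open>auto simp: Pi_iff Z.r_distr\<close>)
    also have "\<dots> \<in> J" by (rule JI) (use v in auto)
    finally show ?thesis .
  qed
  have J_mult: "a \<otimes>\<^bsub>Z\<^esub> c \<in> J" if a: "a \<in> J" and c: "c \<in> carrier Z" for a c
  proof -
    from a obtain v where v: "a = finsum Z (\<lambda>i. delta (x i) \<otimes>\<^bsub>Z\<^esub> v i) I" "v \<in> I \<rightarrow> carrier Z"
      unfolding J_def by blast
    have "a \<otimes>\<^bsub>Z\<^esub> c = finsum Z (\<lambda>i. delta (x i) \<otimes>\<^bsub>Z\<^esub> v i \<otimes>\<^bsub>Z\<^esub> c) I"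
      unfolding v(1) by (rule Z.finsum_ldistr) (use v c finite_I in auto)
    also have "\<dots> = finsum Z (\<lambda>i. delta (x i) \<otimes>\<^bsub>Z\<^esub> (v i \<otimes>\<^bsub>Z\<^esub> c)) I"
      by (rule Z.finsum_cong') (use v c in \<open>auto simp: Pi_iff Z.m_assoc\<close>)
    also have "\<dots> \<in> J" by (rule JI) (use v c in auto)
    finally show ?thesis .
  qed
  have J_inv: "\<ominus>\<^bsub>Z\<^esub> a \<in> J" if "a \<in> J" for a
  proof -
    have "\<ominus>\<^bsub>Z\<^esub> a = a \<otimes>\<^bsub>Z\<^esub> (\<ominus>\<^bsub>Z\<^esub> \<one>\<^bsub>Z\<^esub>)" using that J_sub by (auto simp: Z.r_minus)
    with J_mult[OF that, of "\<ominus>\<^bsub>Z\<^esub> \<one>\<^bsub>Z\<^esub>"] show ?thesis by simp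
  qed
  have "(\<Oplus>\<^bsub>Z\<^esub>i\<in>I. delta (x i) \<otimes>\<^bsub>Z\<^esub> \<zero>\<^bsub>Z\<^esub>) \<in> J" by (rule JI) simp
  then have J_ne: "J \<noteq> {}" by blast
  have J: "additive_subgroup J Z"
    by (rule additive_subgroup.intro, rule Z.add.subgroupI) (use J_sub J_ne J_add J_inv in auto)
  have J_x: "delta (x a) \<in> J" if a: "a \<in> I" for a
  proof -
    have "(\<Oplus>\<^bsub>Z\<^esub>i\<in>I. delta (x i) \<otimes>\<^bsub>Z\<^esub> (if a = i then \<one>\<^bsub>Z\<^esub> else \<zero>\<^bsub>Z\<^esub>))
        = (\<Oplus>\<^bsub>Z\<^esub>i\<in>I. if a = i then delta (x i) else \<zero>\<^bsub>Z\<^esub>)"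
      by (rule Z.finsum_cong') auto
    also have "\<dots> = delta (x a)"
      by (rule Z.finsum_singleton) (use a finite_I in auto)
    finally show ?thesis using JI[of "\<lambda>i. if a = i then \<one>\<^bsub>Z\<^esub> else \<zero>\<^bsub>Z\<^esub>"] by auto
  qed
  have "subgroup {g \<in> carrier F. delta g \<in> J} F"
  proof (rule subgroupI)
    have "delta \<one> = \<zero>\<^bsub>Z\<^esub>" by (simp add: delta_def Z.r_neg a_minus_def flip: group_ring_one)
    then have "\<one> \<in> {g \<in> carrier F. delta g \<in> J}"
      using additive_subgroup.zero_closed[OF J] by simp
    then show "{g \<in> carrier F. delta g \<in> J} \<noteq> {}" by blast
  next
    fix g h assume "g \<in> {g \<in> carrier F. delta g \<in> J}" "h \<in> {g \<in> carrier F. delta g \<in> J}"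
    then show "g \<otimes> h \<in> {g \<in> carrier F. delta g \<in> J}"
      by (simp add: delta_mult J_add J_mult group_ring_of_closed)
  next
    fix g assume g: "g \<in> {g \<in> carrier F. delta g \<in> J}"
    then have gi: "group_ring_of (inv g) \<in> carrier Z" by (simp add: group_ring_of_closed)
    have "delta (g \<otimes> inv g) = \<zero>\<^bsub>Z\<^esub>"
      using g by (simp add: delta_def Z.r_neg a_minus_def flip: group_ring_one)
    then have "delta (inv g) \<oplus>\<^bsub>Z\<^esub> delta g \<otimes>\<^bsub>Z\<^esub> group_ring_of (inv g) = \<zero>\<^bsub>Z\<^esub>"
      using g gi delta_mult[of g "inv g"] by (simp add: Z.a_comm)
    then have "delta (inv g) = \<ominus>\<^bsub>Z\<^esub> (delta g \<otimes>\<^bsub>Z\<^esub> group_ring_of (inv g))"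
      using g gi Z.minus_equality by (metis (no_types, lifting) Z.m_closed delta_closed inv_closed mem_Collect_eq)
    then show "inv g \<in> {g \<in> carrier F. delta g \<in> J}"
      using g gi by (simp add: J_inv J_mult)
  qed auto
  then have "generate F (x ` I) \<subseteq> {g \<in> carrier F. delta g \<in> J}"
    by (rule generate_subgroup_incl[rotated]) (auto simp: J_x)
  then have "delta g \<in> J" if "g \<in> carrier F" for g using that generate_x by blast
  then have "augmentation_ideal (F\<lparr>carrier := carrier F\<rparr>) \<subseteq> J"
    by (intro augmentation_ideal_least[OF subset_refl J]) (simp add: delta_def)
  then have "u \<in> J" using assms by auto
  then show thesis using that unfolding J_def by blast
qed

text \<open>Powers grow by a factor on the right, whereas Fox derivatives split off a factor on the
  left; associativity reconciles the two.\<close>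

lemma augmentation_ideal_span_power:
  "v \<in> augmentation_ideal F \<Longrightarrow> q \<in> span_power Z (augmentation_ideal F) n \<Longrightarrow>
    v \<otimes>\<^bsub>Z\<^esub> q \<in> span_power Z (augmentation_ideal F) (Suc n)"
proof (induction n arbitrary: q)
  case 0
  \<comment> \<open>The first power is formed as the whole ring times the ideal, hence the extra
    factor 1.\<close>
  then have "\<one>\<^bsub>Z\<^esub> \<otimes>\<^bsub>Z\<^esub> (v \<otimes>\<^bsub>Z\<^esub> q) \<in> span_prod Z (carrier Z) (augmentation_ideal F)"
    by (intro Z.span_prod_incl) (auto intro: augmentation_ideal_mult)
  with 0 augmentation_ideal_subset show ?case by auto
next
  case (Suc n)
  let ?f = "augmentation_ideal F"
  let ?J = "{q \<in> carrier Z. v \<otimes>\<^bsub>Z\<^esub> q \<in> span_power Z ?f (Suc (Suc n))}"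
  have v: "v \<in> carrier Z" using Suc.prems augmentation_ideal_subset by auto
  interpret P: additive_subgroup "span_power Z ?f (Suc (Suc n))" Z
    by (rule Z.span_power_subgroup[OF augmentation_ideal_subset])
  have J: "additive_subgroup ?J Z"
  proof (rule additive_subgroup.intro, rule Z.add.subgroupI)
    have "\<zero>\<^bsub>Z\<^esub> \<in> ?J" using v P.zero_closed by (simp del: span_power.simps)
    then show "?J \<noteq> {}" by blast
  qed (use v P.a_closed P.a_inv_closed in \<open>auto simp: Z.r_distr Z.r_minus simp del: span_power.simps\<close>)
  have "span_prod Z (span_power Z ?f n) ?f \<subseteq> ?J"
  proof (rule Z.span_prod_least[OF J])
    fix p y assume p: "p \<in> span_power Z ?f n" and y: "y \<in> ?f"
    then have py: "p \<in> carrier Z" "y \<in> carrier Z"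
      using Z.span_power_subset[OF augmentation_ideal_subset] augmentation_ideal_subset by auto
    have "v \<otimes>\<^bsub>Z\<^esub> p \<otimes>\<^bsub>Z\<^esub> y \<in> span_power Z ?f (Suc (Suc n))"
      using Suc.IH[OF Suc.prems(1) p] y by (simp add: Z.span_prod_incl)
    then show "p \<otimes>\<^bsub>Z\<^esub> y \<in> ?J" using v py by (simp add: Z.m_assoc)
  qed
  with Suc.prems(2) show ?case by auto
qed

text \<open>Products of elements without constant term have no low coefficients. Conversely, the
  coefficient of \<open>a # w\<close> in an element is that of \<open>w\<close> in its Fox
  derivative at \<open>a\<close>, so if the element vanishes below degree n + 1, its derivatives
  vanish below degree n and induction applies to them.\<close>

lemma span_power_augmentation_ideal:
  "span_power Z (augmentation_ideal F) n =
    {u \<in> carrier Z. \<forall>w. length w < n \<longrightarrow> set w \<subseteq> I \<longrightarrow> coef w u = 0}"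
proof (induction n)
  case (Suc n)
  let ?f = "augmentation_ideal F"
  let ?J = "{u \<in> carrier Z. \<forall>w. length w < Suc n \<longrightarrow> set w \<subseteq> I \<longrightarrow> coef w u = 0}"
  show ?case
  proof
    have J: "additive_subgroup ?J Z"
    proof (rule additive_subgroup.intro, rule Z.add.subgroupI)
      have "\<zero>\<^bsub>Z\<^esub> \<in> ?J" by simp
      then show "?J \<noteq> {}" by blast
    qed (auto simp: coef_add coef_a_inv)
    show "span_power Z ?f (Suc n) \<subseteq> ?J"
      unfolding span_power.simps Suc
    proof (rule Z.span_prod_least[OF J])
      fix p y assume "p \<in> {u \<in> carrier Z. \<forall>w. length w < n \<longrightarrow> set w \<subseteq> I \<longrightarrow> coef w u = 0}" "y \<in> ?f"
      then show "p \<otimes>\<^bsub>Z\<^esub> y \<in> ?J"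
        by (auto simp: augmentation_ideal_coef coef_mult intro!: conv_eq_zero[where n = n and A = I])
    qed
    show "?J \<subseteq> span_power Z ?f (Suc n)"
    proof
      fix u assume u: "u \<in> ?J"
      then have "u \<in> ?f" by (auto simp: augmentation_ideal_coef dest: spec[of _ "[]"])
      then obtain v where v: "\<And>i. i \<in> I \<Longrightarrow> v i \<in> carrier Z" "u = finsum Z (\<lambda>i. delta (x i) \<otimes>\<^bsub>Z\<^esub> v i) I"
        using augmentation_ideal_Fox by blast
      have coef_v: "coef (a # w) u = coef w (v a)" if "a \<in> I" for a w
      proof -
        have "coef (a # w) (delta (x i) \<otimes>\<^bsub>Z\<^esub> v i) = (if i = a then coef w (v i) else 0)" if i: "i \<in> I" for i
        proof -
          have "(\<lambda>w. coef (a # w) (delta (x i))) = (if i = a then (\<lambda>w. of_bool (w = [])) else (\<lambda>w. 0))"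
            using i by (auto simp: coef_delta mu_x magnus_gen_def)
          moreover have "coef [] (delta (x i)) = 0" using i by (simp add: coef_delta)
          ultimately show ?thesis using i v(1) by (simp add: coef_mult)
        qed
        then have "coef (a # w) u = (\<Sum>i\<in>I. if i = a then coef w (v i) else 0)"
          unfolding v(2) using v(1) finite_I by (subst coef_finsum) auto
        then show ?thesis using that finite_I by simp
      qed
      have "v a \<in> span_power Z ?f n" if "a \<in> I" for a
        using u v(1) that unfolding Suc by (auto simp flip: coef_v)
      moreover have "delta (x a) \<in> ?f" if "a \<in> I" for a
        using that by (simp add: augmentation_ideal_coef coef_delta)
      ultimately show "u \<in> span_power Z ?f (Suc n)"
        unfolding v(2)
        by (intro Z.additive_subgroup_finsum Z.span_power_subgroup augmentation_ideal_subset
            augmentation_ideal_span_power finite_I)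
    qed
  qed
qed simp

end

section \<open>Ideals between the third and fourth powers of the augmentation ideal\<close>

context magnus
begin

interpretation Z: ring Z by (rule group_ring_is_ring)

text \<open>Modulo the square of the augmentation ideal, \<open>U\<close> spans the multiples \<open>d i X\<^sub>i\<close>.\<close>

definition linear_exponents :: "('a \<Rightarrow> int) set \<Rightarrow> (nat \<Rightarrow> int) \<Rightarrow> bool" where
  "linear_exponents U d \<longleftrightarrow> U \<subseteq> augmentation_ideal F \<and> (\<forall>u\<in>U. \<forall>i\<in>I. d i dvd coef [i] u) \<and>
     (\<forall>i\<in>I. \<exists>u\<in>U. \<forall>p\<in>I. coef [p] u = (if p = i then d i else 0))"

text \<open>Modulo the fourth power of the augmentation ideal, \<open>U\<close> is spanned by the
  \<open>d i j k X\<^sub>i X\<^sub>j X\<^sub>k\<close>.\<close>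

definition cubic_exponents :: "('a \<Rightarrow> int) set \<Rightarrow> (nat \<Rightarrow> nat \<Rightarrow> nat \<Rightarrow> int) \<Rightarrow> bool" where
  "cubic_exponents U d \<longleftrightarrow> additive_subgroup U Z \<and>
     (\<forall>u\<in>U. coef [] u = 0 \<and> (\<forall>i\<in>I. coef [i] u = 0) \<and> (\<forall>i\<in>I. \<forall>j\<in>I. coef [i, j] u = 0) \<and>
       (\<forall>i\<in>I. \<forall>j\<in>I. \<forall>k\<in>I. d i j k dvd coef [i, j, k] u)) \<and>
     (\<forall>i\<in>I. \<forall>j\<in>I. \<forall>k\<in>I. \<exists>u\<in>U. \<forall>p\<in>I. \<forall>q\<in>I. \<forall>r\<in>I.
       coef [p, q, r] u = (if p = i \<and> q = j \<and> r = k then d i j k else 0))"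

lemma additive_subgroupI_coef:
  assumes "P \<zero>\<^bsub>Z\<^esub>" "\<And>u v. u \<in> carrier Z \<Longrightarrow> v \<in> carrier Z \<Longrightarrow> P u \<Longrightarrow> P v \<Longrightarrow> P (u \<oplus>\<^bsub>Z\<^esub> v)"
    "\<And>u. u \<in> carrier Z \<Longrightarrow> P u \<Longrightarrow> P (\<ominus>\<^bsub>Z\<^esub> u)"
  shows "additive_subgroup {u \<in> carrier Z. P u} Z"
proof (rule additive_subgroup.intro, rule Z.add.subgroupI)
  have "\<zero>\<^bsub>Z\<^esub> \<in> {u \<in> carrier Z. P u}" using assms(1) by simp
  then show "{u \<in> carrier Z. P u} \<noteq> {}" by blast
qed (use assms in auto)

lemma linear_exponents_carrier: "linear_exponents U d \<Longrightarrow> U \<subseteq> carrier Z"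
  unfolding linear_exponents_def using augmentation_ideal_subset by blast

text \<open>The factors have no constant term, so a cubic coefficient of a product of three is the
  product of linear coefficients, and the higher terms of the factors do not reach degree
  three.\<close>

lemma cubic_exponents_prod:
  assumes U: "linear_exponents U d" and V: "linear_exponents V d'" and W: "linear_exponents W d''"
  shows "cubic_exponents (span_prod Z (span_prod Z U V) W) (\<lambda>i j k. d i * d' j * d'' k)"
proof -
  note UZ = linear_exponents_carrier[OF U] and VZ = linear_exponents_carrier[OF V] and WZ = linear_exponents_carrier[OF W]
  note w = U[unfolded linear_exponents_def] V[unfolded linear_exponents_def] W[unfolded linear_exponents_def]
  let ?P2 = "\<lambda>u. coef [] u = 0 \<and> (\<forall>i\<in>I. coef [i] u = 0) \<and> (\<forall>i\<in>I. \<forall>j\<in>I. d i * d' j dvd coef [i, j] u)"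
  let ?P3 = "\<lambda>u. coef [] u = 0 \<and> (\<forall>i\<in>I. coef [i] u = 0) \<and> (\<forall>i\<in>I. \<forall>j\<in>I. coef [i, j] u = 0) \<and>
    (\<forall>i\<in>I. \<forall>j\<in>I. \<forall>k\<in>I. d i * d' j * d'' k dvd coef [i, j, k] u)"
  have aug: "u \<in> carrier Z \<and> coef [] u = 0" if "u \<in> U \<union> V \<union> W" for u
    using that w by (auto simp: augmentation_ideal_coef subset_iff)
  have "span_prod Z U V \<subseteq> {u \<in> carrier Z. ?P2 u}"
  proof (rule Z.span_prod_least)
    show "additive_subgroup {u \<in> carrier Z. ?P2 u} Z"
      by (rule additive_subgroupI_coef) (auto simp: coef_add coef_a_inv)
    fix u v assume u: "u \<in> U" and v: "v \<in> V"
    then show "u \<otimes>\<^bsub>Z\<^esub> v \<in> {u \<in> carrier Z. ?P2 u}"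
      using w aug[of u] aug[of v] by (auto simp: coef_mult mult_dvd_mono)
  qed
  moreover have UV: "additive_subgroup (span_prod Z U V) Z" by (rule Z.span_prod_subgroup[OF UZ VZ])
  ultimately have "span_prod Z (span_prod Z U V) W \<subseteq> {u \<in> carrier Z. ?P3 u}"
  proof (intro Z.span_prod_least)
    show "additive_subgroup {u \<in> carrier Z. ?P3 u} Z"
      by (rule additive_subgroupI_coef) (auto simp: coef_add coef_a_inv)
    fix u v assume sub: "span_prod Z U V \<subseteq> {u \<in> carrier Z. ?P2 u}" and u: "u \<in> span_prod Z U V" and v: "v \<in> W"
    have "u \<in> carrier Z" "?P2 u" using u sub by auto
    then show "u \<otimes>\<^bsub>Z\<^esub> v \<in> {u \<in> carrier Z. ?P3 u}"
      using w v aug[of v] by (auto simp: coef_mult mult_dvd_mono)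
  qed
  moreover have "\<exists>u\<in>span_prod Z (span_prod Z U V) W. \<forall>p\<in>I. \<forall>q\<in>I. \<forall>r\<in>I.
      coef [p, q, r] u = (if p = i \<and> q = j \<and> r = k then d i * d' j * d'' k else 0)"
    if ijk: "i \<in> I" "j \<in> I" "k \<in> I" for i j k
  proof -
    obtain a where a: "a \<in> U" "\<forall>p\<in>I. coef [p] a = (if p = i then d i else 0)" using w(1) ijk by blast
    obtain b where b: "b \<in> V" "\<forall>p\<in>I. coef [p] b = (if p = j then d' j else 0)" using w(2) ijk by blast
    obtain c where c: "c \<in> W" "\<forall>p\<in>I. coef [p] c = (if p = k then d'' k else 0)" using w(3) ijk by blast
    have "a \<otimes>\<^bsub>Z\<^esub> b \<otimes>\<^bsub>Z\<^esub> c \<in> span_prod Z (span_prod Z U V) W"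
      using a b c by (intro Z.span_prod_incl)
    moreover have "coef [p, q, r] (a \<otimes>\<^bsub>Z\<^esub> b \<otimes>\<^bsub>Z\<^esub> c) = coef [p] a * coef [q] b * coef [r] c" for p q r
      using aug[of a] aug[of b] aug[of c] a b c by (simp add: coef_mult)
    ultimately show ?thesis
      using a b c ijk by (intro bexI[of _ "a \<otimes>\<^bsub>Z\<^esub> b \<otimes>\<^bsub>Z\<^esub> c"]) auto
  qed
  ultimately show ?thesis
    unfolding cubic_exponents_def using Z.span_prod_subgroup[OF additive_subgroup.a_subset[OF UV] WZ] by (auto simp: subset_iff)
qed

lemma cubic_exponents_basis:
  assumes "cubic_exponents U d" "i \<in> I" "j \<in> I" "k \<in> I"
  shows "\<exists>u\<in>U. \<forall>p\<in>I. \<forall>q\<in>I. \<forall>r\<in>I.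
      coef [p, q, r] u = (if p = i \<and> q = j \<and> r = k then d i j k else 0)"
  using assms by (simp add: cubic_exponents_def)

text \<open>By Bezout, suitable multiples of the elements realising \<open>d i j k\<close> and
  \<open>d' i j k\<close> add up to one that realises the gcd.\<close>

lemma cubic_exponents_add:
  assumes U: "cubic_exponents U d" and V: "cubic_exponents V d'"
  shows "cubic_exponents (U <+>\<^bsub>Z\<^esub> V) (\<lambda>i j k. gcd (d i j k) (d' i j k))"
proof -
  interpret U: additive_subgroup U Z using U by (simp add: cubic_exponents_def)
  interpret V: additive_subgroup V Z using V by (simp add: cubic_exponents_def)
  have add: "additive_subgroup (U <+>\<^bsub>Z\<^esub> V) Z"
    by (rule Z.add_additive_subgroups) (rule U.additive_subgroup_axioms V.additive_subgroup_axioms)+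
  have mem: "a \<in> U <+>\<^bsub>Z\<^esub> V \<longleftrightarrow> (\<exists>u\<in>U. \<exists>v\<in>V. a = u \<oplus>\<^bsub>Z\<^esub> v)" for a
    by (auto simp: set_add_def set_mult_def)
  have "coef [] a = 0 \<and> (\<forall>i\<in>I. coef [i] a = 0) \<and> (\<forall>i\<in>I. \<forall>j\<in>I. coef [i, j] a = 0) \<and>
      (\<forall>i\<in>I. \<forall>j\<in>I. \<forall>k\<in>I. gcd (d i j k) (d' i j k) dvd coef [i, j, k] a)" if a: "a \<in> U <+>\<^bsub>Z\<^esub> V" for a
  proof -
    obtain u v where uv: "u \<in> U" "v \<in> V" "a = u \<oplus>\<^bsub>Z\<^esub> v" using a unfolding mem by blast
    have "gcd (d i j k) (d' i j k) dvd coef [i, j, k] u + coef [i, j, k] v"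
      if "i \<in> I" "j \<in> I" "k \<in> I" for i j k
      using that uv U V unfolding cubic_exponents_def by (meson dvd_add dvd_trans gcd_dvd1 gcd_dvd2)
    with uv U V show ?thesis by (auto simp: coef_add U.a_Hcarr V.a_Hcarr cubic_exponents_def)
  qed
  moreover have "\<exists>a\<in>U <+>\<^bsub>Z\<^esub> V. \<forall>p\<in>I. \<forall>q\<in>I. \<forall>r\<in>I.
      coef [p, q, r] a = (if p = i \<and> q = j \<and> r = k then gcd (d i j k) (d' i j k) else 0)"
    if ijk: "i \<in> I" "j \<in> I" "k \<in> I" for i j k
  proof -
    obtain u where u: "u \<in> U" "\<forall>p\<in>I. \<forall>q\<in>I. \<forall>r\<in>I.
        coef [p, q, r] u = (if p = i \<and> q = j \<and> r = k then d i j k else 0)"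
      using cubic_exponents_basis[OF U ijk] by blast
    obtain v where v: "v \<in> V" "\<forall>p\<in>I. \<forall>q\<in>I. \<forall>r\<in>I.
        coef [p, q, r] v = (if p = i \<and> q = j \<and> r = k then d' i j k else 0)"
      using cubic_exponents_basis[OF V ijk] by blast
    obtain s t where st: "s * d i j k + t * d' i j k = gcd (d i j k) (d' i j k)"
      using bezout_int by blast
    have su: "add_pow Z s u \<in> U" and tv: "add_pow Z t v \<in> V"
      using u v by (simp_all add: Z.additive_subgroup_add_pow[OF U.additive_subgroup_axioms]
          Z.additive_subgroup_add_pow[OF V.additive_subgroup_axioms])
    show ?thesis
    proof (intro bexI ballI)
      show "add_pow Z s u \<oplus>\<^bsub>Z\<^esub> add_pow Z t v \<in> U <+>\<^bsub>Z\<^esub> V" using su tv unfolding mem by blast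
      fix p q r assume "p \<in> I" "q \<in> I" "r \<in> I"
      then show "coef [p, q, r] (add_pow Z s u \<oplus>\<^bsub>Z\<^esub> add_pow Z t v)
          = (if p = i \<and> q = j \<and> r = k then gcd (d i j k) (d' i j k) else 0)"
        using u v st by (simp add: coef_add coef_add_pow U.a_Hcarr V.a_Hcarr)
    qed
  qed
  ultimately show ?thesis unfolding cubic_exponents_def using add by blast
qed

text \<open>Multiples of the realising elements are added one triple at a time. The purpose is to
  match the whole cubic part of a given group element inside \<open>U\<close>.\<close>

lemma cubic_exponents_realise:
  assumes U: "cubic_exponents U d" and c: "\<And>i j k. i \<in> I \<Longrightarrow> j \<in> I \<Longrightarrow> k \<in> I \<Longrightarrow> d i j k dvd c i j k"
  obtains u where "u \<in> U" "\<And>i j k. i \<in> I \<Longrightarrow> j \<in> I \<Longrightarrow> k \<in> I \<Longrightarrow> coef [i, j, k] u = c i j k"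
proof -
  interpret U: additive_subgroup U Z using U by (simp add: cubic_exponents_def)
  have "\<exists>u\<in>U. \<forall>p\<in>I. \<forall>q\<in>I. \<forall>r\<in>I. coef [p, q, r] u = (if (p, q, r) \<in> A then c p q r else 0)"
    if "finite A" "A \<subseteq> I \<times> I \<times> I" for A
    using that
  proof (induction A)
    case empty
    then show ?case using U.zero_closed by (intro bexI[of _ "\<zero>\<^bsub>Z\<^esub>"]) auto
  next
    case (insert t A)
    obtain i j k where t: "t = (i, j, k)" by (cases t)
    have ijk: "i \<in> I" "j \<in> I" "k \<in> I" using insert.prems t by auto
    obtain u where u: "u \<in> U" "\<forall>p\<in>I. \<forall>q\<in>I. \<forall>r\<in>I. coef [p, q, r] u = (if (p, q, r) \<in> A then c p q r else 0)"
      using insert by auto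
    obtain v where v: "v \<in> U" "\<forall>p\<in>I. \<forall>q\<in>I. \<forall>r\<in>I.
        coef [p, q, r] v = (if p = i \<and> q = j \<and> r = k then d i j k else 0)"
      using cubic_exponents_basis[OF U ijk] by blast
    obtain s where s: "c i j k = d i j k * s" using c[OF ijk] by blast
    have sv: "add_pow Z s v \<in> U" by (rule Z.additive_subgroup_add_pow[OF U.additive_subgroup_axioms v(1)])
    show ?case
    proof (intro bexI ballI)
      show "u \<oplus>\<^bsub>Z\<^esub> add_pow Z s v \<in> U" using u(1) sv by (rule U.a_closed)
      fix p q r assume "p \<in> I" "q \<in> I" "r \<in> I"
      then show "coef [p, q, r] (u \<oplus>\<^bsub>Z\<^esub> add_pow Z s v) = (if (p, q, r) \<in> insert t A then c p q r else 0)"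
        using u v s insert.hyps t by (auto simp: coef_add coef_add_pow U.a_Hcarr)
    qed
  qed
  from this[of "I \<times> I \<times> I"] obtain u where "u \<in> U" "\<forall>p\<in>I. \<forall>q\<in>I. \<forall>r\<in>I. coef [p, q, r] u = c p q r"
    using finite_I by auto
  then show thesis using that by blast
qed

lemma length_less_4_cases:
  assumes "length (w :: nat list) < 4" "set w \<subseteq> A"
  obtains "w = []" | i where "i \<in> A" "w = [i]" | i j where "i \<in> A" "j \<in> A" "w = [i, j]"
    | i j k where "i \<in> A" "j \<in> A" "k \<in> A" "w = [i, j, k]"
  using assms by (auto simp: less_Suc_eq numeral_eq_Suc length_Suc_conv)

text \<open>The fourth power is invisible below degree four, so g = 1 + u + v has the cubic
  coefficients of \<open>u\<close> and none in degrees one and two. Conversely, for \<open>u\<close>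
  with the cubic part of \<open>g\<close>, the remainder g - 1 - u has no coefficient below degree
  four and so lies in the fourth power.\<close>

theorem dimension_subgroup_cubic_exponents:
  assumes U: "cubic_exponents U d"
  shows "ideal_dimension_subgroup F 4 U =
    {g \<in> lower_central F 3. \<forall>i\<in>I. \<forall>j\<in>I. \<forall>k\<in>I. d i j k dvd \<mu> g [i, j, k]}"
proof -
  interpret U: additive_subgroup U Z using U by (simp add: cubic_exponents_def)
  let ?f4 = "span_power Z (augmentation_ideal F) 4"
  have f4: "v \<in> ?f4 \<longleftrightarrow> v \<in> carrier Z \<and> (\<forall>w. length w < 4 \<longrightarrow> set w \<subseteq> I \<longrightarrow> coef w v = 0)" for v
    by (simp only: span_power_augmentation_ideal mem_Collect_eq)
  have mem: "g \<in> ideal_dimension_subgroup F 4 U \<longleftrightarrow>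
      g \<in> carrier F \<and> (\<exists>u\<in>U. \<exists>v\<in>?f4. group_ring_of g = \<one>\<^bsub>Z\<^esub> \<oplus>\<^bsub>Z\<^esub> (u \<oplus>\<^bsub>Z\<^esub> v))" for g
    unfolding ideal_dimension_subgroup_def by (auto simp: set_add_def set_mult_def)
  show ?thesis
  proof (rule Set.set_eqI, rule iffI)
    fix g assume "g \<in> ideal_dimension_subgroup F 4 U"
    then obtain u v where g: "g \<in> carrier F" and u: "u \<in> U" and v: "v \<in> ?f4"
      and eq: "group_ring_of g = \<one>\<^bsub>Z\<^esub> \<oplus>\<^bsub>Z\<^esub> (u \<oplus>\<^bsub>Z\<^esub> v)" unfolding mem by blast
    have vZ: "v \<in> carrier Z" and v0: "\<And>w. length w < 4 \<Longrightarrow> set w \<subseteq> I \<Longrightarrow> coef w v = 0"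
      using v unfolding f4 by auto
    have "\<mu> g w = coef w (group_ring_of g)" for w by (simp add: coef_def)
    then have mu: "\<mu> g w = coef w u" if "w \<noteq> []" "length w < 4" "set w \<subseteq> I" for w
      using that u vZ v0 by (simp add: eq coef_add coef_one U.a_Hcarr)
    have "g \<in> lower_central F 3"
      by (rule lower_central_3I[OF g]) (use mu u U in \<open>auto simp: cubic_exponents_def\<close>)
    with mu u U show "g \<in> {g \<in> lower_central F 3. \<forall>i\<in>I. \<forall>j\<in>I. \<forall>k\<in>I. d i j k dvd \<mu> g [i, j, k]}"
      by (auto simp: cubic_exponents_def)
  next
    fix g assume g: "g \<in> {g \<in> lower_central F 3. \<forall>i\<in>I. \<forall>j\<in>I. \<forall>k\<in>I. d i j k dvd \<mu> g [i, j, k]}"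
    then have gF: "g \<in> carrier F" by (simp add: lower_central_3_carrier)
    obtain u where u: "u \<in> U" "\<And>i j k. i \<in> I \<Longrightarrow> j \<in> I \<Longrightarrow> k \<in> I \<Longrightarrow> coef [i, j, k] u = \<mu> g [i, j, k]"
      using cubic_exponents_realise[OF U, of "\<lambda>i j k. \<mu> g [i, j, k]"] g by auto
    define v where "v = delta g \<ominus>\<^bsub>Z\<^esub> u"
    have uZ: "u \<in> carrier Z" using u(1) by (rule U.a_Hcarr)
    have magnus_kernel_3: "g \<in> magnus_kernel_3" using g lower_central_3_magnus_kernel_3 by auto
    have "coef w v = 0" if "length w < 4" "set w \<subseteq> I" for w
      using that
    proof (cases rule: length_less_4_cases)
    qed (use gF uZ u U magnus_kernel_3 in \<open>auto simp: v_def coef_minus coef_delta cubic_exponents_def magnus_kernel_3_def magnus_kernel_2_def\<close>)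
    moreover have "v \<in> carrier Z" using uZ gF by (simp add: v_def)
    ultimately have "v \<in> ?f4" unfolding f4 by blast
    moreover have "group_ring_of g = \<one>\<^bsub>Z\<^esub> \<oplus>\<^bsub>Z\<^esub> (u \<oplus>\<^bsub>Z\<^esub> v)"
    proof -
      have gZ: "group_ring_of g \<in> carrier Z" using gF by (rule group_ring_of_closed)
      have "u \<oplus>\<^bsub>Z\<^esub> v = delta g"
        using uZ gF by (simp add: v_def a_minus_def Z.a_lcomm[of u "delta g"] Z.r_neg)
      then show ?thesis
        using gZ by (simp add: delta_def a_minus_def Z.a_lcomm[of "\<one>\<^bsub>Z\<^esub>" "group_ring_of g"] Z.r_neg)
    qed
    ultimately show "g \<in> ideal_dimension_subgroup F 4 U" unfolding mem using gF u(1) by blast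
  qed
qed

end

section \<open>The four dimension subgroups\<close>

lemma (in group) generated_modulo_subgroup:
  assumes "N \<lhd> G" "T \<subseteq> carrier G"
  shows "subgroup (generated_modulo G N T) G" "N \<subseteq> generated_modulo G N T" "T \<subseteq> generated_modulo G N T"
proof -
  interpret N: normal N G by fact
  have T: "subgroup (generate G T) G" by (rule generate_is_subgroup[OF assms(2)])
  have "generated_modulo G N T = N <#> generate G T"
    unfolding generated_modulo_def using commut_normal[OF T assms(1)] .
  then show "subgroup (generated_modulo G N T) G"
    using mult_norm_subgroup[OF assms(1) T] by simp
  show "N \<subseteq> generated_modulo G N T"
  proof
    fix n assume n: "n \<in> N"
    then have "\<one> \<otimes> n \<in> generated_modulo G N T"
      unfolding generated_modulo_def set_mult_def using generate.one by blast
    with n show "n \<in> generated_modulo G N T" by simp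
  qed
  show "T \<subseteq> generated_modulo G N T"
  proof
    fix t assume t: "t \<in> T"
    then have "t \<otimes> \<one> \<in> generated_modulo G N T"
      unfolding generated_modulo_def set_mult_def using generate.incl[of t T G] N.one_closed by blast
    with t assms(2) show "t \<in> generated_modulo G N T" by (simp add: subset_iff)
  qed
qed

lemma (in group) generated_modulo_least:
  assumes "subgroup H G" "N \<subseteq> H" "T \<subseteq> H"
  shows "generated_modulo G N T \<subseteq> H"
proof -
  have "generate G T \<subseteq> H" by (rule generate_subgroup_incl[OF assms(3,1)])
  then show ?thesis
    unfolding generated_modulo_def set_mult_def using assms(2) subgroup.m_closed[OF assms(1)] by auto
qed

lemma (in group) int_pow_dvd_closed:
  assumes "subgroup H G" "g \<in> carrier G" "g [^] (d :: int) \<in> H" "d dvd n"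
  shows "g [^] n \<in> H"
proof -
  from assms(4) obtain s where "n = d * s" ..
  then have "g [^] n = (g [^] d) [^] s" using assms(2) by (simp add: int_pow_pow)
  then show ?thesis using subgroup_int_pow_closed[OF assms(1,3)] by simp
qed

context magnus
begin

interpretation Z: ring Z by (rule group_ring_is_ring)

lemma linear_exponents_augmentation_ideal: "linear_exponents (augmentation_ideal F) (\<lambda>_. 1)"
  unfolding linear_exponents_def
proof (intro conjI ballI)
  fix i assume i: "i \<in> I"
  show "\<exists>u\<in>augmentation_ideal F. \<forall>p\<in>I. coef [p] u = (if p = i then 1 else 0)"
    using i by (intro bexI[of _ "delta (x i)"]) (auto simp: coef_delta mu_x1 augmentation_ideal_coef)
qed auto

lemma mu1_int_pow: "g \<in> carrier F \<Longrightarrow> \<mu> (g [^] (n::int)) [i] = n * \<mu> g [i]"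
  by (rule int_pow_additive[OF subgroup_self, of g "\<lambda>u. \<mu> u [i]"]) (simp_all add: mu_mult1)

lemma mu3_mult:
  "g \<in> lower_central F 3 \<Longrightarrow> h \<in> lower_central F 3 \<Longrightarrow> \<mu> (g \<otimes> h) [p, q, r] = \<mu> g [p, q, r] + \<mu> h [p, q, r]"
  using lower_central_3_magnus_kernel_3 by (auto simp: mu_mult3 magnus_kernel_3_def magnus_kernel_2_def subset_iff)

lemma mu3_int_pow:
  "g \<in> lower_central F 3 \<Longrightarrow> \<mu> (g [^] (n::int)) [p, q, r] = n * \<mu> g [p, q, r]"
  by (rule int_pow_additive[OF normal_imp_subgroup[OF lower_central_normal[of 3]], of g "\<lambda>u. \<mu> u [p, q, r]"])
    (simp_all add: mu3_mult)

lemma dvd_mu3_subgroup: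
  "subgroup {g \<in> lower_central F 3. \<forall>i\<in>I. \<forall>j\<in>I. \<forall>k\<in>I. d i j k dvd \<mu> g [i, j, k]} F"
proof -
  have "{g \<in> lower_central F 3. \<forall>i\<in>I. \<forall>j\<in>I. \<forall>k\<in>I. d i j k dvd \<mu> g [i, j, k]} =
    {g \<in> lower_central F 3. \<forall>t\<in>I \<times> I \<times> I. (\<lambda>(i, j, k). d i j k) t dvd (\<lambda>(i, j, k) g. \<mu> g [i, j, k]) t g}"
    by auto
  also have "subgroup \<dots> F"
    by (rule subgroup_dvd_additive[OF normal_imp_subgroup[OF lower_central_normal]]) (auto simp: mu3_mult)
  finally show ?thesis .
qed

lemma lower_central_4_dvd_mu3:
  "lower_central F 4 \<subseteq> {g \<in> lower_central F 3. \<forall>i\<in>I. \<forall>j\<in>I. \<forall>k\<in>I. d i j k dvd \<mu> g [i, j, k]}"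
  using lower_central_4_subset_3 lower_central_4_mu3 by auto

section \<open>Powers of basic commutators with divisible coefficients\<close>

lemma basic_commutator_pow_lower_central_3:
  "j \<in> I \<Longrightarrow> i \<in> I \<Longrightarrow> k \<in> I \<Longrightarrow> basic_commutator (j, i, k) [^] (n::int) \<in> lower_central F 3"
  using subgroup_int_pow_closed[OF normal_imp_subgroup[OF lower_central_normal[of 3]]]
  by (simp add: triple_commutator_lower_central_3)

text \<open>Each hypothesis belongs to one of the four monomials of [[X_j, X_i], X_k], which occur
  with coefficients 1 or -1. If indices coincide, such terms are merely added, so the criterion
  remains sufficient.\<close>

lemma basic_commutator_pow_dvd:
  assumes "j \<in> I" "i \<in> I" "k \<in> I"
    and d: "d j i k dvd n" "d i j k dvd n" "d k j i dvd n" "d k i j dvd n"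
  shows "basic_commutator (j, i, k) [^] (n::int) \<in> {g \<in> lower_central F 3. \<forall>i\<in>I. \<forall>j\<in>I. \<forall>k\<in>I. d i j k dvd \<mu> g [i, j, k]}"
proof (intro CollectI conjI ballI)
  show "basic_commutator (j, i, k) [^] n \<in> lower_central F 3" using assms by (intro basic_commutator_pow_lower_central_3)
  fix p q r
  have "d p q r dvd n * of_bool (p = j \<and> q = i \<and> r = k)" "d p q r dvd n * of_bool (p = i \<and> q = j \<and> r = k)"
      "d p q r dvd n * of_bool (p = k \<and> q = j \<and> r = i)" "d p q r dvd n * of_bool (p = k \<and> q = i \<and> r = j)"
    using d by auto
  then have "d p q r dvd n * of_bool (p = j \<and> q = i \<and> r = k) - n * of_bool (p = i \<and> q = j \<and> r = k)
      - (n * of_bool (p = k \<and> q = j \<and> r = i) - n * of_bool (p = k \<and> q = i \<and> r = j))"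
    by (intro dvd_diff)
  also have "\<dots> = n * \<mu> (basic_commutator (j, i, k)) [p, q, r]"
    using assms by (simp add: mu_basic_commutator of_bool_conj algebra_simps)
  finally show "d p q r dvd \<mu> (basic_commutator (j, i, k) [^] n) [p, q, r]"
    using assms by (simp add: mu3_int_pow triple_commutator_lower_central_3)
qed

text \<open>For \<open>k = j\<close> two of the four monomials merge into 2 X_j X_i X_j, so there a
  condition on \<open>2 * n\<close> is enough.\<close>

lemma basic_commutator_pow_dvd_upper:
  assumes "j \<in> I" "i \<in> I" "i \<noteq> j"
    and d: "d j i j dvd 2 * n" "d i j j dvd n" "d j j i dvd n"
  shows "basic_commutator (j, i, j) [^] (n::int) \<in> {g \<in> lower_central F 3. \<forall>i\<in>I. \<forall>j\<in>I. \<forall>k\<in>I. d i j k dvd \<mu> g [i, j, k]}"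
proof (intro CollectI conjI ballI)
  show "basic_commutator (j, i, j) [^] n \<in> lower_central F 3" using assms by (intro basic_commutator_pow_lower_central_3)
  fix p q r
  have "d p q r dvd 2 * n * of_bool (p = j \<and> q = i \<and> r = j)" "d p q r dvd n * of_bool (p = i \<and> q = j \<and> r = j)"
      "d p q r dvd n * of_bool (p = j \<and> q = j \<and> r = i)"
    using d by auto
  then have "d p q r dvd 2 * n * of_bool (p = j \<and> q = i \<and> r = j) - n * of_bool (p = i \<and> q = j \<and> r = j)
      - n * of_bool (p = j \<and> q = j \<and> r = i)"
    by (intro dvd_diff)
  also have "\<dots> = n * \<mu> (basic_commutator (j, i, j)) [p, q, r]"
    using assms by (simp add: mu_basic_commutator of_bool_conj algebra_simps)
  finally show "d p q r dvd \<mu> (basic_commutator (j, i, j) [^] n) [p, q, r]"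
    using assms by (simp add: mu3_int_pow triple_commutator_lower_central_3)
qed

text \<open>The mirror case: for \<open>k = i\<close> two monomials merge into -2 X_i X_j
  X_i.\<close>

lemma basic_commutator_pow_dvd_lower:
  assumes "j \<in> I" "i \<in> I" "i \<noteq> j"
    and d: "d j i i dvd n" "d i i j dvd n" "d i j i dvd 2 * n"
  shows "basic_commutator (j, i, i) [^] (n::int) \<in> {g \<in> lower_central F 3. \<forall>i\<in>I. \<forall>j\<in>I. \<forall>k\<in>I. d i j k dvd \<mu> g [i, j, k]}"
proof (intro CollectI conjI ballI)
  show "basic_commutator (j, i, i) [^] n \<in> lower_central F 3" using assms by (intro basic_commutator_pow_lower_central_3)
  fix p q r
  have "d p q r dvd n * of_bool (p = j \<and> q = i \<and> r = i)" "d p q r dvd 2 * n * of_bool (p = i \<and> q = j \<and> r = i)"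
      "d p q r dvd n * of_bool (p = i \<and> q = i \<and> r = j)"
    using d by auto
  then have "d p q r dvd n * of_bool (p = j \<and> q = i \<and> r = i) - 2 * n * of_bool (p = i \<and> q = j \<and> r = i)
      + n * of_bool (p = i \<and> q = i \<and> r = j)"
    by (intro dvd_diff dvd_add)
  also have "\<dots> = n * \<mu> (basic_commutator (j, i, i)) [p, q, r]"
    using assms by (simp add: mu_basic_commutator of_bool_conj algebra_simps)
  finally show "d p q r dvd \<mu> (basic_commutator (j, i, i) [^] n) [p, q, r]"
    using assms by (simp add: mu3_int_pow triple_commutator_lower_central_3)
qed

lemma basic_commutator_carrier: "j \<in> I \<Longrightarrow> i \<in> I \<Longrightarrow> k \<in> I \<Longrightarrow> basic_commutator (j, i, k) \<in> carrier F"
  by simp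

section \<open>The linear part of the ideal of R\<close>

context
  fixes e :: "nat \<Rightarrow> int" and R S :: "'a set"
  assumes chain: "\<And>i j. i \<in> I \<Longrightarrow> j \<in> I \<Longrightarrow> i \<le> j \<Longrightarrow> e j dvd e i"
    and S_def: "S = generate F ({x i [^] e i | i. i \<in> I} \<union> lower_central F 2)"
    and R_normal: "R \<lhd> F"
    and R_S: "R <#> lower_central F 2 = S"
begin

abbreviation (input) "f \<equiv> augmentation_ideal F"
abbreviation (input) "r \<equiv> augmentation_ideal (F\<lparr>carrier := R\<rparr>)"

lemma R_carrier: "g \<in> R \<Longrightarrow> g \<in> carrier F"
  by (rule subgroup.mem_carrier[OF normal_imp_subgroup[OF R_normal]])

lemma R_mu1:
  assumes g: "g \<in> R" and i: "i \<in> I"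
  shows "e i dvd \<mu> g [i]"
proof -
  let ?H = "{g \<in> carrier F. \<forall>i\<in>I. e i dvd \<mu> g [i]}"
  have "\<one> \<in> lower_central F 2"
    by (rule subgroup.one_closed[OF normal_imp_subgroup[OF lower_central_normal]])
  then have "g \<otimes> \<one> \<in> S" unfolding R_S[symmetric] set_mult_def using g by blast
  moreover have "S \<subseteq> ?H"
    unfolding S_def
  proof (rule generate_subgroup_incl)
    show "subgroup ?H F"
      by (rule subgroup_dvd_additive[OF subgroup_self, of I "\<lambda>i g. \<mu> g [i]" e]) (simp add: mu_mult1)
    show "{x i [^] e i |i. i \<in> I} \<union> lower_central F 2 \<subseteq> ?H"
      using lower_central_2_carrier lower_central_2_mu1 by (auto simp: mu1_int_pow mu_x1)
  qed
  ultimately show ?thesis using i R_carrier[OF g] by auto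
qed

text \<open>The power \<open>x i [^] e i\<close> may lie outside \<open>R\<close>, but it lies in
  \<open>S\<close>, so some element of \<open>R\<close> differs from it by a factor in the second
  term, which has no linear coefficients.\<close>

lemma R_basis:
  assumes i: "i \<in> I"
  obtains g where "g \<in> R" "\<And>p. \<mu> g [p] = (if p = i then e i else 0)"
proof -
  have "x i [^] e i \<in> S" unfolding S_def using i by (auto intro: generate.incl)
  then obtain g y where gy: "g \<in> R" "y \<in> lower_central F 2" "x i [^] e i = g \<otimes> y"
    unfolding R_S[symmetric] set_mult_def by blast
  have "\<mu> (x i [^] e i) [p] = \<mu> g [p]" for p
    unfolding gy(3) using gy(1,2) R_carrier lower_central_2_carrier lower_central_2_mu1 by (simp add: mu_mult1)
  then have "\<mu> g [p] = (if p = i then e i else 0)" for p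
    using i by (simp add: mu1_int_pow mu_x1 flip: \<open>\<And>p. \<mu> (x i [^] e i) [p] = \<mu> g [p]\<close>)
  with gy(1) show thesis using that by blast
qed

text \<open>The ideal is spanned by the differences \<open>delta g\<close> with \<open>g\<close> in
  \<open>R\<close>, whose linear coefficients are those of \<open>g\<close>; so both requirements
  reduce to \<open>R_mu1\<close> and \<open>R_basis\<close>.\<close>

lemma linear_exponents_r: "linear_exponents r e"
  unfolding linear_exponents_def
proof (intro conjI ballI)
  have Rsub: "R \<subseteq> carrier F" using R_carrier by blast
  let ?J = "{u \<in> carrier Z. coef [] u = 0 \<and> (\<forall>i\<in>I. e i dvd coef [i] u)}"
  have J: "additive_subgroup ?J Z"
    by (rule additive_subgroupI_coef) (auto simp: coef_add coef_a_inv)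
  have "r \<subseteq> ?J"
  proof (rule augmentation_ideal_least[OF Rsub J])
    fix g assume g: "g \<in> R"
    then have "delta g \<in> ?J" using R_carrier R_mu1 by (simp add: coef_delta)
    then show "group_ring_of g \<ominus>\<^bsub>Z\<^esub> \<one>\<^bsub>Z\<^esub> \<in> ?J" by (simp add: delta_def)
  qed
  then show "r \<subseteq> f" "\<And>u i. u \<in> r \<Longrightarrow> i \<in> I \<Longrightarrow> e i dvd coef [i] u"
    by (auto simp: augmentation_ideal_coef)
  fix i assume "i \<in> I"
  then obtain g where g: "g \<in> R" "\<And>p. \<mu> g [p] = (if p = i then e i else 0)" by (rule R_basis) blast
  have gF: "g \<in> carrier F" using g R_carrier by blast
  have "{h. delta g h \<noteq> 0} \<subseteq> R"
    using g(1) subgroup.one_closed[OF normal_imp_subgroup[OF R_normal]]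
    unfolding delta_def a_minus_def group_ring_one group_ring_add
      group_ring_a_inv[OF group_ring_of_closed[OF one_closed]]
    by (auto simp: group_ring_of_def split: if_splits)
  moreover have "linear_extension (\<lambda>_. 1) (delta g) = 0"
    using gF coef_Nil[of "delta g"] by (simp add: coef_delta)
  ultimately have "delta g \<in> r"
    using delta_closed[OF gF] by (simp add: augmentation_ideal_iff group_ring_carrier)
  then show "\<exists>u\<in>r. \<forall>p\<in>I. coef [p] u = (if p = i then e i else 0)"
    using g gF by (intro bexI[of _ "delta g"]) (auto simp: coef_delta)
qed

section \<open>The four cases\<close>

lemma dimension_frf:
  "ideal_dimension_subgroup F 4 (f \<bullet>\<^bsub>Z\<^esub> r \<bullet>\<^bsub>Z\<^esub> f) =
     generated_modulo F (lower_central F 4)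
       ({basic_commutator (j, i, k) [^] e i | i j k. i \<in> I \<and> j \<in> I \<and> k \<in> I \<and> i < j} \<union>
        {basic_commutator (j, i, j) [^] n | i j n. i \<in> I \<and> j \<in> I \<and> i < j \<and> e j dvd n \<and> e i dvd 2 * n})"
    (is "?D = generated_modulo F ?N ?T")
proof -
  define d where "d = (\<lambda>(i::nat) (j::nat) (k::nat). e j)"
  have D: "?D = {g \<in> lower_central F 3. \<forall>i\<in>I. \<forall>j\<in>I. \<forall>k\<in>I. d i j k dvd \<mu> g [i, j, k]}"
    using dimension_subgroup_cubic_exponents[OF cubic_exponents_prod[OF linear_exponents_augmentation_ideal linear_exponents_r linear_exponents_augmentation_ideal]]
    by (simp add: d_def)
  have T: "?T \<subseteq> carrier F" by auto
  note gm = generated_modulo_subgroup[OF lower_central_normal T, of 4]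
  show ?thesis
  proof
    show "?D \<subseteq> generated_modulo F ?N ?T"
    proof
      fix g assume "g \<in> ?D"
      then have g: "g \<in> lower_central F 3" and dvd: "\<And>i j k. i \<in> I \<Longrightarrow> j \<in> I \<Longrightarrow> k \<in> I \<Longrightarrow> e j dvd \<mu> g [i, j, k]"
        unfolding D d_def by auto
      show "g \<in> generated_modulo F ?N ?T"
      proof (rule mem_of_hall_decomposition'[OF gm(1,2) g])
        fix t assume t: "t \<in> hall_triples'"
        obtain j i k where jik: "t = (j, i, k)" by (cases t)
        have I: "j \<in> I" "i \<in> I" "k \<in> I" "i < j" "k \<le> j" using t by (auto simp: jik hall_triples'_def)
        show "basic_commutator t [^] hall_coeff' g t \<in> generated_modulo F ?N ?T"
        proof (cases "k = j")
          case True
          \<comment> \<open>X_j X_i X_j has middle letter \<open>i\<close>, and its coefficient is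
            -2 times that of X_i X_j X_j.\<close>
          have "e i dvd 2 * - \<mu> g [i, j, j]"
            using dvd[of j i j] lower_central_3_relation[OF g, of j i] I by simp
          moreover have "e j dvd - \<mu> g [i, j, j]" using dvd[of i j j] I by simp
          ultimately have "basic_commutator (j, i, j) [^] (- \<mu> g [i, j, j]) \<in> ?T" using I by blast
          from subsetD[OF gm(3) this] show ?thesis using True by (simp add: jik hall_coeff'_def)
        next
          case False
          \<comment> \<open>The coordinate is the coefficient of X_k X_i X_j, whose middle letter
            \<open>i\<close> gives exactly the exponent of this generator.\<close>
          have "basic_commutator (j, i, k) [^] e i \<in> ?T" using I by blast
          then have "basic_commutator (j, i, k) [^] \<mu> g [k, i, j] \<in> generated_modulo F ?N ?T"
            using int_pow_dvd_closed[OF gm(1) basic_commutator_carrier _ dvd] gm(3) I by blast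
          then show ?thesis using False by (simp add: jik hall_coeff'_def)
        qed
      qed
    qed
    show "generated_modulo F ?N ?T \<subseteq> ?D"
      unfolding D
    proof (rule generated_modulo_least[OF dvd_mu3_subgroup lower_central_4_dvd_mu3], rule Un_least)
      \<comment> \<open>The four monomials have middle letters \<open>i\<close> and
        \<open>j\<close>, and \<open>e j\<close> divides \<open>e i\<close>.\<close>
      show "{basic_commutator (j, i, k) [^] e i | i j k. i \<in> I \<and> j \<in> I \<and> k \<in> I \<and> i < j} \<subseteq>
        {g \<in> lower_central F 3. \<forall>i\<in>I. \<forall>j\<in>I. \<forall>k\<in>I. d i j k dvd \<mu> g [i, j, k]}"
        by (rule subsetI, elim CollectE exE conjE, hypsubst, rule basic_commutator_pow_dvd; simp add: d_def chain)
      show "{basic_commutator (j, i, j) [^] n | i j n. i \<in> I \<and> j \<in> I \<and> i < j \<and> e j dvd n \<and> e i dvd 2 * n} \<subseteq>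
        {g \<in> lower_central F 3. \<forall>i\<in>I. \<forall>j\<in>I. \<forall>k\<in>I. d i j k dvd \<mu> g [i, j, k]}"
        by (rule subsetI, elim CollectE exE conjE, hypsubst, rule basic_commutator_pow_dvd_upper; simp add: d_def)
    qed
  qed
qed

text \<open>Here the outer letters carry the condition. The usual basis fits, since its coordinate
  at X_i X_j X_k has outer letters \<open>i\<close> and \<open>k\<close>, matching the exponent
  \<open>e i * e k\<close>.\<close>

lemma dimension_rfr:
  "ideal_dimension_subgroup F 4 (r \<bullet>\<^bsub>Z\<^esub> f \<bullet>\<^bsub>Z\<^esub> r) =
     generated_modulo F (lower_central F 4)
       ({basic_commutator (j, i, k) [^] (e i * e k) | i j k. i \<in> I \<and> j \<in> I \<and> k \<in> I \<and> i < j} \<union>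
        {basic_commutator (j, i, i) [^] n | i j n. i \<in> I \<and> j \<in> I \<and> i < j \<and> e j * e i dvd n \<and> (e i)\<^sup>2 dvd 2 * n})"
    (is "?D = generated_modulo F ?N ?T")
proof -
  define d where "d = (\<lambda>(i::nat) (j::nat) (k::nat). e i * e k)"
  have D: "?D = {g \<in> lower_central F 3. \<forall>i\<in>I. \<forall>j\<in>I. \<forall>k\<in>I. d i j k dvd \<mu> g [i, j, k]}"
    using dimension_subgroup_cubic_exponents[OF cubic_exponents_prod[OF linear_exponents_r linear_exponents_augmentation_ideal linear_exponents_r]]
    by (simp add: d_def)
  have T: "?T \<subseteq> carrier F" by auto
  note gm = generated_modulo_subgroup[OF lower_central_normal T, of 4]
  show ?thesis
  proof
    show "?D \<subseteq> generated_modulo F ?N ?T"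
    proof
      fix g assume "g \<in> ?D"
      then have g: "g \<in> lower_central F 3" and dvd: "\<And>i j k. i \<in> I \<Longrightarrow> j \<in> I \<Longrightarrow> k \<in> I \<Longrightarrow> e i * e k dvd \<mu> g [i, j, k]"
        unfolding D d_def by auto
      show "g \<in> generated_modulo F ?N ?T"
      proof (rule mem_of_hall_decomposition[OF gm(1,2) g])
        fix t assume t: "t \<in> hall_triples"
        obtain j i k where jik: "t = (j, i, k)" by (cases t)
        have I: "j \<in> I" "i \<in> I" "k \<in> I" "i < j" "i \<le> k" using t by (auto simp: jik hall_triples_def)
        show "basic_commutator t [^] hall_coeff g t \<in> generated_modulo F ?N ?T"
        proof (cases "k = i")
          case True
          \<comment> \<open>X_i X_j X_i has \<open>i\<close> at both ends, and its coefficient is -2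
            times that of X_j X_i X_i.\<close>
          have "(e i)\<^sup>2 dvd 2 * \<mu> g [j, i, i]"
            using dvd[of i j i] lower_central_3_relation[OF g, of i j] I by (simp add: power2_eq_square)
          moreover have "e j * e i dvd \<mu> g [j, i, i]" using dvd[of j i i] I by simp
          ultimately have "basic_commutator (j, i, i) [^] \<mu> g [j, i, i] \<in> ?T" using I by blast
          from subsetD[OF gm(3) this] show ?thesis using True by (simp add: jik hall_coeff_def)
        next
          case False
          have "basic_commutator (j, i, k) [^] (e i * e k) \<in> ?T" using I by blast
          moreover have "e i * e k dvd - \<mu> g [i, j, k]" using dvd[of i j k] I by simp
          ultimately have "basic_commutator (j, i, k) [^] (- \<mu> g [i, j, k]) \<in> generated_modulo F ?N ?T"
            using int_pow_dvd_closed[OF gm(1) basic_commutator_carrier] gm(3) I by blast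
          then show ?thesis using False by (simp add: jik hall_coeff_def)
        qed
      qed
    qed
    show "generated_modulo F ?N ?T \<subseteq> ?D"
      unfolding D
    proof (rule generated_modulo_least[OF dvd_mu3_subgroup lower_central_4_dvd_mu3], rule Un_least)
      show "{basic_commutator (j, i, k) [^] (e i * e k) | i j k. i \<in> I \<and> j \<in> I \<and> k \<in> I \<and> i < j} \<subseteq>
        {g \<in> lower_central F 3. \<forall>i\<in>I. \<forall>j\<in>I. \<forall>k\<in>I. d i j k dvd \<mu> g [i, j, k]}"
        by (rule subsetI, elim CollectE exE conjE, hypsubst, rule basic_commutator_pow_dvd; simp add: d_def chain mult_dvd_mono mult.commute)
      show "{basic_commutator (j, i, i) [^] n | i j n. i \<in> I \<and> j \<in> I \<and> i < j \<and> e j * e i dvd n \<and> (e i)\<^sup>2 dvd 2 * n} \<subseteq>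
        {g \<in> lower_central F 3. \<forall>i\<in>I. \<forall>j\<in>I. \<forall>k\<in>I. d i j k dvd \<mu> g [i, j, k]}"
        by (rule subsetI, elim CollectE exE conjE, hypsubst, rule basic_commutator_pow_dvd_lower; simp add: d_def power2_eq_square mult.commute)
    qed
  qed
qed

text \<open>The sum of the two ideals yields the gcd of the exponents at the two ends of a monomial,
  which by the divisibility chain is, up to sign, the exponent of the larger end index. For X_i X_j
  X_k with \<open>i < k\<close> this is \<open>e k\<close>.\<close>

lemma dimension_ffr_rff:
  "ideal_dimension_subgroup F 4 (f \<bullet>\<^bsub>Z\<^esub> f \<bullet>\<^bsub>Z\<^esub> r <+>\<^bsub>Z\<^esub> r \<bullet>\<^bsub>Z\<^esub> f \<bullet>\<^bsub>Z\<^esub> f) =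
     generated_modulo F (lower_central F 4)
       {basic_commutator (j, i, k) [^] n | i j k n. i \<in> I \<and> j \<in> I \<and> k \<in> I \<and> i < j \<and> i \<le> k \<and>
          (k \<noteq> i \<longrightarrow> e k dvd n) \<and> (k = i \<longrightarrow> e j dvd n \<and> e i dvd 2 * n)}"
    (is "?D = generated_modulo F ?N ?T")
proof -
  define d where "d = (\<lambda>(i::nat) (j::nat) (k::nat). gcd (e k) (e i))"
  have D: "?D = {g \<in> lower_central F 3. \<forall>i\<in>I. \<forall>j\<in>I. \<forall>k\<in>I. d i j k dvd \<mu> g [i, j, k]}"
    using dimension_subgroup_cubic_exponents[OF cubic_exponents_add[OF
          cubic_exponents_prod[OF linear_exponents_augmentation_ideal linear_exponents_augmentation_ideal linear_exponents_r]
          cubic_exponents_prod[OF linear_exponents_r linear_exponents_augmentation_ideal linear_exponents_augmentation_ideal]]]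
    by (simp add: d_def)
  have T: "?T \<subseteq> carrier F" by auto
  note gm = generated_modulo_subgroup[OF lower_central_normal T, of 4]
  show ?thesis
  proof
    show "?D \<subseteq> generated_modulo F ?N ?T"
    proof
      fix g assume "g \<in> ?D"
      then have g: "g \<in> lower_central F 3"
        and dvd: "\<And>i j k. i \<in> I \<Longrightarrow> j \<in> I \<Longrightarrow> k \<in> I \<Longrightarrow> gcd (e k) (e i) dvd \<mu> g [i, j, k]"
        unfolding D d_def by auto
      show "g \<in> generated_modulo F ?N ?T"
      proof (rule mem_of_hall_decomposition[OF gm(1,2) g])
        fix t assume t: "t \<in> hall_triples"
        obtain j i k where jik: "t = (j, i, k)" by (cases t)
        have I: "j \<in> I" "i \<in> I" "k \<in> I" "i < j" "i \<le> k" using t by (auto simp: jik hall_triples_def)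
        have "e k dvd hall_coeff g (j, i, k)" if "k \<noteq> i"
        proof -
          have "e k dvd gcd (e k) (e i)" using chain[of i k] I by simp
          with dvd[of i j k] that I show ?thesis
            using dvd_trans[of "e k" "gcd (e k) (e i)" "\<mu> g [i, j, k]"] by (simp add: hall_coeff_def)
        qed
        moreover have "e j dvd hall_coeff g (j, i, k) \<and> e i dvd 2 * hall_coeff g (j, i, k)" if "k = i"
        proof -
          have "e j dvd gcd (e i) (e j)" using chain[of i j] I by simp
          with dvd[of j i i] I have "e j dvd \<mu> g [j, i, i]"
            using dvd_trans[of "e j" "gcd (e i) (e j)" "\<mu> g [j, i, i]"] by simp
          moreover have "e i dvd 2 * \<mu> g [j, i, i]"
            using dvd[of i j i] lower_central_3_relation[OF g, of i j] I by simp
          ultimately show ?thesis using that by (simp add: hall_coeff_def)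
        qed
        ultimately have "basic_commutator (j, i, k) [^] hall_coeff g (j, i, k) \<in> ?T"
          using I by (intro CollectI exI[of _ i] exI[of _ j] exI[of _ k] exI[of _ "hall_coeff g (j, i, k)"]) simp
        from subsetD[OF gm(3) this] show "basic_commutator t [^] hall_coeff g t \<in> generated_modulo F ?N ?T"
          by (simp only: jik)
      qed
    qed
    show "generated_modulo F ?N ?T \<subseteq> ?D"
      unfolding D
    proof (rule generated_modulo_least[OF dvd_mu3_subgroup lower_central_4_dvd_mu3], clarify)
      fix i j k n
      assume I: "i \<in> I" "j \<in> I" "k \<in> I" "i < j" "i \<le> k"
        and n: "k \<noteq> i \<longrightarrow> e k dvd n" "k = i \<longrightarrow> e j dvd n \<and> e i dvd 2 * n"
      have "basic_commutator (j, i, k) [^] n \<in> {g \<in> lower_central F 3. \<forall>i\<in>I. \<forall>j\<in>I. \<forall>k\<in>I. d i j k dvd \<mu> g [i, j, k]}"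
      proof (cases "k = i")
        case True
        have "basic_commutator (j, i, i) [^] n \<in> {g \<in> lower_central F 3. \<forall>i\<in>I. \<forall>j\<in>I. \<forall>k\<in>I. d i j k dvd \<mu> g [i, j, k]}"
        proof (rule basic_commutator_pow_dvd_lower)
          show "d j i i dvd n" "d i i j dvd n" "d i j i dvd 2 * n"
            using n(2) True unfolding d_def by (auto intro: dvd_trans)
        qed (use I in auto)
        then show ?thesis using True by simp
      next
        case False
        then have "e k dvd n" using n by blast
        \<comment> \<open>Every monomial of [[X_j, X_i], X_k] has X_k at one end, so each of the
          gcds divides \<open>e k\<close>.\<close>
        then have "gcd (e k) c dvd n" "gcd c (e k) dvd n" for c by (auto intro: dvd_trans)
        then show ?thesis using I by (intro basic_commutator_pow_dvd) (auto simp: d_def)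
      qed
      then show "(commutator F (commutator F (x j) (x i)) (x k)) [^] n \<in> lower_central F 3 \<and>
          (\<forall>a\<in>I. \<forall>b\<in>I. \<forall>c\<in>I. d a b c dvd \<mu> (commutator F (commutator F (x j) (x i)) (x k) [^] n) [a, b, c])"
        by simp
    qed
  qed
qed

text \<open>The basic commutator to the power \<open>e j * e k\<close> agrees, modulo the fourth
  term, with a commutator [[a, x_i], b] where \<open>a\<close> and \<open>b\<close> lie in
  \<open>R\<close> and have linear parts e_j X_j and e_k X_k. The opposite inclusion multiplies
  divisibilities of quadratic and linear coefficients.\<close>

lemma dimension_rrf_rfr_frr:
  "ideal_dimension_subgroup F 4 (r \<bullet>\<^bsub>Z\<^esub> r \<bullet>\<^bsub>Z\<^esub> f <+>\<^bsub>Z\<^esub> r \<bullet>\<^bsub>Z\<^esub> f \<bullet>\<^bsub>Z\<^esub> r <+>\<^bsub>Z\<^esub> f \<bullet>\<^bsub>Z\<^esub> r \<bullet>\<^bsub>Z\<^esub> r) =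
     commutator_subgroup F (commutator_subgroup F (carrier F) R) R <#> lower_central F 4"
    (is "?D = commutator_subgroup F ?FR R <#> ?N")
proof -
  let ?T = "{commutator F u k | u k. u \<in> ?FR \<and> k \<in> R}"
  define d where "d = (\<lambda>(i::nat) (j::nat) (k::nat). gcd (gcd (e i * e j) (e i * e k)) (e j * e k))"
  have D: "?D = {g \<in> lower_central F 3. \<forall>i\<in>I. \<forall>j\<in>I. \<forall>k\<in>I. d i j k dvd \<mu> g [i, j, k]}"
    using dimension_subgroup_cubic_exponents[OF cubic_exponents_add[OF cubic_exponents_add[OF
          cubic_exponents_prod[OF linear_exponents_r linear_exponents_r linear_exponents_augmentation_ideal]
          cubic_exponents_prod[OF linear_exponents_r linear_exponents_augmentation_ideal linear_exponents_r]]
          cubic_exponents_prod[OF linear_exponents_augmentation_ideal linear_exponents_r linear_exponents_r]]]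
    by (simp add: d_def)
  have K: "commutator_subgroup F ?FR R <#> ?N = generated_modulo F ?N ?T"
    by (simp add: generated_modulo_def commutator_subgroup_def[of F ?FR R])
  \<comment> \<open>In a quadratic coefficient of a commutator with an element of \<open>R\<close>,
    either letter may come from \<open>R\<close>, so only the gcd of the two exponents is certain to
    divide.\<close>
  let ?H = "{u \<in> lower_central F 2. \<forall>t\<in>I \<times> I. (\<lambda>(p, q). gcd (e p) (e q)) t dvd (\<lambda>(p, q) u. \<mu> u [p, q]) t u}"
  have H: "subgroup ?H F"
    by (rule subgroup_dvd_additive[OF normal_imp_subgroup[OF lower_central_normal]])
      (auto simp: mu_mult2 lower_central_2_carrier lower_central_2_mu1)
  have "?FR \<subseteq> ?H"
    unfolding commutator_subgroup_def[of F "carrier F"]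
  proof (rule generate_subgroup_incl[OF _ H], clarify)
    fix g k assume g: "g \<in> carrier F" and k: "k \<in> R"
    have "commutator F g k \<in> lower_central F 2"
      unfolding lower_central_2 using g R_carrier[OF k] by (auto intro: generate.incl)
    moreover have "gcd (e p) (e q) dvd \<mu> (commutator F g k) [p, q]" if "p \<in> I" "q \<in> I" for p q
    proof -
      have "gcd (e p) (e q) dvd \<mu> k [p]" "gcd (e p) (e q) dvd \<mu> k [q]"
        using R_mu1[OF k that(1)] R_mu1[OF k that(2)] by (auto intro: dvd_trans)
      then show ?thesis using g R_carrier[OF k] by (simp add: mu_commutator2)
    qed
    ultimately show "commutator F g k \<in> lower_central F 2 \<and>
        (\<forall>t\<in>I \<times> I. (case t of (p, q) \<Rightarrow> gcd (e p) (e q)) dvd (case t of (p, q) \<Rightarrow> \<lambda>u. \<mu> u [p, q]) (commutator F g k))"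
      by auto
  qed
  then have FR: "u \<in> lower_central F 2" "\<And>p q. p \<in> I \<Longrightarrow> q \<in> I \<Longrightarrow> gcd (e p) (e q) dvd \<mu> u [p, q]"
    if "u \<in> ?FR" for u using that by auto
  have T: "?T \<subseteq> carrier F" using FR lower_central_2_carrier R_carrier by auto
  note gm = generated_modulo_subgroup[OF lower_central_normal T, of 4]
  show ?thesis
    unfolding K
  proof
    show "?D \<subseteq> generated_modulo F ?N ?T"
    proof
      fix g assume "g \<in> ?D"
      then have g: "g \<in> lower_central F 3"
        and dvd: "\<And>i j k. i \<in> I \<Longrightarrow> j \<in> I \<Longrightarrow> k \<in> I \<Longrightarrow> d i j k dvd \<mu> g [i, j, k]"
        unfolding D by auto
      show "g \<in> generated_modulo F ?N ?T"
      proof (rule mem_of_hall_decomposition[OF gm(1,2) g])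
        fix t assume t: "t \<in> hall_triples"
        obtain j i k where jik: "t = (j, i, k)" by (cases t)
        have I: "j \<in> I" "i \<in> I" "k \<in> I" "i < j" "i \<le> k" using t by (auto simp: jik hall_triples_def)
        \<comment> \<open>As \<open>i\<close> is the smallest index, \<open>e j * e k\<close>
          divides each of the three products whose gcd is \<open>d i j k\<close>.\<close>
        have "e j dvd e i" "e k dvd e i" using I chain by auto
        then have "e j * e k dvd d i j k" "k = i \<Longrightarrow> e j * e k dvd d j i i"
          by (auto simp: d_def mult.commute intro: mult_dvd_mono)
        then have e: "e j * e k dvd hall_coeff g t"
          using dvd[of i j k] dvd[of j i i] I dvd_trans by (auto simp: jik hall_coeff_def)
        obtain a where a: "a \<in> R" "\<And>p. \<mu> a [p] = (if p = j then e j else 0)" by (rule R_basis[OF I(1)]) blast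
        obtain b where b: "b \<in> R" "\<And>p. \<mu> b [p] = (if p = k then e k else 0)" by (rule R_basis[OF I(3)]) blast
        let ?h = "commutator F (commutator F a (x i)) b"
        let ?y = "basic_commutator (j, i, k) [^] (e j * e k)"
        have aF: "a \<in> carrier F" and bF: "b \<in> carrier F" using a b R_carrier by auto
        have h3: "?h \<in> lower_central F 3" using aF bF I by (intro triple_commutator_lower_central_3) auto
        have y3: "?y \<in> lower_central F 3" using I by (intro basic_commutator_pow_lower_central_3)
        interpret L3: subgroup "lower_central F 3" F by (rule normal_imp_subgroup[OF lower_central_normal])
        \<comment> \<open>\<open>?h\<close> and \<open>?y\<close> have the same cubic coefficients,
          \<open>e j * e k\<close> times those of the basic commutator, so their quotient falls into
          the fourth term.\<close>
        have "\<mu> (inv ?h \<otimes> ?y) [p, q, r] = 0" for p q r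
        proof -
          have "\<mu> ?y [p, q, r] = \<mu> (?h \<otimes> (inv ?h \<otimes> ?y)) [p, q, r]"
            using h3 y3 L3.mem_carrier by simp
          also have "\<dots> = \<mu> ?h [p, q, r] + \<mu> (inv ?h \<otimes> ?y) [p, q, r]"
            using h3 y3 by (intro mu3_mult) auto
          also have "\<mu> ?h [p, q, r] = \<mu> ?y [p, q, r]"
            using aF bF I a(2) b(2)
            by (simp add: mu3_int_pow triple_commutator_lower_central_3 mu_triple_commutator mu_x1 algebra_simps)
          finally show ?thesis by simp
        qed
        then have "inv ?h \<otimes> ?y \<in> lower_central F 4"
          using h3 y3 by (intro lower_central_4I) auto
        then have n: "inv ?h \<otimes> ?y \<in> generated_modulo F ?N ?T" using gm(2) by blast
        \<comment> \<open>Generators of the inner commutator subgroup carry the element of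
          \<open>R\<close> on the right, so the commutator of \<open>a\<close> with
          \<open>x i\<close> is reached as an inverse.\<close>
        have "commutator F (x i) a \<in> ?FR"
          unfolding commutator_subgroup_def[of F "carrier F"] using a(1) x_closed[OF I(2)] by (blast intro: generate.incl)
        moreover have "subgroup ?FR F"
          unfolding commutator_subgroup_def[of F "carrier F"]
          by (rule generate_is_subgroup) (use R_carrier in auto)
        ultimately have "commutator F a (x i) \<in> ?FR"
          using inv_commutator[of "x i" a] aF I subgroup.m_inv_closed by fastforce
        then have "?h \<in> generated_modulo F ?N ?T" using gm(3) b(1) by blast
        then have "?h \<otimes> (inv ?h \<otimes> ?y) \<in> generated_modulo F ?N ?T"
          using n subgroup.m_closed[OF gm(1)] by blast
        then have "?y \<in> generated_modulo F ?N ?T" using h3 y3 L3.mem_carrier by simp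
        then show "basic_commutator t [^] hall_coeff g t \<in> generated_modulo F ?N ?T"
          using int_pow_dvd_closed[OF gm(1) basic_commutator_carrier _ e] I unfolding jik by blast
      qed
    qed
    show "generated_modulo F ?N ?T \<subseteq> ?D"
      unfolding D
    proof (rule generated_modulo_least[OF dvd_mu3_subgroup lower_central_4_dvd_mu3], clarify)
      fix u k assume u: "u \<in> ?FR" and k: "k \<in> R"
      have kF: "k \<in> carrier F" by (rule R_carrier[OF k])
      have "commutator F u k \<in> lower_central F 3"
        unfolding lower_central_3 using FR(1)[OF u] kF by (auto intro: generate.incl)
      moreover have "d p q r dvd \<mu> (commutator F u k) [p, q, r]" if pqr: "p \<in> I" "q \<in> I" "r \<in> I" for p q r
      proof -
        have d: "d p q r dvd e p * e q" "d p q r dvd e p * e r" "d p q r dvd e q * e r"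
          unfolding d_def by (rule dvd_trans[OF gcd_dvd1 gcd_dvd1], rule dvd_trans[OF gcd_dvd1 gcd_dvd2], rule gcd_dvd2)
        \<comment> \<open>Bezout writes the gcd times \<open>c\<close> as a combination of the
          products \<open>a * c\<close> and \<open>b * c\<close>.\<close>
        have gcd_dvd: "d p q r dvd gcd a b * c" if "d p q r dvd a * c" "d p q r dvd b * c" for a b c
        proof -
          obtain s t where "s * a + t * b = gcd a b" using bezout_int by blast
          then have "gcd a b * c = s * (a * c) + t * (b * c)" by (simp add: algebra_simps flip: \<open>s * a + t * b = gcd a b\<close>)
          with that show ?thesis by simp
        qed
        have "d p q r dvd gcd (e p) (e q) * e r" using d by (intro gcd_dvd)
        moreover have "d p q r dvd gcd (e q) (e r) * e p" using d by (intro gcd_dvd) (simp_all add: mult.commute)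
        moreover have "gcd (e p) (e q) * e r dvd \<mu> u [p, q] * \<mu> k [r]"
          using FR(2)[OF u pqr(1,2)] R_mu1[OF k pqr(3)] by (rule mult_dvd_mono)
        moreover have "gcd (e q) (e r) * e p dvd \<mu> u [q, r] * \<mu> k [p]"
          using FR(2)[OF u pqr(2,3)] R_mu1[OF k pqr(1)] by (rule mult_dvd_mono)
        ultimately have "d p q r dvd \<mu> u [p, q] * \<mu> k [r]" "d p q r dvd \<mu> u [q, r] * \<mu> k [p]"
          by (blast intro: dvd_trans)+
        then have "d p q r dvd \<mu> u [p, q] * \<mu> k [r] - \<mu> u [q, r] * \<mu> k [p]" by (rule dvd_diff)
        then show ?thesis
          using FR(1)[OF u] kF
          by (simp add: mu_commutator3 lower_central_2_carrier lower_central_2_mu1 mult.commute)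
      qed
      ultimately show "commutator F u k \<in> lower_central F 3 \<and>
          (\<forall>i\<in>I. \<forall>j\<in>I. \<forall>ka\<in>I. d i j ka dvd \<mu> (commutator F u k) [i, j, ka])" by blast
    qed
  qed
qed

end

end

theorem theorem5:
  fixes F :: "('a, 'b) monoid_scheme" and m :: nat and x :: "nat \<Rightarrow> 'a" and e :: "nat \<Rightarrow> int"
    and R S :: "'a set" and f r :: "('a \<Rightarrow> int) set"
    and Z (structure) and D and c
  defines "Z \<equiv> group_ring F"
    and "f \<equiv> augmentation_ideal F"
    and "r \<equiv> augmentation_ideal (F\<lparr>carrier := R\<rparr>)"
    and "D \<equiv> ideal_dimension_subgroup F 4"
    and "c \<equiv> \<lambda>j i k. commutator F (commutator F (x j) (x i)) (x k)"
  assumes free: "free_group_on F {1..m} x"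
    and nonneg: "\<forall>i\<in>{1..m}. 0 \<le> e i"
    and chain: "\<forall>i\<in>{1..<m}. e (Suc i) dvd e i"
    and S_def: "S = generate F ({x i [^]\<^bsub>F\<^esub> e i | i. i \<in> {1..m}} \<union> lower_central F 2)"
    and R_normal: "R \<lhd> F"
    and R_S: "R <#>\<^bsub>F\<^esub> lower_central F 2 = S"
  shows
    "D (f \<bullet> r \<bullet> f) =
       generated_modulo F (lower_central F 4)
         ({c j i k [^]\<^bsub>F\<^esub> e i | i j k. i \<in> {1..m} \<and> j \<in> {1..m} \<and> k \<in> {1..m} \<and> i < j} \<union>
          {c j i j [^]\<^bsub>F\<^esub> n | i j n. i \<in> {1..m} \<and> j \<in> {1..m} \<and> i < j \<and>
             e j dvd n \<and> e i dvd 2 * n}) \<and>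
     D (r \<bullet> f \<bullet> r) =
       generated_modulo F (lower_central F 4)
         ({c j i k [^]\<^bsub>F\<^esub> (e i * e k) | i j k.
             i \<in> {1..m} \<and> j \<in> {1..m} \<and> k \<in> {1..m} \<and> i < j} \<union>
          {c j i i [^]\<^bsub>F\<^esub> n | i j n. i \<in> {1..m} \<and> j \<in> {1..m} \<and> i < j \<and>
             e j * e i dvd n \<and> (e i)\<^sup>2 dvd 2 * n}) \<and>
     D (r \<bullet> r \<bullet> f <+>\<^bsub>Z\<^esub> r \<bullet> f \<bullet> r <+>\<^bsub>Z\<^esub> f \<bullet> r \<bullet> r) =
       commutator_subgroup F (commutator_subgroup F (carrier F) R) R <#>\<^bsub>F\<^esub> lower_central F 4 \<and>
     D (f \<bullet> f \<bullet> r <+>\<^bsub>Z\<^esub> r \<bullet> f \<bullet> f) =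
       generated_modulo F (lower_central F 4)
         {c j i k [^]\<^bsub>F\<^esub> n | i j k n. i \<in> {1..m} \<and> j \<in> {1..m} \<and> k \<in> {1..m} \<and> i < j \<and> i \<le> k \<and>
            (k \<noteq> i \<longrightarrow> e k dvd n) \<and> (k = i \<longrightarrow> e j dvd n \<and> e i dvd 2 * n)}"
proof -
  let ?I = "{1..m}"
  obtain \<mu> where \<mu>: "\<And>g. g \<in> carrier F \<Longrightarrow> \<mu> g [] = 1"
    "\<And>g h. g \<in> carrier F \<Longrightarrow> h \<in> carrier F \<Longrightarrow> \<mu> (g \<otimes>\<^bsub>F\<^esub> h) = conv (\<mu> g) (\<mu> h)"
    "\<And>i. i \<in> ?I \<Longrightarrow> \<mu> (x i) = magnus_gen i"
    by (rule magnus_expansion[OF free]) (rule that)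
  interpret magnus F ?I x \<mu>
  proof (intro magnus.intro magnus_axioms.intro)
    show "group F" using free by (simp add: free_group_on_def)
    show "generate F (x ` ?I) = carrier F" by (rule free_group_generate[OF free])
    show "x i \<in> carrier F" if "i \<in> ?I" for i using free that by (auto simp: free_group_on_def)
  qed (use \<mu> in auto)
  have chain': "e j dvd e i" if "i \<in> ?I" "j \<in> ?I" "i \<le> j" for i j
    using that(3,1,2)
  proof (induction j rule: dec_induct)
    case (step j)
    then have "e (Suc j) dvd e j" using chain by auto
    with step show ?case using dvd_trans by auto
  qed simp
  note facts = chain' S_def R_normal R_S
  show ?thesis
    using dimension_frf[OF facts] dimension_rfr[OF facts] dimension_rrf_rfr_frr[OF facts]
      dimension_ffr_rff[OF facts]
    unfolding Z_def f_def r_def D_def c_def by (simp only: prod.case simp_thms)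
qed

end
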